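(* Let $A_1,A_2\in\mathbb{R}^{n\times n}$ and $c\in\mathbb{R}^n$ with $c\neq0$, and consider the bimodal piecewise linear system determined by these data (see context; this is the bimodal piecewise affine system with $e_1=e_2=0$ and $f=0$). Let $h_i$ be the observability index of $(c^T,A_i)$, $i=1,2$. Then every Filippov solution of the system is right-unique if and only if the following statements all hold: 1. $h_1=h_2$. 2. There exists an $(h_1+1)\times(h_1+1)$ lower triangular matrix $M$ with positive diagonal elements such that $$\begin{bmatrix}c^T\\ c^TA_1\\ \vdots\\ c^TA_1^{h_1}\end{bmatrix}=M\begin{bmatrix}c^T\\ c^TA_2\\ \vdots\\ c^TA_2^{h_1}\end{bmatrix}.$$ 3. For all $x\in\mathbb{R}^n$, the following implication holds: $$\begin{bmatrix}c^T\\ c^TA_1\\ \vdots\\ c^TA_1^{h_1}\end{bmatrix}x=0\ \Rightarrow\ A_1x=A_2x.$$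
   Context: Define the set-valued mapping $G(x)=\{A_1x\}$ if $c^Tx<0$, $G(x)=\operatorname{conv}\{A_1x,A_2x\}$ if $c^Tx=0$, $G(x)=\{A_2x\}$ if $c^Tx>0$. A function $x:\mathbb{R}\to\mathbb{R}^n$, absolutely continuous on every compact interval, is a Filippov solution for the initial state $\xi$ if $x(0)=\xi$ and $\dot x(t)\in G(x(t))$ for almost all $t\in\mathbb{R}$. A Filippov solution $x$ for the initial state $\xi$ is right-unique if for any Filippov solution $x'$ for the initial state $\xi$ there exists $\epsilon>0$ such that $x(t)=x'(t)$ for all $t\in[0,\epsilon)$. The observability index $h_i$ of $(c^T,A_i)$ is the largest integer such that the matrix with rows $c^T,c^TA_i,\dots,c^TA_i^{h_i}$ has full row rank. *)

theory Defs
  imports "HOL-Analysis.Analysis"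
begin

text \<open>The usual epsilon-delta notion: the elements of \<open>D\<close> are finitely many non-overlapping
  closed subintervals \<open>{Inf K..Sup K}\<close> of \<open>{a..b}\<close>.\<close>

definition absolutely_continuous_on_Icc ::
    "real \<Rightarrow> real \<Rightarrow> (real \<Rightarrow> 'a::real_normed_vector) \<Rightarrow> bool" where
  "absolutely_continuous_on_Icc a b f \<longleftrightarrow>
     (\<forall>\<epsilon>>0. \<exists>\<delta>>0. \<forall>D. D division_of \<Union>D \<and> \<Union>D \<subseteq> {a..b} \<and> (\<Sum>K\<in>D. Sup K - Inf K) < \<delta> \<longrightarrow>
        (\<Sum>K\<in>D. norm (f (Sup K) - f (Inf K))) < \<epsilon>)"

definition filippov_map ::
    "real^'n \<Rightarrow> real^'n^'n \<Rightarrow> real^'n^'n \<Rightarrow> real^'n \<Rightarrow> (real^'n) set" where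
  "filippov_map c A\<^sub>1 A\<^sub>2 x =
     (if c \<bullet> x < 0 then {A\<^sub>1 *v x}
      else if c \<bullet> x = 0 then convex hull {A\<^sub>1 *v x, A\<^sub>2 *v x}
      else {A\<^sub>2 *v x})"

definition filippov_solution ::
    "real^'n \<Rightarrow> real^'n^'n \<Rightarrow> real^'n^'n \<Rightarrow> real^'n \<Rightarrow> (real \<Rightarrow> real^'n) \<Rightarrow> bool" where
  "filippov_solution c A\<^sub>1 A\<^sub>2 \<xi> x \<longleftrightarrow>
     (\<forall>a b. absolutely_continuous_on_Icc a b x) \<and> x 0 = \<xi> \<and>
     (AE t in lebesgue. \<exists>v\<in>filippov_map c A\<^sub>1 A\<^sub>2 (x t). (x has_vector_derivative v) (at t))"

definition filippov_right_unique ::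
    "real^'n \<Rightarrow> real^'n^'n \<Rightarrow> real^'n^'n \<Rightarrow> real^'n \<Rightarrow> (real \<Rightarrow> real^'n) \<Rightarrow> bool" where
  "filippov_right_unique c A\<^sub>1 A\<^sub>2 \<xi> x \<longleftrightarrow>
     (\<forall>x'. filippov_solution c A\<^sub>1 A\<^sub>2 \<xi> x' \<longrightarrow> (\<exists>\<epsilon>>0. \<forall>t\<in>{0..<\<epsilon>}. x t = x' t))"

text \<open>The type class operation \<open>^\<close> on \<open>real^'n^'n\<close> is the componentwise power,
  hence this definition.\<close>

definition matrix_power :: "real^'n^'n \<Rightarrow> nat \<Rightarrow> real^'n^'n" where
  "matrix_power A k = (((**) A) ^^ k) (mat 1)"

text \<open>Row \<open>k\<close>, counted from 0, of the observability matrices. Their number of rows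
  varies, so a matrix with rows \<open>0, \<dots>, h\<close> is represented by the restriction of
  \<open>obs_row c A\<close> to \<open>{..h}\<close>.\<close>

definition obs_row :: "real^'n \<Rightarrow> real^'n^'n \<Rightarrow> nat \<Rightarrow> real^'n" where
  "obs_row c A k = c v* matrix_power A k"

text \<open>Full row rank: the row rank, i.e. the dimension of the span of the rows, equals
  the number \<open>h + 1\<close> of rows. The greatest element exists whenever \<open>c \<noteq> 0\<close>: \<open>h = 0\<close>
  qualifies, and any qualifying \<open>h\<close> is less than \<open>CARD('n)\<close>.\<close>

definition observability_index :: "real^'n \<Rightarrow> real^'n^'n \<Rightarrow> nat" where
  "observability_index c A = (GREATEST h. dim (obs_row c A ` {..h}) = h + 1)"

end

theory Submission
  imports Defs
begin

text \<open>Call a sequence lexicographically negative if its first nonzero entry is negative. Along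
  \<open>x' = A x\<close>, the functions \<open>z j = c\<^sup>T A\<^sup>j x\<close> satisfy \<open>z j' = z (j + 1)\<close>, so \<open>c\<^sup>T x\<close> becomes negative at once
  iff \<open>(c\<^sup>T A\<^sup>j \<xi>)\<close> is lexicographically negative. If uniqueness holds, a state from which both
  modes could be followed must give the same trajectory in both; hence the cones of
  lexicographically negative states of the two modes coincide, which forces the triangular relation
  between the rows and \<open>A\<^sub>1 = A\<^sub>2\<close> on the common kernel. A short piece of a mode is a Filippov solution
  only if it extends to the whole real line; Euler polygons provide the extension.
  Conversely, the triangular relation makes the \<open>z j\<close> solve, up to lower triangular terms, a chain
  \<open>z j' = a z (j + 1)\<close> with \<open>a > 0\<close> along every Filippov solution, so all solutions from \<open>\<xi>\<close> enter
  the same mode and agree by a Gronwall estimate; on the common kernel the modes coincide, and the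
  distance to the solution staying there obeys a Gronwall estimate, too.\<close>

section \<open>Absolutely continuous functions\<close>

text \<open>Filippov solutions are only absolutely continuous with a derivative almost everywhere,
  so every estimate rests on the fundamental theorem of calculus for such functions. Conversely, a
  constructed curve is a solution only once its almost everywhere differentiability is proved;
  Vitali coverings give it for Lipschitz curves. Velocities are tested by half-spaces
  \<open>p \<bullet> v \<ge> b\<close>: such conditions survive the limit of the Euler scheme and,
  by separation, determine the closed convex set of admissible velocities. The positive diagonal of
  \<open>M\<close> keeps all convex combinations of the modes pointing the same way: mode one sends
  \<open>z j\<close> to \<open>z (j + 1)\<close>, mode two sends it to
  \<open>M j j / M (j + 1) (j + 1)\<close> times \<open>z (j + 1)\<close> up to \<open>z 0\<close>,
  ..., \<open>z j\<close>, so every mixture has a coefficient bounded away from 0. The cones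
  coincide by contraposition: a state negative for mode one but not for mode two starts one curve
  with \<open>c \<bullet> x < 0\<close> and another with \<open>c \<bullet> x \<ge> 0\<close>.
  Trajectories of a single mode are Filippov solutions for two equal matrices, so one existence
  theorem serves throughout.\<close>

lemma absolutely_continuous_on_IccD:
  assumes "absolutely_continuous_on_Icc a b f" "\<epsilon> > 0"
  obtains \<delta> where "\<delta> > 0"
    "\<And>D. \<lbrakk>D division_of \<Union>D; \<Union>D \<subseteq> {a..b}; (\<Sum>K\<in>D. Sup K - Inf K) < \<delta>\<rbrakk>
      \<Longrightarrow> (\<Sum>K\<in>D. norm (f (Sup K) - f (Inf K))) < \<epsilon>"
  using assms unfolding absolutely_continuous_on_Icc_def by meson

lemma division_real_elem:
  fixes D :: "real set set"
  assumes "D division_of S" "K \<in> D"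
  shows "Inf K \<le> Sup K" "Inf K \<in> K" "Sup K \<in> K" "K = {Inf K..Sup K}"
proof -
  obtain u v where K: "K = cbox u v" "K \<noteq> {}"
    using division_ofD(3,4)[OF assms] by blast
  then show "Inf K \<le> Sup K" "Inf K \<in> K" "Sup K \<in> K" "K = {Inf K..Sup K}"
    by auto
qed

text \<open>A domination principle: with \<open>f\<close> the identity it covers Lipschitz
  functions, with \<open>g\<close> a bounded linear image of \<open>f\<close> it covers components
  of a curve.\<close>

lemma absolutely_continuous_on_Icc_le:
  assumes f: "absolutely_continuous_on_Icc a b f" and "L \<ge> 0"
    and le: "\<And>u v. \<lbrakk>u \<in> {a..b}; v \<in> {a..b}\<rbrakk> \<Longrightarrow> norm (g v - g u) \<le> L * norm (f v - f u)"
  shows "absolutely_continuous_on_Icc a b g"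
  unfolding absolutely_continuous_on_Icc_def
proof (intro allI impI)
  fix e :: real assume "e > 0"
  \<comment> \<open>\<open>L + 1\<close> instead of \<open>L\<close>, which may be 0; it also makes
    the final inequality strict.\<close>
  then have e1: "e / (L + 1) > 0" using \<open>L \<ge> 0\<close> by simp
  obtain d where "d > 0" and d: "\<And>D. \<lbrakk>D division_of \<Union>D; \<Union>D \<subseteq> {a..b}; (\<Sum>K\<in>D. Sup K - Inf K) < d\<rbrakk>
      \<Longrightarrow> (\<Sum>K\<in>D. norm (f (Sup K) - f (Inf K))) < e / (L + 1)"
    by (rule absolutely_continuous_on_IccD[OF f e1], rule that)
  show "\<exists>d>0. \<forall>D. D division_of \<Union>D \<and> \<Union>D \<subseteq> {a..b} \<and> (\<Sum>K\<in>D. Sup K - Inf K) < d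
      \<longrightarrow> (\<Sum>K\<in>D. norm (g (Sup K) - g (Inf K))) < e"
  proof (intro exI[of _ d] conjI allI impI \<open>d > 0\<close>, elim conjE)
    fix D :: "real set set"
    assume D: "D division_of \<Union>D" "\<Union>D \<subseteq> {a..b}" "(\<Sum>K\<in>D. Sup K - Inf K) < d"
    have "(\<Sum>K\<in>D. norm (g (Sup K) - g (Inf K))) \<le> (\<Sum>K\<in>D. L * norm (f (Sup K) - f (Inf K)))"
      proof (intro sum_mono le)
      fix K assume K: "K \<in> D"
      show "Inf K \<in> {a..b}" "Sup K \<in> {a..b}"
        using division_real_elem(2,3)[OF D(1) K] D(2) K by blast+
    qed
    also have "\<dots> = L * (\<Sum>K\<in>D. norm (f (Sup K) - f (Inf K)))"
      by (simp add: sum_distrib_left)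
    also have "\<dots> \<le> L * (e / (L + 1))"
      using d[OF D] \<open>L \<ge> 0\<close> by (intro mult_left_mono) auto
    also have "\<dots> < e"
      using \<open>e > 0\<close> \<open>L \<ge> 0\<close> by (simp add: field_simps)
    finally show "(\<Sum>K\<in>D. norm (g (Sup K) - g (Inf K))) < e" .
  qed
qed

lemma absolutely_continuous_on_Icc_id: "absolutely_continuous_on_Icc a b (\<lambda>t. t :: real)"
  unfolding absolutely_continuous_on_Icc_def
proof (intro allI impI)
  fix e :: real assume "e > 0"
  show "\<exists>d>0. \<forall>D. D division_of \<Union>D \<and> \<Union>D \<subseteq> {a..b} \<and> (\<Sum>K\<in>D. Sup K - Inf K) < d
      \<longrightarrow> (\<Sum>K\<in>D. norm (Sup K - Inf K)) < e"
  proof (intro exI[of _ e] conjI allI impI \<open>e > 0\<close>, elim conjE)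
    fix D :: "real set set"
    assume D: "D division_of \<Union>D" "(\<Sum>K\<in>D. Sup K - Inf K) < e"
    have "(\<Sum>K\<in>D. norm (Sup K - Inf K)) = (\<Sum>K\<in>D. Sup K - Inf K)"
      by (intro sum.cong) (auto dest: division_real_elem[OF D(1)])
    then show "(\<Sum>K\<in>D. norm (Sup K - Inf K)) < e" using D by simp
  qed
qed

lemma lipschitz_imp_absolutely_continuous_on_Icc:
  fixes f :: "real \<Rightarrow> 'a::real_normed_vector"
  assumes "L-lipschitz_on {a..b} f"
  shows "absolutely_continuous_on_Icc a b f"
  using assms
  by (intro absolutely_continuous_on_Icc_le[OF absolutely_continuous_on_Icc_id, of L])
    (auto simp: lipschitz_on_def dist_norm)

lemma absolutely_continuous_on_Icc_bounded_linear:
  assumes "bounded_linear g" "absolutely_continuous_on_Icc a b f"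
  shows "absolutely_continuous_on_Icc a b (\<lambda>t. g (f t))"
proof -
  interpret g: bounded_linear g by fact
  obtain K where "K \<ge> 0" "\<And>x. norm (g x) \<le> norm x * K"
    using g.nonneg_bounded by auto
  then show ?thesis
    by (intro absolutely_continuous_on_Icc_le[OF assms(2), of K])
      (simp_all add: g.diff[symmetric] mult.commute)
qed

lemma absolutely_continuous_on_Icc_diff:
  assumes f: "absolutely_continuous_on_Icc a b f" and g: "absolutely_continuous_on_Icc a b g"
  shows "absolutely_continuous_on_Icc a b (\<lambda>t. f t - g t)"
  unfolding absolutely_continuous_on_Icc_def
proof (intro allI impI)
  fix e :: real assume "e > 0"
  then have e2: "e / 2 > 0" by simp
  obtain d where "d > 0" and d: "\<And>D. \<lbrakk>D division_of \<Union>D; \<Union>D \<subseteq> {a..b}; (\<Sum>K\<in>D. Sup K - Inf K) < d\<rbrakk>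
      \<Longrightarrow> (\<Sum>K\<in>D. norm (f (Sup K) - f (Inf K))) < e / 2"
    by (rule absolutely_continuous_on_IccD[OF f e2], rule that)
  obtain d' where "d' > 0" and d': "\<And>D. \<lbrakk>D division_of \<Union>D; \<Union>D \<subseteq> {a..b}; (\<Sum>K\<in>D. Sup K - Inf K) < d'\<rbrakk>
      \<Longrightarrow> (\<Sum>K\<in>D. norm (g (Sup K) - g (Inf K))) < e / 2"
    by (rule absolutely_continuous_on_IccD[OF g e2], rule that)
  show "\<exists>d>0. \<forall>D. D division_of \<Union>D \<and> \<Union>D \<subseteq> {a..b} \<and> (\<Sum>K\<in>D. Sup K - Inf K) < d
      \<longrightarrow> (\<Sum>K\<in>D. norm (f (Sup K) - g (Sup K) - (f (Inf K) - g (Inf K)))) < e"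
  proof (intro exI[of _ "min d d'"] conjI allI impI, use \<open>d > 0\<close> \<open>d' > 0\<close> in simp, elim conjE)
    fix D :: "real set set"
    assume D: "D division_of \<Union>D" "\<Union>D \<subseteq> {a..b}" "(\<Sum>K\<in>D. Sup K - Inf K) < min d d'"
    have "(\<Sum>K\<in>D. norm (f (Sup K) - g (Sup K) - (f (Inf K) - g (Inf K))))
      \<le> (\<Sum>K\<in>D. norm (f (Sup K) - f (Inf K)) + norm (g (Sup K) - g (Inf K)))"
    proof (intro sum_mono)
      fix K
      have "f (Sup K) - g (Sup K) - (f (Inf K) - g (Inf K))
        = (f (Sup K) - f (Inf K)) - (g (Sup K) - g (Inf K))" by simp
      then show "norm (f (Sup K) - g (Sup K) - (f (Inf K) - g (Inf K)))
        \<le> norm (f (Sup K) - f (Inf K)) + norm (g (Sup K) - g (Inf K))"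
        by (metis norm_triangle_ineq4)
    qed
    also have "\<dots> < e / 2 + e / 2"
      unfolding sum.distrib by (intro add_strict_mono d d') (use D in auto)
    finally show "(\<Sum>K\<in>D. norm (f (Sup K) - g (Sup K) - (f (Inf K) - g (Inf K)))) < e" by simp
  qed
qed

lemma absolutely_continuous_on_Icc_subset:
  assumes "absolutely_continuous_on_Icc a b f" "{a'..b'} \<subseteq> {a..b}"
  shows "absolutely_continuous_on_Icc a' b' f"
  using assms unfolding absolutely_continuous_on_Icc_def by (meson subset_trans)

lemma absolutely_continuous_on_Icc_imp_continuous:
  fixes f :: "real \<Rightarrow> 'a::real_normed_vector"
  assumes f: "absolutely_continuous_on_Icc a b f"
  shows "continuous_on {a..b} f"
  unfolding continuous_on_iff
proof (intro ballI allI impI)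
  fix x e :: real assume x: "x \<in> {a..b}" and "e > 0"
  obtain d where "d > 0" and d: "\<And>D. \<lbrakk>D division_of \<Union>D; \<Union>D \<subseteq> {a..b}; (\<Sum>K\<in>D. Sup K - Inf K) < d\<rbrakk>
      \<Longrightarrow> (\<Sum>K\<in>D. norm (f (Sup K) - f (Inf K))) < e"
    by (rule absolutely_continuous_on_IccD[OF f \<open>e > 0\<close>], rule that)
  have *: "norm (f v - f u) < e" if "u \<le> v" "v - u < d" "u \<in> {a..b}" "v \<in> {a..b}" for u v
    using d[of "{{u..v}}"] that division_of_self[of u v] by (simp add: subset_iff)
  show "\<exists>d>0. \<forall>x'\<in>{a..b}. dist x' x < d \<longrightarrow> dist (f x') (f x) < e"
  proof (intro exI[of _ d] conjI ballI impI \<open>d > 0\<close>)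
    fix x' assume "x' \<in> {a..b}" "dist x' x < d"
    then show "dist (f x') (f x) < e"
      using *[of x x'] *[of x' x] x
      by (cases "x \<le> x'") (auto simp: dist_norm norm_minus_commute)
  qed
qed

section \<open>Fundamental theorem of calculus for absolutely continuous functions\<close>

lemma AE_lebesgue_iff_negligible: "(AE t in lebesgue. P t) \<longleftrightarrow> negligible {t. \<not> P t}"
proof
  assume "AE t in lebesgue. P t"
  then obtain N where "\<And>t. t \<in> space lebesgue - N \<Longrightarrow> P t" "N \<in> null_sets lebesgue"
    using AE_E3 by blast
  then have "{t. \<not> P t} \<subseteq> N" "N \<in> null_sets lebesgue" by auto
  then show "negligible {t. \<not> P t}"
    by (meson negligible_iff_null_sets negligible_subset)
next
  assume "negligible {t. \<not> P t}"
  then show "AE t in lebesgue. P t"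
    by (intro AE_I'[of "{t. \<not> P t}"]) (auto simp: negligible_iff_null_sets)
qed

text \<open>The gauge integral is checked from its definition, so integrability of \<open>f'\<close>
  comes out together with the value. A tag where the derivative exists controls the increment over
  its interval up to \<open>e'\<close> times the length; the intervals tagged in the null set
  \<open>N\<close> are forced into an open set of measure less than \<open>d\<close>, where absolute
  continuity bounds the sum of all increments.\<close>

theorem absolutely_continuous_has_integral_derivative:
  fixes f :: "real \<Rightarrow> 'a::euclidean_space"
  assumes f: "absolutely_continuous_on_Icc a b f" and "a \<le> b"
    and ae: "AE t in lebesgue. a < t \<and> t < b \<longrightarrow> (f has_vector_derivative f' t) (at t)"
  shows "(f' has_integral (f b - f a)) {a..b}"
proof -
  define N where "N = {t \<in> {a..b}. \<not> (f has_vector_derivative f' t) (at t)}"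
  have "negligible {t. \<not> (a < t \<and> t < b \<longrightarrow> (f has_vector_derivative f' t) (at t))}"
    using ae by (simp only: AE_lebesgue_iff_negligible)
  then have "negligible ({t. \<not> (a < t \<and> t < b \<longrightarrow> (f has_vector_derivative f' t) (at t))} \<union> {a, b})"
    by auto
  then have N: "negligible N"
    by (rule negligible_subset) (auto simp: N_def)
  \<comment> \<open>Value 0 on \<open>N\<close>: an interval tagged there adds nothing to the
    Riemann sum, and its error is exactly the increment of \<open>f\<close>.\<close>
  define g where "g t = (if t \<in> N then 0 else f' t)" for t
  have "(g has_integral (f b - f a)) {a..b}"
    unfolding has_integral_real
  proof (intro allI impI)
    fix e :: real assume "e > 0"
    define e' where "e' = e / (2 * (b - a + 1))"
    have "e' > 0" and e': "e' * (b - a) < e / 2"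
      using \<open>e > 0\<close> \<open>a \<le> b\<close> by (auto simp: e'_def field_simps)
    obtain d where "d > 0" and d: "\<And>D. \<lbrakk>D division_of \<Union>D; \<Union>D \<subseteq> {a..b}; (\<Sum>K\<in>D. Sup K - Inf K) < d\<rbrakk>
      \<Longrightarrow> (\<Sum>K\<in>D. norm (f (Sup K) - f (Inf K))) < e / 2"
      by (rule absolutely_continuous_on_IccD[OF f half_gt_zero[OF \<open>e > 0\<close>]], rule that)
    obtain U where U: "open U" "N \<subseteq> U" "emeasure lebesgue (U - N) < ennreal d" "U - N \<in> lmeasurable"
      using sets_lebesgue_outer_open[OF negligible_imp_sets[OF N] \<open>d > 0\<close>] by metis
    have "N \<in> lmeasurable" using N by (simp add: negligible_imp_measurable)
    then have Um: "U \<in> lmeasurable" using U(2,4) 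
      by (metis Diff_partition fmeasurable.Un)
    have "measure lebesgue U = measure lebesgue (U - N)"
      using N by (simp add: measure_Diff_null_set negligible_iff_null_sets Um fmeasurableD)
    also have "\<dots> < d"
      using U(3,4) \<open>d > 0\<close> by (simp add: emeasure_eq_measure2 ennreal_less_iff)
    finally have Ud: "measure lebesgue U < d" .
    \<comment> \<open>One radius per point serves as gauge: inside \<open>U\<close> for bad tags,
      within the differentiability estimate for good ones, arbitrary outside
      \<open>{a..b}\<close>.\<close>
    have "\<forall>t. \<exists>r>0. (t \<in> N \<longrightarrow> ball t r \<subseteq> U) \<and> (t \<in> {a..b} - N \<longrightarrow>
      (\<forall>y. norm (y - t) < r \<longrightarrow> norm (f y - f t - (y - t) *\<^sub>R f' t) \<le> e' * norm (y - t)))"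
    proof
      fix t
      consider "t \<in> N" | "t \<notin> {a..b}" | "t \<in> {a..b} - N" by blast
      then show "\<exists>r>0. (t \<in> N \<longrightarrow> ball t r \<subseteq> U) \<and> (t \<in> {a..b} - N \<longrightarrow>
      (\<forall>y. norm (y - t) < r \<longrightarrow> norm (f y - f t - (y - t) *\<^sub>R f' t) \<le> e' * norm (y - t)))"
      proof cases
        case 1
        then show ?thesis using U(1,2) by (metis DiffD2 openE subsetD)
      next
        case 2
        then show ?thesis by (intro exI[of _ 1]) (auto simp: N_def)
      next
        case 3
        then have "(f has_vector_derivative f' t) (at t)" by (auto simp: N_def)
        then show ?thesis using 3 \<open>e' > 0\<close>
          unfolding has_vector_derivative_def has_derivative_at_alt by blast
      qed
    qed
    then obtain r where r: "\<And>t. r t > 0" "\<And>t. t \<in> N \<Longrightarrow> ball t (r t) \<subseteq> U"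
      "\<And>t y. t \<in> {a..b} - N \<Longrightarrow> norm (y - t) < r t
         \<Longrightarrow> norm (f y - f t - (y - t) *\<^sub>R f' t) \<le> e' * norm (y - t)" by metis
    show "\<exists>\<gamma>. gauge \<gamma> \<and> (\<forall>\<D>. \<D> tagged_division_of {a..b} \<and> \<gamma> fine \<D> \<longrightarrow>
          norm ((\<Sum>(x, k)\<in>\<D>. measure lborel k *\<^sub>R g x) - (f b - f a)) < e)"
    proof (intro exI[of _ "\<lambda>t. ball t (r t)"] conjI allI impI)
      show "gauge (\<lambda>t. ball t (r t))" using r(1) by (intro gauge_ball_dependent) simp
    next
      fix p assume "p tagged_division_of {a..b} \<and> (\<lambda>t. ball t (r t)) fine p"
      then have p: "p tagged_division_of {a..b}" and fine: "(\<lambda>t. ball t (r t)) fine p" by auto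
      define pN where "pN = {(x, K) \<in> p. x \<in> N}"
      have pN: "pN \<subseteq> p" "finite p" "finite pN"
        using p by (auto simp: pN_def intro: finite_subset)
      have part: "pN tagged_partial_division_of {a..b}"
        using p pN(1) by (meson tagged_division_of_def tagged_partial_division_subset)
      have div: "snd ` pN division_of \<Union>(snd ` pN)"
        by (rule partial_division_of_tagged_division[OF part])
      \<comment> \<open>A sum over tagged pairs becomes a sum over intervals. One interval may carry
        two tags, but only if its interior is empty, and then \<open>h\<close> vanishes on
        it.\<close>
      have reindex: "(\<Sum>(x, K)\<in>pN. h K) = (\<Sum>K\<in>snd ` pN. h K)"
        if h: "\<And>K. Sup K = Inf K \<Longrightarrow> h K = 0" for h :: "real set \<Rightarrow> real"
      proof -
        have "(\<Sum>K\<in>snd ` pN. h K) = (\<Sum>q\<in>pN. (h \<circ> snd) q)"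
        proof (rule sum.reindex_nontrivial[OF pN(3)])
          fix q q' assume q: "q \<in> pN" "q' \<in> pN" "q \<noteq> q'" "snd q = snd q'"
          then have "interior (snd q) \<inter> interior (snd q') = {}"
            using part unfolding tagged_partial_division_of_def by (metis prod.collapse)
          then have "interior (snd q) = {}" using q by simp
          moreover have "snd q \<in> snd ` pN" using q by simp
          then have qi: "snd q = {Inf (snd q)..Sup (snd q)}" and "Inf (snd q) \<le> Sup (snd q)"
            using division_real_elem[OF div] by blast+
          ultimately have "{Inf (snd q)<..<Sup (snd q)} = {}"
            by (metis qi interior_atLeastAtMost_real)
          with \<open>Inf (snd q) \<le> Sup (snd q)\<close> have "Sup (snd q) = Inf (snd q)"
            by (simp add: greaterThanLessThan_empty_iff)
          then show "h (snd q) = 0" by (rule h)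
        qed
        then show ?thesis by (simp add: case_prod_unfold)
      qed
      have sub: "\<Union>(snd ` pN) \<subseteq> U" 
        using fine r(2) by (fastforce simp: pN_def fine_def)
      have "(\<Sum>K\<in>snd ` pN. Sup K - Inf K) = (\<Sum>K\<in>snd ` pN. measure lebesgue K)"
      proof (intro sum.cong refl)
        fix K assume "K \<in> snd ` pN"
        note K = division_real_elem[OF div this]
        have "measure lebesgue {Inf K..Sup K} = Sup K - Inf K"
          using K(1) by simp
        then show "Sup K - Inf K = measure lebesgue K"
          using K(4) by metis
      qed
      also have "\<dots> = measure lebesgue (\<Union>(snd ` pN))"
        by (rule content_division[OF div])
      also have "\<dots> \<le> measure lebesgue U"
        using sub Um lmeasurable_division[OF div] by (intro measure_mono_fmeasurable) auto
      finally have "(\<Sum>K\<in>snd ` pN. Sup K - Inf K) < d" using Ud by simp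
      moreover have "\<Union>(snd ` pN) \<subseteq> {a..b}"
        using part unfolding tagged_partial_division_of_def by (force dest: subsetD)
      ultimately have "(\<Sum>K\<in>snd ` pN. norm (f (Sup K) - f (Inf K))) < e / 2"
        using d[OF div] by simp
      then have sN: "(\<Sum>(x, K)\<in>pN. norm (f (Sup K) - f (Inf K))) < e / 2"
        by (subst reindex) auto
      have "norm ((\<Sum>(x, K)\<in>p. measure lborel K *\<^sub>R g x) - (f b - f a))
        = norm (\<Sum>(x, K)\<in>p. measure lborel K *\<^sub>R g x - (f (Sup K) - f (Inf K)))"
        using additive_tagged_division_1[OF \<open>a \<le> b\<close> p, of f]
        by (simp add: case_prod_unfold sum_subtractf)
      also have "\<dots> \<le> (\<Sum>q\<in>p. (case q of (x, K) \<Rightarrow> e' * (Sup K - Inf K))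
           + (if q \<in> pN then (case q of (x, K) \<Rightarrow> norm (f (Sup K) - f (Inf K))) else 0))"
      proof (rule sum_norm_le, clarify)
        fix x K assume xK: "(x, K) \<in> p"
        then obtain u v where K: "K = {u..v}" and x: "x \<in> K" and Kab: "K \<subseteq> {a..b}"
          using p by (metis box_real(2) tagged_division_ofD(2,3,4))
        then have uv: "u \<le> v" "x \<in> {u..v}" by auto
        show "norm (measure lborel K *\<^sub>R g x - (f (Sup K) - f (Inf K)))
          \<le> e' * (Sup K - Inf K) + (if (x, K) \<in> pN then norm (f (Sup K) - f (Inf K)) else 0)"
        proof (cases "x \<in> N")
          case True
          then have "(x, K) \<in> pN" "g x = 0" using xK by (auto simp: pN_def g_def)
          then show ?thesis using uv K \<open>e' > 0\<close> by (simp add: norm_minus_commute)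
        next
          case False
          then have gx: "g x = f' x" "(x, K) \<notin> pN" "x \<in> {a..b} - N" using xK Kab x
            by (auto simp: pN_def g_def)
          have ball: "norm (u - x) < r x" "norm (v - x) < r x"
            using fine xK K uv unfolding fine_def by (fastforce simp: dist_norm norm_minus_commute)+
          \<comment> \<open>Splitting at the tag costs nothing: it lies between \<open>u\<close> and
            \<open>v\<close>, so the two distances add up to \<open>v - u\<close>.\<close>
          have "norm ((v - u) *\<^sub>R f' x - (f v - f u))
            = norm ((f u - f x - (u - x) *\<^sub>R f' x) - (f v - f x - (v - x) *\<^sub>R f' x))"
            by (simp add: algebra_simps)
          also have "\<dots> \<le> e' * norm (u - x) + e' * norm (v - x)"
            using r(3)[OF gx(3) ball(1)] r(3)[OF gx(3) ball(2)] norm_triangle_ineq4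
            by (smt (verit, ccfv_threshold))
          also have "\<dots> = e' * (v - u)" using uv by (simp add: algebra_simps)
          finally show ?thesis using K uv gx by simp
        qed
      qed
      also have "\<dots> = e' * (\<Sum>(x, K)\<in>p. Sup K - Inf K) + (\<Sum>(x, K)\<in>pN. norm (f (Sup K) - f (Inf K)))"
        using pN by (simp add: sum.distrib sum_distrib_left case_prod_unfold sum.If_cases Int_absorb1)
      also have "(\<Sum>(x, K)\<in>p. Sup K - Inf K) = b - a"
        using additive_tagged_division_1[OF \<open>a \<le> b\<close> p, of "\<lambda>x. x"] by simp
      also have "e' * (b - a) + (\<Sum>(x, K)\<in>pN. norm (f (Sup K) - f (Inf K))) < e"
        using e' sN by simp
      finally show "norm ((\<Sum>(x, K)\<in>p. measure lborel K *\<^sub>R g x) - (f b - f a)) < e" .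
    qed
  qed
  then show ?thesis
    by (rule has_integral_spike[OF N, rotated]) (auto simp: g_def)
qed

section \<open>Growth estimates\<close>

lemma absolutely_continuous_norm_bound:
  fixes f :: "real \<Rightarrow> 'a::euclidean_space"
  assumes f: "absolutely_continuous_on_Icc a b f" and "a \<le> b" "B \<ge> 0"
    and ae: "AE t in lebesgue. a < t \<and> t < b \<longrightarrow> (\<exists>d. (f has_vector_derivative d) (at t) \<and> norm d \<le> B)"
  shows "norm (f b - f a) \<le> B * (b - a)"
proof -
  define P where "P t d \<longleftrightarrow> (f has_vector_derivative d) (at t) \<and> norm d \<le> B" for t d
  \<comment> \<open>Default 0, which obeys the bound since \<open>B \<ge> 0\<close>: the integral
    estimate needs the bound at every point.\<close>
  define f' where "f' t = (if \<exists>d. P t d then SOME d. P t d else 0)" for t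
  have P: "P t (f' t)" if "\<exists>d. P t d" for t
    using that someI_ex[OF that] by (simp add: f'_def)
  have "AE t in lebesgue. a < t \<and> t < b \<longrightarrow> (f has_vector_derivative f' t) (at t)"
    using ae P by (auto simp: P_def elim!: eventually_mono)
  then have "(f' has_integral (f b - f a)) (cbox a b)"
    using absolutely_continuous_has_integral_derivative[OF f \<open>a \<le> b\<close>] by simp
  moreover have "norm (f' t) \<le> B" for t
    using P[of t] \<open>B \<ge> 0\<close> by (cases "\<exists>d. P t d") (auto simp: P_def f'_def)
  ultimately show ?thesis
    using has_integral_bound[OF \<open>B \<ge> 0\<close>, of f' "f b - f a" a b] \<open>a \<le> b\<close> by simp
qed

lemma absolutely_continuous_diff_le_integral:
  fixes f :: "real \<Rightarrow> real"
  assumes f: "absolutely_continuous_on_Icc a b f" and "a \<le> b"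
    and ae: "AE t in lebesgue. a < t \<and> t < b \<longrightarrow> (\<exists>d. (f has_real_derivative d) (at t) \<and> d \<le> g t)"
    and g: "(g has_integral I) {a..b}"
  shows "f b - f a \<le> I"
proof -
  define P where "P t d \<longleftrightarrow> (f has_real_derivative d) (at t) \<and> d \<le> g t" for t d
  \<comment> \<open>Default \<open>g t\<close>, so that \<open>f' t \<le> g t\<close> holds
    everywhere and not only almost everywhere.\<close>
  define f' where "f' t = (if \<exists>d. P t d then SOME d. P t d else g t)" for t
  have P: "P t (f' t)" if "\<exists>d. P t d" for t
    using that someI_ex[OF that] by (simp add: f'_def)
  have "AE t in lebesgue. a < t \<and> t < b \<longrightarrow> (f has_vector_derivative f' t) (at t)"
    using ae P by (auto simp: P_def has_real_derivative_iff_has_vector_derivative elim!: eventually_mono)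
  then have "(f' has_integral (f b - f a)) {a..b}"
    using absolutely_continuous_has_integral_derivative[OF f \<open>a \<le> b\<close>] by simp
  moreover have "f' t \<le> g t" for t
    using P[of t] by (cases "\<exists>d. P t d") (auto simp: P_def f'_def)
  ultimately show ?thesis
    using has_integral_le[OF _ g] by blast
qed

text \<open>On an interval of length less than \<open>1/C\<close> the maximum of the norm is at most a fraction of itself.\<close>

lemma absolutely_continuous_linear_growth_zero:
  fixes f :: "real \<Rightarrow> 'a::euclidean_space"
  assumes f: "absolutely_continuous_on_Icc 0 b f" and "b > 0" "C \<ge> 0" "f 0 = 0"
    and ae: "AE t in lebesgue. 0 < t \<and> t < b \<longrightarrow>
      (\<exists>d. (f has_vector_derivative d) (at t) \<and> norm d \<le> C * norm (f t))"
  shows "\<exists>\<epsilon>>0. \<epsilon> \<le> b \<and> (\<forall>t\<in>{0..\<epsilon>}. f t = 0)"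
proof -
  define \<epsilon> where "\<epsilon> = min b (1 / (2 * (C + 1)))"
  have \<epsilon>: "\<epsilon> > 0" "\<epsilon> \<le> b" "C * \<epsilon> \<le> 1 / 2"
  proof -
    show "\<epsilon> > 0" "\<epsilon> \<le> b" using \<open>b > 0\<close> \<open>C \<ge> 0\<close> by (auto simp: \<epsilon>_def)
    have "C * \<epsilon> \<le> C * (1 / (2 * (C + 1)))"
      using \<open>C \<ge> 0\<close> by (intro mult_left_mono) (auto simp: \<epsilon>_def)
    also have "\<dots> \<le> 1 / 2" using \<open>C \<ge> 0\<close> by (simp add: field_simps)
    finally show "C * \<epsilon> \<le> 1 / 2" .
  qed
  have "continuous_on {0..\<epsilon>} (\<lambda>t. norm (f t))"
    using absolutely_continuous_on_Icc_imp_continuous[OF f] \<epsilon>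
    by (intro continuous_on_norm) (auto elim: continuous_on_subset)
  then obtain s where s: "s \<in> {0..\<epsilon>}" and max: "\<And>t. t \<in> {0..\<epsilon>} \<Longrightarrow> norm (f t) \<le> norm (f s)"
    using continuous_attains_sup[of "{0..\<epsilon>}" "\<lambda>t. norm (f t)"] \<epsilon> by auto
  have "norm (f s - f 0) \<le> (C * norm (f s)) * (s - 0)"
  proof (rule absolutely_continuous_norm_bound)
    show "absolutely_continuous_on_Icc 0 s f"
      using s \<epsilon> by (intro absolutely_continuous_on_Icc_subset[OF f]) auto
    show "AE t in lebesgue. 0 < t \<and> t < s \<longrightarrow> (\<exists>d. (f has_vector_derivative d) (at t) \<and> norm d \<le> C * norm (f s))"
      using ae
    proof eventually_elim
      case (elim t)
      show ?case
      proof
        assume t: "0 < t \<and> t < s"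
        then obtain d where d: "(f has_vector_derivative d) (at t)" "norm d \<le> C * norm (f t)"
          using elim s \<epsilon> by auto
        moreover have "C * norm (f t) \<le> C * norm (f s)"
          using t s max[of t] \<open>C \<ge> 0\<close> by (intro mult_left_mono) auto
        ultimately show "\<exists>d. (f has_vector_derivative d) (at t) \<and> norm d \<le> C * norm (f s)"
          by force
      qed
    qed
  qed (use s \<open>C \<ge> 0\<close> in auto)
  also have "(C * norm (f s)) * (s - 0) \<le> (C * norm (f s)) * \<epsilon>"
    using s \<open>C \<ge> 0\<close> by (intro mult_left_mono) auto
  also have "\<dots> = (C * \<epsilon>) * norm (f s)" by simp
  also have "\<dots> \<le> 1 / 2 * norm (f s)"
    using \<epsilon>(3) by (intro mult_right_mono) auto
  finally have "f s = 0" using \<open>f 0 = 0\<close> by simp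
  then show ?thesis using max \<epsilon> by (intro exI[of _ \<epsilon>]) auto
qed

text \<open>Descending from \<open>j = k\<close>, \<open>z j\<close> is negative of exact order \<open>t\<^sup>k\<^sup>-\<^sup>j\<close>: the lower
  triangular perturbation gains one power of \<open>t\<close> over the leading term.\<close>

lemma triangular_system_negative:
  fixes z :: "nat \<Rightarrow> real \<Rightarrow> real"
  assumes ac: "\<And>j. j \<le> k \<Longrightarrow> absolutely_continuous_on_Icc 0 b (z j)"
    and pos: "b > 0" "m > 0" "C \<ge> 0"
    and init: "\<And>j. j < k \<Longrightarrow> z j 0 = 0" "z k 0 < 0"
    and ae: "AE t in lebesgue. 0 < t \<and> t < b \<longrightarrow> (\<forall>j<k. \<exists>d a. (z j has_real_derivative d) (at t) \<and>
      m \<le> a \<and> a \<le> C \<and> \<bar>d - a * z (Suc j) t\<bar> \<le> C * (\<Sum>i\<le>j. \<bar>z i t\<bar>))"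
  shows "\<exists>\<epsilon>>0. \<epsilon> \<le> b \<and> (\<forall>t\<in>{0<..\<epsilon>}. z 0 t < 0)"
proof -
  have cont: "continuous_on {0..b} (z j)" if "j \<le> k" for j
    using ac[OF that] by (rule absolutely_continuous_on_Icc_imp_continuous)
  \<comment> \<open>The induction also carries a bound of order \<open>t ^ i\<close> on all
    components below \<open>k - i\<close>, since these make up the perturbation in the next
    step.\<close>
  have "\<exists>\<epsilon> \<gamma> D. 0 < \<epsilon> \<and> \<epsilon> \<le> b \<and> 0 < \<gamma> \<and> 0 \<le> D \<and> (\<forall>t\<in>{0..\<epsilon>}. z (k - i) t \<le> - \<gamma> * t ^ i \<and>
    (\<forall>l\<le>k - i. \<bar>z l t\<bar> \<le> D * t ^ i))" if "i \<le> k" for i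
    using that
  proof (induction i)
    case 0
    have "\<exists>D\<ge>0. \<forall>t\<in>{0..b}. \<bar>z l t\<bar> \<le> D" if "l \<le> k" for l
    proof -
      have "compact (z l ` {0..b})" by (intro compact_continuous_image cont that) auto
      then obtain D where "\<forall>x\<in>z l ` {0..b}. norm x \<le> D"
        using compact_imp_bounded bounded_iff by metis
      then show ?thesis by (intro exI[of _ "\<bar>D\<bar>"]) force
    qed
    then obtain D where D: "\<And>l. l \<le> k \<Longrightarrow> D l \<ge> 0" "\<And>l t. l \<le> k \<Longrightarrow> t \<in> {0..b} \<Longrightarrow> \<bar>z l t\<bar> \<le> D l"
      by metis
    have "\<exists>d>0. \<forall>t\<in>{0..b}. dist t 0 < d \<longrightarrow> dist (z k t) (z k 0) < - z k 0 / 2"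
      using cont[OF order_refl, unfolded continuous_on_iff, rule_format, of 0 "- z k 0 / 2"] pos init(2)
      by simp
    then obtain d where "d > 0" and d: "\<And>t. t \<in> {0..b} \<Longrightarrow> t < d \<Longrightarrow> \<bar>z k t - z k 0\<bar> < - z k 0 / 2"
      by (auto simp: dist_real_def)
    show ?case
    proof (intro exI conjI ballI allI impI)
      show "0 < min b (d / 2)" "min b (d / 2) \<le> b" "0 < - z k 0 / 2" "0 \<le> (\<Sum>l\<le>k. D l)"
        using pos \<open>d > 0\<close> init(2) D(1) by (auto intro: sum_nonneg)
      fix t assume t: "t \<in> {0..min b (d / 2)}"
      then show "z (k - 0) t \<le> - (- z k 0 / 2) * t ^ 0"
        using d[of t] \<open>d > 0\<close> by auto
      fix l assume l: "l \<le> k - 0"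
      have "\<bar>z l t\<bar> \<le> D l" using D(2) l t by auto
      also have "\<dots> \<le> (\<Sum>l\<le>k. D l)" using l D(1) by (intro member_le_sum) auto
      finally show "\<bar>z l t\<bar> \<le> (\<Sum>l\<le>k. D l) * t ^ 0" by simp
    qed
  next
    case (Suc i)
    then obtain \<epsilon> \<gamma> D where IH: "0 < \<epsilon>" "\<epsilon> \<le> b" "0 < \<gamma>" "0 \<le> D"
      "\<And>t. t \<in> {0..\<epsilon>} \<Longrightarrow> z (k - i) t \<le> - \<gamma> * t ^ i"
      "\<And>t l. t \<in> {0..\<epsilon>} \<Longrightarrow> l \<le> k - i \<Longrightarrow> \<bar>z l t\<bar> \<le> D * t ^ i"
      by (metis Suc_leD)
    define j where "j = k - Suc i"
    have j: "k - i = Suc j" "j < k" using Suc.prems by (auto simp: j_def)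
    \<comment> \<open>Coefficient of \<open>t ^ i\<close> in the derivative bound for
      \<open>z l\<close>: \<open>C * D\<close> from the leading term, and at most \<open>k\<close>
      perturbing terms, each contributing \<open>C * D\<close>.\<close>
    define D' where "D' = C * D + C * (real k * D)"
    have "D' \<ge> 0" using pos IH by (simp add: D'_def)
    have sum_le: "(\<Sum>i'\<le>l. \<bar>z i' t\<bar>) \<le> real k * E" if "l < k" "E \<ge> 0" "\<And>i'. i' \<le> l \<Longrightarrow> \<bar>z i' t\<bar> \<le> E" for l t E
    proof -
      have "(\<Sum>i'\<le>l. \<bar>z i' t\<bar>) \<le> (\<Sum>i'\<le>l. E)" using that by (intro sum_mono) auto
      also have "\<dots> = real (Suc l) * E" by simp
      also have "\<dots> \<le> real k * E" using that by (intro mult_right_mono) auto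
      finally show ?thesis .
    qed
    \<comment> \<open>Integration from the initial value 0 gains one power of
      \<open>t\<close>.\<close>
    have bound: "\<bar>z l t\<bar> \<le> D' * t ^ Suc i" if t: "t \<in> {0..\<epsilon>}" and l: "l \<le> j" for t l
    proof -
      have "norm (z l t - z l 0) \<le> (D' * t ^ i) * (t - 0)"
      proof (rule absolutely_continuous_norm_bound)
        show "absolutely_continuous_on_Icc 0 t (z l)"
          using t IH l j by (intro absolutely_continuous_on_Icc_subset[OF ac]) auto
        show "AE s in lebesgue. 0 < s \<and> s < t \<longrightarrow> (\<exists>d. (z l has_vector_derivative d) (at s) \<and> norm d \<le> D' * t ^ i)"
          using ae
        proof eventually_elim
          case (elim s)
          show ?case
          proof
            assume s: "0 < s \<and> s < t"
            have "l < k" "Suc l \<le> k - i" using l j by auto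
            then obtain d a where d: "(z l has_real_derivative d) (at s)" "m \<le> a" "a \<le> C"
              "\<bar>d - a * z (Suc l) s\<bar> \<le> C * (\<Sum>i\<le>l. \<bar>z i s\<bar>)"
              using elim s t IH(2) by auto
            have st: "s ^ i \<le> t ^ i" using s by (intro power_mono) auto
            have zs: "\<bar>z l' s\<bar> \<le> D * t ^ i" if "l' \<le> k - i" for l'
            proof -
              have "\<bar>z l' s\<bar> \<le> D * s ^ i" using IH(6)[of s l'] s t that by auto
              also have "\<dots> \<le> D * t ^ i" using st IH(4) by (rule mult_left_mono)
              finally show ?thesis .
            qed
            have "\<bar>a * z (Suc l) s\<bar> \<le> C * (D * t ^ i)"
              unfolding abs_mult using d(2,3) pos zs[OF \<open>Suc l \<le> k - i\<close>] by (intro mult_mono) auto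
            moreover have "C * (\<Sum>i\<le>l. \<bar>z i s\<bar>) \<le> C * (real k * (D * t ^ i))"
              using pos IH t \<open>l < k\<close> l j by (intro mult_left_mono sum_le zs) auto
            ultimately have "\<bar>d\<bar> \<le> D' * t ^ i"
              using d(4) unfolding D'_def by (simp add: algebra_simps)
            then show "\<exists>d. (z l has_vector_derivative d) (at s) \<and> norm d \<le> D' * t ^ i"
              using d(1) by (auto simp: has_real_derivative_iff_has_vector_derivative)
          qed
        qed
      qed (use t \<open>D' \<ge> 0\<close> in auto)
      then show ?thesis using init(1)[of l] l j by (simp add: mult.assoc mult.commute[of t])
    qed
    \<comment> \<open>Chosen so that the perturbation, of order \<open>s ^ Suc i\<close>, uses up at
      most half of the leading decrease \<open>m * \<gamma> * s ^ i\<close>.\<close>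
    define \<epsilon>' where "\<epsilon>' = min \<epsilon> (m * \<gamma> / (2 * (C * (real k * D') + 1)))"
    have "C * (real k * D') \<ge> 0" using pos \<open>D' \<ge> 0\<close> by simp
    then have \<epsilon>': "\<epsilon>' > 0" "\<epsilon>' \<le> \<epsilon>" "(C * (real k * D')) * \<epsilon>' \<le> m * \<gamma> / 2"
    proof -
      show "\<epsilon>' > 0" "\<epsilon>' \<le> \<epsilon>"
        using pos IH \<open>C * (real k * D') \<ge> 0\<close> by (auto simp: \<epsilon>'_def intro!: divide_pos_pos)
      have "(C * (real k * D')) * \<epsilon>' \<le> (C * (real k * D')) * (m * \<gamma> / (2 * (C * (real k * D') + 1)))"
        using \<open>C * (real k * D') \<ge> 0\<close> by (intro mult_left_mono) (auto simp: \<epsilon>'_def)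
      also have "\<dots> = m * \<gamma> / 2 * (C * (real k * D') / (C * (real k * D') + 1))"
        by (simp add: field_simps)
      also have "\<dots> \<le> m * \<gamma> / 2 * 1"
        using \<open>C * (real k * D') \<ge> 0\<close> pos IH by (intro mult_left_mono) (auto simp: divide_simps)
      finally show "(C * (real k * D')) * \<epsilon>' \<le> m * \<gamma> / 2" by simp
    qed
    show ?case
    proof (rule exI[of _ \<epsilon>'], rule exI[of _ "m * \<gamma> / 2 / real (Suc i)"], rule exI[of _ D'], intro conjI ballI allI impI)
      show "0 < \<epsilon>'" "\<epsilon>' \<le> b" "0 < m * \<gamma> / 2 / real (Suc i)" "0 \<le> D'"
        using \<epsilon>' IH pos \<open>D' \<ge> 0\<close> by auto
      fix t assume t: "t \<in> {0..\<epsilon>'}"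
      show "\<bar>z l t\<bar> \<le> D' * t ^ Suc i" if "l \<le> k - Suc i" for l
        using bound[of t l] that t \<epsilon>' by (auto simp: j_def)
      have "((\<lambda>s. - (m * \<gamma> / 2 / real (Suc i)) * s ^ Suc i) has_real_derivative - (m * \<gamma> / 2) * s ^ i)
          (at s within {0..t})" for s
        by (rule DERIV_cong[OF DERIV_cmult[OF DERIV_pow]]) (simp del: of_nat_Suc)
      then have "((\<lambda>s. - (m * \<gamma> / 2) * s ^ i) has_integral
          - (m * \<gamma> / 2 / real (Suc i)) * t ^ Suc i - - (m * \<gamma> / 2 / real (Suc i)) * 0 ^ Suc i) {0..t}"
        using t by (intro fundamental_theorem_of_calculus[where f = "\<lambda>s. - (m * \<gamma> / 2 / real (Suc i)) * s ^ Suc i"])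
          (auto simp flip: has_real_derivative_iff_has_vector_derivative)
      moreover have "AE s in lebesgue. 0 < s \<and> s < t \<longrightarrow>
        (\<exists>d. (z j has_real_derivative d) (at s) \<and> d \<le> - (m * \<gamma> / 2) * s ^ i)"
        using ae
      proof eventually_elim
        case (elim s)
        show ?case
        proof
          assume s: "0 < s \<and> s < t"
          then obtain d a where d: "(z j has_real_derivative d) (at s)" "m \<le> a" "a \<le> C"
            "\<bar>d - a * z (Suc j) s\<bar> \<le> C * (\<Sum>i\<le>j. \<bar>z i s\<bar>)"
            using elim t IH(2) \<epsilon>'(2) j by auto
          have s': "s \<in> {0..\<epsilon>}" "s \<le> \<epsilon>'" using s t \<epsilon>' by auto
          have zj: "z (Suc j) s \<le> - \<gamma> * s ^ i" using IH(5)[OF s'(1)] j by simp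
          then have "z (Suc j) s \<le> 0"
            using IH(3) s by (smt (verit) mult_nonneg_nonneg zero_le_power mult_minus_left)
          \<comment> \<open>The factor is nonpositive, so the lower bound \<open>m\<close> on
            \<open>a\<close> gives the upper estimate.\<close>
          then have "a * z (Suc j) s \<le> m * z (Suc j) s"
            using d(2) by (rule mult_right_mono_neg[rotated])
          also have "\<dots> \<le> m * (- \<gamma> * s ^ i)" using zj pos by (intro mult_left_mono) auto
          finally have 1: "a * z (Suc j) s \<le> - (m * \<gamma>) * s ^ i" by (simp add: algebra_simps)
          have "C * (\<Sum>i\<le>j. \<bar>z i s\<bar>) \<le> C * (real k * (D' * s ^ Suc i))"
            using pos s \<open>D' \<ge> 0\<close> j bound[OF s'(1)] by (intro mult_left_mono sum_le) auto
          also have "\<dots> = (C * (real k * D')) * s * s ^ i" by simp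
          also have "\<dots> \<le> (m * \<gamma> / 2) * s ^ i"
          proof (rule mult_right_mono)
            have "(C * (real k * D')) * s \<le> (C * (real k * D')) * \<epsilon>'"
              using s' \<open>C * (real k * D') \<ge> 0\<close> by (intro mult_left_mono) auto
            then show "(C * (real k * D')) * s \<le> m * \<gamma> / 2" using \<epsilon>'(3) by simp
          qed (use s in auto)
          finally have "d \<le> - (m * \<gamma>) * s ^ i + (m * \<gamma> / 2) * s ^ i" using 1 d(4) by linarith
          also have "\<dots> = - (m * \<gamma> / 2) * s ^ i" by (simp add: algebra_simps)
          finally show "\<exists>d. (z j has_real_derivative d) (at s) \<and> d \<le> - (m * \<gamma> / 2) * s ^ i"
            using d(1) by blast
        qed
      qed
      moreover have "absolutely_continuous_on_Icc 0 t (z j)"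
        using t IH \<epsilon>' j by (intro absolutely_continuous_on_Icc_subset[OF ac]) auto
      ultimately have "z j t - z j 0 \<le> - (m * \<gamma> / 2 / real (Suc i)) * t ^ Suc i
          - - (m * \<gamma> / 2 / real (Suc i)) * 0 ^ Suc i"
        using t by (intro absolutely_continuous_diff_le_integral) auto
      then show "z (k - Suc i) t \<le> - (m * \<gamma> / 2 / real (Suc i)) * t ^ Suc i"
        using init(1)[OF j(2)] by (simp add: j_def)
    qed
  qed
  from this[of k] obtain \<epsilon> \<gamma> where "0 < \<epsilon>" "\<epsilon> \<le> b" "0 < \<gamma>" and neg: "\<And>t. t \<in> {0..\<epsilon>} \<Longrightarrow> z 0 t \<le> - \<gamma> * t ^ k"
    by auto
  moreover have "z 0 t < 0" if "t \<in> {0<..\<epsilon>}" for t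
  proof -
    have "\<gamma> * t ^ k > 0" using that \<open>0 < \<gamma>\<close> by auto
    then show ?thesis using neg[of t] that by auto
  qed
  ultimately show ?thesis by blast
qed

section \<open>Almost everywhere differentiability of Lipschitz functions\<close>

text \<open>Compactness is applied to the image filter. No subsequence is extracted, since an
  uncountable product of balls, as used for the Euler scheme, need not be sequentially compact; the
  same form serves the difference quotients at a point.\<close>

lemma compact_cluster_point:
  assumes "compact K" "F \<noteq> bot" "eventually (\<lambda>s. h s \<in> K) F"
  obtains D where "D \<in> K" "\<And>A. open A \<Longrightarrow> D \<in> A \<Longrightarrow> frequently (\<lambda>s. h s \<in> A) F"
proof -
  have "filtermap h F \<noteq> bot" "eventually (\<lambda>x. x \<in> K) (filtermap h F)"
    using assms by (auto simp: filtermap_bot_iff eventually_filtermap)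
  then obtain D where D: "D \<in> K" "inf (nhds D) (filtermap h F) \<noteq> bot"
    using \<open>compact K\<close> unfolding compact_filter by blast
  have "frequently (\<lambda>s. h s \<in> A) F" if A: "open A" "D \<in> A" for A
  proof (rule ccontr)
    assume "\<not> frequently (\<lambda>s. h s \<in> A) F"
    then have "eventually (\<lambda>x. x \<notin> A) (filtermap h F)"
      by (simp add: not_frequently eventually_filtermap)
    moreover have "eventually (\<lambda>x. x \<in> A) (nhds D)"
      using A by (rule eventually_nhds_in_open)
    ultimately have "eventually (\<lambda>x. False) (inf (nhds D) (filtermap h F))"
      unfolding eventually_inf by (metis (full_types))
    then show False using D(2) by (simp add: trivial_limit_def)
  qed
  with D(1) show ?thesis using that by blast
qed

lemma emeasure_countable_disjoint_Union_le:
  assumes "countable C" "disjoint_family_on X C"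
    and "\<And>i. i \<in> C \<Longrightarrow> X i \<in> sets M" "\<And>i. i \<in> C \<Longrightarrow> X i \<in> sets N"
    and le: "\<And>i. i \<in> C \<Longrightarrow> emeasure M (X i) \<le> c * emeasure N (X i)"
  shows "emeasure M (\<Union>i\<in>C. X i) \<le> c * emeasure N (\<Union>i\<in>C. X i)"
proof -
  have "emeasure M (\<Union>i\<in>C. X i) = (\<integral>\<^sup>+i. emeasure M (X i) \<partial>count_space C)"
    using assms by (intro emeasure_UN_countable) auto
  also have "\<dots> \<le> (\<integral>\<^sup>+i. c * emeasure N (X i) \<partial>count_space C)"
    using le by (intro nn_integral_mono) auto
  also have "\<dots> = c * (\<integral>\<^sup>+i. emeasure N (X i) \<partial>count_space C)"
    by (intro nn_integral_cmult) auto
  also have "(\<integral>\<^sup>+i. emeasure N (X i) \<partial>count_space C) = emeasure N (\<Union>i\<in>C. X i)"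
    using assms by (intro emeasure_UN_countable[symmetric]) auto
  finally show ?thesis .
qed

text \<open>The covering theorem for balls, restated with endpoints: a closed interval is the ball
  about its midpoint whose radius is half its length.\<close>

lemma Vitali_covering_intervals:
  fixes S :: "real set" and K :: "(real \<times> real) set"
  assumes K: "\<And>u v. (u, v) \<in> K \<Longrightarrow> u < v"
    and S: "\<And>t d. \<lbrakk>t \<in> S; d > 0\<rbrakk> \<Longrightarrow> \<exists>u v. (u, v) \<in> K \<and> u \<le> t \<and> t \<le> v \<and> v - u < d"
  shows "\<exists>C. countable C \<and> C \<subseteq> K \<and> disjoint_family_on (\<lambda>(u, v). {u..v}) C \<and>
    negligible (S - (\<Union>(u, v)\<in>C. {u..v}))"
proof -
  let ?a = "\<lambda>p :: real \<times> real. (fst p + snd p) / 2" and ?r = "\<lambda>p :: real \<times> real. (snd p - fst p) / 2"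
  have cb: "cball (?a p) (?r p) = (case p of (u, v) \<Rightarrow> {u..v})" for p
    by (auto simp: cball_eq_atLeastAtMost case_prod_unfold field_simps)
  have r: "0 < ?r p" if "p \<in> K" for p
    using K[of "fst p" "snd p"] that by simp
  have cov: "\<exists>p. p \<in> K \<and> t \<in> cball (?a p) (?r p) \<and> ?r p < d" if td: "t \<in> S" "0 < d" for t d
  proof -
    obtain u v where "(u, v) \<in> K" "u \<le> t" "t \<le> v" "v - u < d" using S[OF td] by blast
    then show ?thesis using K[of u v] unfolding cb by (intro exI[of _ "(u, v)"]) auto
  qed
  show ?thesis
  proof (rule Vitali_covering_theorem_cballs[where K = K and r = ?r and S = S and a = ?a])
    fix C assume C: "countable C" "C \<subseteq> K"
      "pairwise (\<lambda>i j. disjnt (cball (?a i) (?r i)) (cball (?a j) (?r j))) C"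
      "negligible (S - (\<Union>i\<in>C. cball (?a i) (?r i)))"
    show ?thesis
    proof (intro exI conjI)
      show "countable C" "C \<subseteq> K" by (fact C)+
      show "disjoint_family_on (\<lambda>(u, v). {u..v}) C"
        using C(3) unfolding cb by (auto simp: disjoint_family_on_def pairwise_def disjnt_def)
      show "negligible (S - (\<Union>(u, v)\<in>C. {u..v}))"
        using C(4) unfolding cb by (simp add: case_prod_unfold)
    qed
  qed (use r cov in auto)
qed

lemma emeasure_lborel_eq_measure_lebesgue:
  assumes "A \<in> sets borel" "A \<in> lmeasurable"
  shows "emeasure lborel A = ennreal (measure lebesgue A)"
proof -
  have "emeasure lborel A = emeasure lebesgue A"
    using assms(1) by (simp add: emeasure_completion)
  also have "\<dots> = ennreal (measure lebesgue A)"
    by (rule emeasure_eq_measure2[OF assms(2)])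
  finally show ?thesis .
qed

text \<open>Two nested Vitali coverings, by intervals of slope at most \<open>r\<close> and, inside these, by intervals
  of slope at least \<open>R\<close>, are compared in the Lebesgue-Stieltjes measure of \<open>g\<close>.\<close>

lemma monotone_slope_gap_contraction:
  fixes g :: "real \<Rightarrow> real" and S :: "real set"
  assumes mono: "mono g" and cont: "continuous_on UNIV g" and r: "0 \<le> r" "0 < R"
    and U: "open U" "U \<in> lmeasurable" "S \<subseteq> U"
    and low: "\<And>t d. \<lbrakk>t \<in> S; d > 0\<rbrakk> \<Longrightarrow> \<exists>u v. u < v \<and> u \<le> t \<and> t \<le> v \<and> v - u < d \<and> g v - g u \<le> r * (v - u)"
    and high: "\<And>t d. \<lbrakk>t \<in> S; d > 0\<rbrakk> \<Longrightarrow> \<exists>u v. u < v \<and> u \<le> t \<and> t \<le> v \<and> v - u < d \<and> R * (v - u) \<le> g v - g u"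
  obtains V where "V \<in> lmeasurable" "S \<subseteq> V" "measure lebesgue V \<le> r / R * measure lebesgue U"
proof -
  \<comment> \<open>Continuity of \<open>g\<close> excludes atoms, so a closed interval has mass
    exactly \<open>g v - g u\<close>.\<close>
  define \<mu> where "\<mu> = interval_measure g"
  have \<mu>: "emeasure \<mu> {u..v} = ennreal (g v - g u)" if "u \<le> v" for u v
    unfolding \<mu>_def using mono cont that
    by (intro emeasure_interval_measure_Icc) (auto simp: mono_def)
  have sets_\<mu>: "sets \<mu> = sets borel" by (simp add: \<mu>_def)
  define K where "K = {(u, v). u < v \<and> {u..v} \<subseteq> U \<and> g v - g u \<le> r * (v - u)}"
  have small: "\<exists>d>0. \<forall>u v. u \<le> t \<and> t \<le> v \<and> v - u < d \<longrightarrow> {u..v} \<subseteq> W" if W: "open W" "t \<in> W" for W and t :: real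
  proof -
    obtain d where "d > 0" "ball t d \<subseteq> W" using W by (rule openE)
    then show ?thesis by (intro exI[of _ d]) (force simp: dist_real_def)
  qed
  have Kpos: "u < v" if "(u, v) \<in> K" for u v using that by (simp add: K_def)
  have covK: "\<exists>u v. (u, v) \<in> K \<and> u \<le> t \<and> t \<le> v \<and> v - u < d" if td: "t \<in> S" "d > 0" for t d
  proof -
    obtain d' where "d' > 0" and d': "\<And>u v. u \<le> t \<and> t \<le> v \<and> v - u < d' \<Longrightarrow> {u..v} \<subseteq> U"
      using small[of U t] U td by blast
    obtain u v where "u < v" "u \<le> t" "t \<le> v" "v - u < min d d'" "g v - g u \<le> r * (v - u)"
      using low[of t "min d d'"] td \<open>d' > 0\<close> by auto
    moreover from this have "{u..v} \<subseteq> U" using d'[of u v] by simp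
    ultimately show ?thesis unfolding K_def by - (rule exI[where x = u], rule exI[where x = v], auto)
  qed
  obtain C where C: "countable C" "C \<subseteq> K" "disjoint_family_on (\<lambda>(u, v). {u..v}) C"
    "negligible (S - (\<Union>(u, v)\<in>C. {u..v}))"
    using Vitali_covering_intervals[OF Kpos covK] by blast
  \<comment> \<open>Open intervals, so that the second covering can be fitted into them; only the
    countably many endpoints are lost.\<close>
  define W where "W = (\<Union>(u, v)\<in>C. {u<..<v})"
  have "open W" by (auto simp: W_def)
  have "negligible (fst ` C \<union> snd ` C)"
    using C(1) by (simp add: negligible_iff_null_sets countable_imp_null_set_lborel null_sets_completionI)
  then have SW: "negligible (S - W)"
    by (rule negligible_subset[OF negligible_Un[OF C(4)]]) (force simp: W_def)
  define K' where "K' = {(u, v). u < v \<and> {u..v} \<subseteq> W \<and> R * (v - u) \<le> g v - g u}"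
  have Kpos': "u < v" if "(u, v) \<in> K'" for u v using that by (simp add: K'_def)
  have covK': "\<exists>u v. (u, v) \<in> K' \<and> u \<le> t \<and> t \<le> v \<and> v - u < d" if td: "t \<in> S \<inter> W" "d > 0" for t d
  proof -
    obtain d' where "d' > 0" and d': "\<And>u v. u \<le> t \<and> t \<le> v \<and> v - u < d' \<Longrightarrow> {u..v} \<subseteq> W"
      using small[of W t] \<open>open W\<close> td by blast
    obtain u v where "u < v" "u \<le> t" "t \<le> v" "v - u < min d d'" "R * (v - u) \<le> g v - g u"
      using high[of t "min d d'"] td \<open>d' > 0\<close> by auto
    moreover from this have "{u..v} \<subseteq> W" using d'[of u v] by simp
    ultimately show ?thesis unfolding K'_def by - (rule exI[where x = u], rule exI[where x = v], auto)
  qed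
  obtain C' where C': "countable C'" "C' \<subseteq> K'" "disjoint_family_on (\<lambda>(u, v). {u..v}) C'"
    "negligible (S \<inter> W - (\<Union>(u, v)\<in>C'. {u..v}))"
    using Vitali_covering_intervals[OF Kpos' covK'] by blast
  define I where "I = (\<Union>(u, v)\<in>C. {u..v})"
  define J where "J = (\<Union>(u, v)\<in>C'. {u..v})"
  have borel: "I \<in> sets borel" "J \<in> sets borel"
    unfolding I_def J_def using C(1) C'(1) by (auto intro!: sets.countable_UN'')
  have "J \<subseteq> W" using C'(2) unfolding J_def K'_def by fast
  have "W \<subseteq> I" unfolding W_def I_def by fastforce
  have "I \<subseteq> U" using C(2) unfolding I_def K_def by fast
  \<comment> \<open>Steep intervals bound length by mass over \<open>R\<close>, flat ones bound mass
    by \<open>r\<close> times length; \<open>J \<subseteq> I \<subseteq> U\<close> links the two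
    estimates.\<close>
  have "emeasure lborel J \<le> ennreal (1 / R) * emeasure \<mu> J"
    unfolding J_def
  proof (rule emeasure_countable_disjoint_Union_le[OF C'(1,3)])
    fix p assume "p \<in> C'"
    then obtain u v where p: "p = (u, v)" "u < v" "R * (v - u) \<le> g v - g u"
      using C'(2) by (auto simp: K'_def)
    then have "v - u \<le> 1 / R * (g v - g u)" using r by (simp add: field_simps)
    then show "emeasure lborel (case p of (u, v) \<Rightarrow> {u..v}) \<le> ennreal (1 / R) * emeasure \<mu> (case p of (u, v) \<Rightarrow> {u..v})"
      using p r mono by (simp add: \<mu> ennreal_mult[symmetric] mono_def ennreal_leI)
  qed (auto simp: sets_\<mu>)
  also have "emeasure \<mu> J \<le> emeasure \<mu> I"
    using \<open>J \<subseteq> W\<close> \<open>W \<subseteq> I\<close> borel by (intro emeasure_mono) (auto simp: sets_\<mu>)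
  also have "emeasure \<mu> I \<le> ennreal r * emeasure lborel I"
    unfolding I_def
  proof (rule emeasure_countable_disjoint_Union_le[OF C(1,3)])
    fix p assume "p \<in> C"
    then obtain u v where p: "p = (u, v)" "u < v" "g v - g u \<le> r * (v - u)"
      using C(2) by (auto simp: K_def)
    then show "emeasure \<mu> (case p of (u, v) \<Rightarrow> {u..v}) \<le> ennreal r * emeasure lborel (case p of (u, v) \<Rightarrow> {u..v})"
      using r by (simp add: \<mu> ennreal_mult[symmetric] ennreal_leI)
  qed (auto simp: sets_\<mu>)
  also have "emeasure lborel I \<le> emeasure lborel U"
    using \<open>I \<subseteq> U\<close> U by (intro emeasure_mono) auto
  also have "emeasure lborel U = ennreal (measure lebesgue U)"
    using U by (intro emeasure_lborel_eq_measure_lebesgue) auto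
  finally have "emeasure lborel J \<le> ennreal (1 / R) * (ennreal r * ennreal (measure lebesgue U))"
    by (simp add: mult_left_mono)
  also have "\<dots> = ennreal (r / R * measure lebesgue U)"
    using r by (simp add: ennreal_mult[symmetric])
  finally have J: "emeasure lborel J \<le> ennreal (r / R * measure lebesgue U)" .
  have Jm: "J \<in> lmeasurable"
    using borel J by (auto simp: fmeasurable_def top_unique less_top[symmetric] intro: le_less_trans)
  have "emeasure lborel J = ennreal (measure lebesgue J)"
    using Jm borel by (intro emeasure_lborel_eq_measure_lebesgue)
  with J have J': "measure lebesgue J \<le> r / R * measure lebesgue U"
    using r by (simp add: ennreal_le_iff)
  have neg: "negligible (S - J)"
    by (rule negligible_subset[OF negligible_Un[OF SW C'(4)]]) (auto simp: J_def)
  show ?thesis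
  proof (rule that)
    show "J \<union> (S - J) \<in> lmeasurable" using Jm negligible_imp_measurable[OF neg] by (rule fmeasurable.Un)
    show "S \<subseteq> J \<union> (S - J)" by auto
    show "measure lebesgue (J \<union> (S - J)) \<le> r / R * measure lebesgue U"
      using J' measure_Un_null_set[OF fmeasurableD[OF Jm] neg[unfolded negligible_iff_null_sets]] by argo
  qed
qed

text \<open>The outer measure \<open>s\<close> of \<open>S\<close> satisfies
  \<open>s \<le> r / R * s\<close>, because almost optimal open supersets are contracted by the
  factor \<open>r / R < 1\<close>; hence \<open>s = 0\<close>. Boundedness provides a superset of
  finite measure to start from.\<close>

lemma monotone_slope_gap_negligible:
  fixes g :: "real \<Rightarrow> real" and S :: "real set"
  assumes mono: "mono g" and cont: "continuous_on UNIV g" and r: "0 \<le> r" "r < R"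
    and "bounded S"
    and low: "\<And>t d. \<lbrakk>t \<in> S; d > 0\<rbrakk> \<Longrightarrow> \<exists>u v. u < v \<and> u \<le> t \<and> t \<le> v \<and> v - u < d \<and> g v - g u \<le> r * (v - u)"
    and high: "\<And>t d. \<lbrakk>t \<in> S; d > 0\<rbrakk> \<Longrightarrow> \<exists>u v. u < v \<and> u \<le> t \<and> t \<le> v \<and> v - u < d \<and> R * (v - u) \<le> g v - g u"
  shows "negligible S"
proof -
  define Q where "Q = measure lebesgue ` {V. V \<in> lmeasurable \<and> S \<subseteq> V}"
  obtain B where "S \<subseteq> cbox (-B) B" using \<open>bounded S\<close> by (meson bounded_subset_cbox_symmetric)
  then have Qne: "Q \<noteq> {}" by (auto simp: Q_def)
  have Q0: "q \<ge> 0" if "q \<in> Q" for q using that by (auto simp: Q_def)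
  then have bdd: "bdd_below Q" by (rule bdd_belowI)
  define s where "s = Inf Q"
  have "s \<ge> 0" unfolding s_def using Qne Q0 by (intro cInf_greatest)
  have step: "s \<le> r / R * (s + e)" if "e > 0" for e
  proof -
    obtain q where "q \<in> Q" "q < s + e / 2"
      using cInf_lessD[OF Qne, of "s + e / 2"] \<open>e > 0\<close> by (auto simp: s_def)
    then obtain T where T: "T \<in> lmeasurable" "S \<subseteq> T" "measure lebesgue T < s + e / 2"
      by (auto simp: Q_def)
    obtain U where U: "open U" "T \<subseteq> U" "(U - T) \<in> lmeasurable" "emeasure lebesgue (U - T) < ennreal (e / 2)"
      using sets_lebesgue_outer_open[OF fmeasurableD[OF T(1)], of "e / 2"] \<open>e > 0\<close> by auto
    have "T \<union> (U - T) \<in> lmeasurable" "measure lebesgue (T \<union> (U - T)) \<le> measure lebesgue T + measure lebesgue (U - T)"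
      using T(1) U(3) by (rule fmeasurable.Un, intro measure_Un_le fmeasurableD T(1) U(3))
    moreover have "T \<union> (U - T) = U" using U by auto
    moreover have "measure lebesgue (U - T) < e / 2"
      using U(3,4) by (simp add: emeasure_eq_measure2 ennreal_less_iff)
    ultimately have Um: "U \<in> lmeasurable" "measure lebesgue U \<le> s + e" using T by auto
    have "0 < R" "S \<subseteq> U" using r T U by auto
    show ?thesis
    proof (rule monotone_slope_gap_contraction[OF mono cont r(1) \<open>0 < R\<close> U(1) Um(1) \<open>S \<subseteq> U\<close> low high])
      fix V assume V: "V \<in> lmeasurable" "S \<subseteq> V" "measure lebesgue V \<le> r / R * measure lebesgue U"
    have "s \<le> measure lebesgue V" unfolding s_def using V bdd by (intro cInf_lower) (auto simp: Q_def)
    also note V(3)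
    also have "r / R * measure lebesgue U \<le> r / R * (s + e)"
      using Um(2) r by (intro mult_left_mono) auto
    finally show "s \<le> r / R * (s + e)" .
    qed auto
  qed
  have "s \<le> r / R * s"
  proof (rule field_le_epsilon)
    fix e :: real assume "e > 0"
    have "r / R * (s + e) = r / R * s + r / R * e" by (simp add: distrib_left)
    also have "r / R * e \<le> 1 * e" using r \<open>e > 0\<close> by (intro mult_right_mono) auto
    finally show "s \<le> r / R * s + e" using step[OF \<open>e > 0\<close>] by simp
  qed
  then have "(R - r) * s \<le> 0" using r by (simp add: field_simps)
  then have "s = 0" using r \<open>s \<ge> 0\<close> by (simp add: mult_le_0_iff)
  show ?thesis
    unfolding negligible_outer
  proof (intro allI impI)
    fix e :: real assume "e > 0"
    then obtain q where "q \<in> Q" "q < e"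
      using cInf_lessD[OF Qne, of e] \<open>s = 0\<close> by (auto simp: s_def)
    then show "\<exists>T. S \<subseteq> T \<and> T \<in> lmeasurable \<and> measure lebesgue T < e" by (auto simp: Q_def)
  qed
qed

text \<open>Adding \<open>L * t\<close> makes the function monotone, with slopes in
  \<open>{0..2 * L}\<close>, so that it defines a Stieltjes measure. By compactness the slopes at a
  point have a cluster value \<open>D\<close>; if they do not converge to it, two rationals separate
  two ranges of slopes that both occur arbitrarily close to the point, and such points form
  countably many null sets \<open>E r R\<close>.\<close>

lemma lipschitz_has_derivative_AE_real:
  fixes f :: "real \<Rightarrow> real"
  assumes f: "L-lipschitz_on UNIV f"
  shows "AE t in lebesgue. f differentiable (at t)"
proof -
  define g where "g t = f t + L * t" for t
  have L: "L \<ge> 0" using f by (rule lipschitz_on_nonneg)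
  have fL: "\<bar>f v - f u\<bar> \<le> L * (v - u)" if "u \<le> v" for u v
    using lipschitz_onD[OF f, of v u] that by (simp add: dist_real_def)
  have g_diff: "0 \<le> g v - g u" "g v - g u \<le> 2 * L * (v - u)" if "u \<le> v" for u v
    using fL[OF that] by (auto simp: g_def algebra_simps)
  then have mono: "mono g" by (simp add: mono_def)
  have cont: "continuous_on UNIV g"
    unfolding g_def by (intro continuous_intros lipschitz_on_continuous_on[OF f])
  define slope where "slope t s = (g s - g t) / (s - t)" for t s
  have slope_ivl: "\<exists>u v. u < v \<and> u \<le> t \<and> t \<le> v \<and> v - u < d \<and> g v - g u = slope t s * (v - u)"
    if "s \<noteq> t" "dist s t < d" for s t d
  proof (cases "s < t")
    case True
    then show ?thesis using that
      by (rule_tac exI[of _ s], rule_tac exI[of _ t]) (auto simp: slope_def dist_real_def field_simps)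
  next
    case False
    then show ?thesis using that
      by (rule_tac exI[of _ t], rule_tac exI[of _ s]) (auto simp: slope_def dist_real_def field_simps)
  qed
  have slope_bound: "slope t s \<in> {0..2 * L}" if "s \<noteq> t" for t s
    using g_diff[of s t] g_diff[of t s] that
    by (cases "s < t") (auto simp: slope_def divide_simps mult_le_0_iff zero_le_mult_iff algebra_simps)
  define E where "E r R = {t. (\<exists>\<^sub>F s in at t. slope t s \<le> r) \<and> (\<exists>\<^sub>F s in at t. R \<le> slope t s)}" for r R
  have "negligible (E r R)" if "0 \<le> r" "r < R" for r R
  proof -
    \<comment> \<open>Cut off to get the bounded set that the outer measure argument
      requires.\<close>
    have "negligible (E r R \<inter> {- real n..real n})" for n
    proof (rule monotone_slope_gap_negligible[OF mono cont that])
      fix t d :: real assume "t \<in> E r R \<inter> {- real n..real n}" "d > 0"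
      then have "\<exists>\<^sub>F s in at t. slope t s \<le> r" "\<exists>\<^sub>F s in at t. R \<le> slope t s"
        by (auto simp: E_def)
      then obtain s s' where s: "s \<noteq> t" "dist s t < d" "slope t s \<le> r" "s' \<noteq> t" "dist s' t < d" "R \<le> slope t s'"
        using \<open>d > 0\<close> unfolding frequently_def eventually_at by (metis UNIV_I)
      show "\<exists>u v. u < v \<and> u \<le> t \<and> t \<le> v \<and> v - u < d \<and> g v - g u \<le> r * (v - u)"
        using slope_ivl[OF s(1,2)] s(3) by (metis diff_gt_0_iff_gt less_eq_real_def mult_right_mono)
      show "\<exists>u v. u < v \<and> u \<le> t \<and> t \<le> v \<and> v - u < d \<and> R * (v - u) \<le> g v - g u"
        using slope_ivl[OF s(4,5)] s(6) by (metis diff_gt_0_iff_gt less_eq_real_def mult_right_mono)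
    qed (auto intro: bounded_subset[of "{- real n..real n}"])
    then have "negligible (\<Union>n. E r R \<inter> {- real n..real n})" by (intro negligible_countable_Union) auto
    moreover have "E r R \<subseteq> (\<Union>n. E r R \<inter> {- real n..real n})"
    proof
      fix t assume "t \<in> E r R"
      obtain n where "\<bar>t\<bar> \<le> real n" using real_arch_simple by blast
      then show "t \<in> (\<Union>n. E r R \<inter> {- real n..real n})" using \<open>t \<in> E r R\<close> by (intro UN_I[of n]) auto
    qed
    ultimately show ?thesis by (rule negligible_subset)
  qed
  then have "negligible (\<Union>(r, R)\<in>{(r, R). r \<in> \<rat> \<and> R \<in> \<rat> \<and> 0 \<le> r \<and> r < R}. E r R)"
    by (intro negligible_countable_Union countable_image countable_subset[OF _ countable_SIGMA[OF countable_rat countable_rat]]) auto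
  moreover have "{t. \<not> f differentiable (at t)} \<subseteq> (\<Union>(r, R)\<in>{(r, R). r \<in> \<rat> \<and> R \<in> \<rat> \<and> 0 \<le> r \<and> r < R}. E r R)"
  proof (rule subsetI, rule ccontr)
    fix t assume t: "t \<in> {t. \<not> f differentiable (at t)}"
      and "t \<notin> (\<Union>(r, R)\<in>{(r, R). r \<in> \<rat> \<and> R \<in> \<rat> \<and> 0 \<le> r \<and> r < R}. E r R)"
    then have no: False if "\<exists>\<^sub>F s in at t. slope t s \<le> r" "\<exists>\<^sub>F s in at t. R \<le> slope t s" "r \<in> \<rat>" "R \<in> \<rat>" "0 \<le> r" "r < R" for r R
      using that by (auto simp: E_def)
    have "\<forall>\<^sub>F s in at t. slope t s \<in> {0..2 * L}"
      using slope_bound by (auto simp: eventually_at_filter)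
    then obtain D where D: "D \<in> {0..2 * L}" "\<And>A. open A \<Longrightarrow> D \<in> A \<Longrightarrow> \<exists>\<^sub>F s in at t. slope t s \<in> A"
      using compact_cluster_point[of "{0..2 * L}" "at t" "slope t"] by auto
    have "(slope t \<longlongrightarrow> D) (at t)"
      unfolding order_tendsto_iff
    proof (intro conjI allI impI)
      fix l assume "l < D"
      show "\<forall>\<^sub>F s in at t. l < slope t s"
      proof (rule ccontr)
        assume "\<not> (\<forall>\<^sub>F s in at t. l < slope t s)"
        then have fr: "\<exists>\<^sub>F s in at t. slope t s \<le> l" by (simp add: not_eventually not_less)
        \<comment> \<open>Slopes are nonnegative, so \<open>l \<ge> 0\<close>; this makes the
          rationals chosen below admissible for \<open>no\<close>.\<close>
        moreover have "\<exists>s. s \<noteq> t \<and> slope t s \<le> l"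
          using fr unfolding frequently_def eventually_at_filter by (metis (mono_tags, lifting) always_eventually)
        then have "0 \<le> l" using slope_bound by force
        obtain r where r: "r \<in> \<rat>" "l < r" "r < D" using Rats_dense_in_real[OF \<open>l < D\<close>] by blast
        obtain R where R: "R \<in> \<rat>" "r < R" "R < D" using Rats_dense_in_real[OF \<open>r < D\<close>] by blast
        have "\<exists>\<^sub>F s in at t. slope t s \<in> {R<..}" using D(2)[of "{R<..}"] R by simp
        then have "\<exists>\<^sub>F s in at t. R \<le> slope t s" by (rule frequently_elim1) auto
        moreover have "\<exists>\<^sub>F s in at t. slope t s \<le> r" using fr by (rule frequently_elim1) (use r in auto)
        ultimately show False using no r R \<open>0 \<le> l\<close> by force
      qed
    next
      fix l assume "D < l"
      show "\<forall>\<^sub>F s in at t. slope t s < l"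
      proof (rule ccontr)
        assume "\<not> (\<forall>\<^sub>F s in at t. slope t s < l)"
        then have fr: "\<exists>\<^sub>F s in at t. l \<le> slope t s" by (simp add: not_eventually not_less)
        obtain r where r: "r \<in> \<rat>" "D < r" "r < l" using Rats_dense_in_real[OF \<open>D < l\<close>] by blast
        obtain R where R: "R \<in> \<rat>" "r < R" "R < l" using Rats_dense_in_real[OF \<open>r < l\<close>] by blast
        have "\<exists>\<^sub>F s in at t. slope t s \<in> {..<r}" using D(2)[of "{..<r}"] r by simp
        then have "\<exists>\<^sub>F s in at t. slope t s \<le> r" by (rule frequently_elim1) auto
        moreover have "\<exists>\<^sub>F s in at t. R \<le> slope t s" using fr by (rule frequently_elim1) (use R in auto)
        ultimately show False using no r R D(1) by force
      qed
    qed
    then have "(g has_real_derivative D) (at t)"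
      by (simp add: slope_def[abs_def] has_field_derivative_iff)
    then have "((\<lambda>t. g t - L * t) has_real_derivative (D - L * 1)) (at t)"
      by (auto intro!: derivative_eq_intros)
    moreover have "(\<lambda>t. g t - L * t) = f" by (simp add: g_def fun_eq_iff)
    ultimately have "f differentiable (at t)"
      by (metis real_differentiable_def)
    with t show False by simp
  qed
  ultimately show ?thesis
    unfolding AE_lebesgue_iff_negligible by (rule negligible_subset)
qed

lemma lipschitz_has_vector_derivative_AE:
  fixes f :: "real \<Rightarrow> 'a::euclidean_space"
  assumes f: "L-lipschitz_on UNIV f"
  shows "AE t in lebesgue. \<exists>v. (f has_vector_derivative v) (at t)"
proof -
  have "AE t in lebesgue. (\<lambda>s. f s \<bullet> i) differentiable (at t)" if "i \<in> Basis" for i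
  proof (rule lipschitz_has_derivative_AE_real)
    show "L-lipschitz_on UNIV (\<lambda>s. f s \<bullet> i)"
    proof (rule lipschitz_onI)
      fix s t
      have "dist (f s \<bullet> i) (f t \<bullet> i) = \<bar>(f s - f t) \<bullet> i\<bar>" by (simp add: dist_real_def inner_diff_left)
      also have "\<dots> \<le> norm (f s - f t)" using that by (rule Basis_le_norm)
      also have "\<dots> \<le> L * dist s t" using lipschitz_onD[OF f, of s t] by (simp add: dist_norm)
      finally show "dist (f s \<bullet> i) (f t \<bullet> i) \<le> L * dist s t" .
    qed (rule lipschitz_on_nonneg[OF f])
  qed
  then have "AE t in lebesgue. \<forall>i\<in>Basis. (\<lambda>s. f s \<bullet> i) differentiable (at t)"
    by (intro AE_finite_allI) auto
  then show ?thesis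
    by eventually_elim
      (metis differentiable_componentwise_within vector_derivative_works)
qed

section \<open>Existence of Filippov solutions\<close>

primrec euler_iterate :: "('a::real_vector \<Rightarrow> 'a) \<Rightarrow> real \<Rightarrow> 'a \<Rightarrow> nat \<Rightarrow> 'a" where
  "euler_iterate g h \<xi> 0 = \<xi>"
| "euler_iterate g h \<xi> (Suc j) = euler_iterate g h \<xi> j + h *\<^sub>R g (euler_iterate g h \<xi> j)"

text \<open>Discrete Gronwall estimate: each step multiplies the norm by at most
  \<open>1 + K * h\<close>, which is at most \<open>exp (K * h)\<close>. The bound depends on the
  elapsed time only, not on the step size.\<close>

lemma euler_iterate_norm_le:
  fixes g :: "'a::real_normed_vector \<Rightarrow> 'a"
  assumes g: "\<And>y. norm (g y) \<le> K * norm y" and "K \<ge> 0" "h \<ge> 0"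
  shows "norm (euler_iterate g h \<xi> j) \<le> exp (K * (h * real j)) * norm \<xi>"
proof (induction j)
  case (Suc j)
  let ?y = "euler_iterate g h \<xi> j"
  have "norm (euler_iterate g h \<xi> (Suc j)) \<le> norm ?y + h * norm (g ?y)"
    using norm_triangle_ineq[of ?y "h *\<^sub>R g ?y"] \<open>h \<ge> 0\<close> by simp
  also have "\<dots> \<le> norm ?y + h * (K * norm ?y)"
    using g[of ?y] \<open>h \<ge> 0\<close> by (simp add: mult_left_mono)
  also have "\<dots> = (1 + K * h) * norm ?y" by (simp add: algebra_simps)
  also have "\<dots> \<le> exp (K * h) * (exp (K * (h * real j)) * norm \<xi>)"
    using Suc.IH assms by (intro mult_mono exp_ge_add_one_self) auto
  also have "\<dots> = exp (K * (h * real (Suc j))) * norm \<xi>"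
    by (simp add: algebra_simps exp_add)
  finally show ?case .
qed simp

lemma euler_iterate_dist_le:
  fixes g :: "'a::real_normed_vector \<Rightarrow> 'a"
  assumes g: "\<And>y. norm (g y) \<le> K * norm y" and "K \<ge> 0" "h \<ge> 0" and "i \<le> j" "h * real j \<le> T"
  shows "norm (euler_iterate g h \<xi> j - euler_iterate g h \<xi> i)
    \<le> K * (exp (K * T) * norm \<xi>) * (h * (real j - real i))"
  using \<open>i \<le> j\<close> \<open>h * real j \<le> T\<close>
proof (induction j rule: dec_induct)
  case (step j)
  let ?y = "euler_iterate g h \<xi> j" and ?B = "exp (K * T) * norm \<xi>"
  have jT: "h * real j \<le> T" using step.prems \<open>h \<ge> 0\<close> by (simp add: algebra_simps)
  have "norm ?y \<le> exp (K * (h * real j)) * norm \<xi>"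
    by (rule euler_iterate_norm_le[OF assms(1-3)])
  also have "\<dots> \<le> ?B"
    using jT \<open>K \<ge> 0\<close> by (intro mult_right_mono) (auto intro: mult_left_mono)
  finally have "norm (g ?y) \<le> K * ?B"
    using g[of ?y] \<open>K \<ge> 0\<close> by (meson mult_left_mono order_trans)
  then have "norm (h *\<^sub>R g ?y) \<le> K * ?B * h" using \<open>h \<ge> 0\<close> by (simp add: mult_left_mono mult.commute)
  moreover have "norm (?y - euler_iterate g h \<xi> i) \<le> K * ?B * (h * (real j - real i))"
    using step.IH jT by simp
  moreover have "euler_iterate g h \<xi> (Suc j) - euler_iterate g h \<xi> i = (?y - euler_iterate g h \<xi> i) + h *\<^sub>R g ?y"
    by simp
  ultimately have "norm (euler_iterate g h \<xi> (Suc j) - euler_iterate g h \<xi> i)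
      \<le> K * ?B * (h * (real j - real i)) + K * ?B * h"
    by (metis add_mono norm_triangle_le)
  also have "\<dots> = K * ?B * (h * (real (Suc j) - real i))" by (simp add: algebra_simps)
  finally show ?case .
qed simp

lemma euler_iterate_in_subspace:
  assumes "subspace S" "\<xi> \<in> S" "\<And>y. y \<in> S \<Longrightarrow> g y \<in> S"
  shows "euler_iterate g h \<xi> j \<in> S"
  by (induction j) (use assms in \<open>auto intro: subspace_add subspace_scale\<close>)

text \<open>Only half-space conditions are propagated: a lower bound on \<open>p \<bullet> g\<close>
  adds up over the steps, whereas the velocities of a discontinuous \<open>g\<close> need not
  converge.\<close>

lemma euler_iterate_inner_ge:
  assumes "i \<le> j" "h \<ge> 0" "\<And>l. \<lbrakk>i \<le> l; l < j\<rbrakk> \<Longrightarrow> b \<le> p \<bullet> g (euler_iterate g h \<xi> l)"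
  shows "b * (h * (real j - real i)) \<le> p \<bullet> (euler_iterate g h \<xi> j - euler_iterate g h \<xi> i)"
  using assms(1,3)
proof (induction j rule: dec_induct)
  case (step j)
  have "b * h \<le> (p \<bullet> g (euler_iterate g h \<xi> j)) * h"
    using step \<open>h \<ge> 0\<close> by (intro mult_right_mono) auto
  moreover have "b * (h * (real j - real i)) \<le> p \<bullet> (euler_iterate g h \<xi> j - euler_iterate g h \<xi> i)"
    using step by simp
  ultimately show ?case by (simp add: algebra_simps inner_diff_right inner_add_right)
qed simp

text \<open>The pointwise cluster points of the Euler polygons, obtained from Tychonoff's theorem, suffice:
  every property needed of the limit involves only finitely many points of time.\<close>

theorem euler_cluster_point:
  fixes g :: "'a::euclidean_space \<Rightarrow> 'a"
  assumes g: "\<And>y. norm (g y) \<le> K * norm y" and "K \<ge> 0"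
  obtains x :: "real \<Rightarrow> 'a" where "x 0 = \<xi>"
    and "\<And>T. \<exists>L. L-lipschitz_on {0..T} x"
    and "\<And>S t. \<lbrakk>subspace S; \<xi> \<in> S; \<And>y. y \<in> S \<Longrightarrow> g y \<in> S\<rbrakk> \<Longrightarrow> x t \<in> S"
    and "\<And>t v p b \<delta>. \<lbrakk>0 \<le> t; (x has_vector_derivative v) (at t); \<delta> > 0;
      \<And>y. dist y (x t) < \<delta> \<Longrightarrow> b \<le> p \<bullet> g y\<rbrakk> \<Longrightarrow> b \<le> p \<bullet> v"
proof -
  define h where "h k = 1 / real (Suc k)" for k
  have h: "h k > 0" for k by (simp add: h_def)
  have h_less: "\<exists>N. \<forall>k\<ge>N. h k < e" if e: "e > 0" for e
  proof -
    obtain N where N: "inverse (real (Suc N)) < e" using reals_Archimedean[OF e] by blast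
    show ?thesis
    proof (intro exI[of _ N] allI impI)
      fix k assume "k \<ge> N"
      then have "h k \<le> inverse (real (Suc N))" by (simp add: h_def inverse_eq_divide frac_le)
      then show "h k < e" using N by simp
    qed
  qed
  \<comment> \<open>Times are rounded down to the grid, so \<open>X\<close> below is the step
    function of the scheme rather than the polygon. \<open>nat\<close> sends negative times to index
    0, whence \<open>max t 0\<close> in the bounds.\<close>
  define idx where "idx k t = nat \<lfloor>t / h k\<rfloor>" for k and t :: real
  define X where "X k t = euler_iterate g (h k) \<xi> (idx k t)" for k t
  have idx_le: "h k * real (idx k t) \<le> t" if "t \<ge> 0" for k t
  proof -
    have "real (idx k t) \<le> t / h k" using that h[of k] by (simp add: idx_def)
    then show ?thesis using h[of k] by (simp add: field_simps)
  qed
  have idx_gt: "t - h k \<le> h k * real (idx k t)" if "t \<ge> 0" for k t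
  proof -
    have "t / h k - 1 \<le> real (idx k t)" using that h[of k] by (simp add: idx_def)
    then show ?thesis using h[of k] by (simp add: field_simps)
  qed
  have idx_mono: "idx k s \<le> idx k t" if "s \<le> t" for k s t
    unfolding idx_def using that h[of k] by (intro nat_mono floor_mono divide_right_mono) auto
  define B where "B T = exp (K * T) * norm \<xi>" for T
  have B: "B T \<ge> 0" for T by (simp add: B_def)
  have X_bound: "X k t \<in> cball 0 (B (max t 0))" for k t
  proof -
    have "norm (X k t) \<le> exp (K * (h k * real (idx k t))) * norm \<xi>"
      unfolding X_def using g \<open>K \<ge> 0\<close> h[of k] by (intro euler_iterate_norm_le) auto
    also have "\<dots> \<le> B (max t 0)"
    proof -
      have "h k * real (idx k t) \<le> max t 0"
      proof (cases "t \<ge> 0")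
        case False
        then have "t / h k \<le> 0" using h[of k] by (simp add: divide_nonpos_pos)
        then have "idx k t = 0" by (simp add: idx_def) 
        then show ?thesis by simp
      qed (use idx_le[of t k] in auto)
      then show ?thesis unfolding B_def using \<open>K \<ge> 0\<close> 
        by (intro mult_right_mono) (auto intro: mult_left_mono)
    qed
    finally show ?thesis by simp
  qed
  \<comment> \<open>Rounding to the grid costs at most one step, the summand \<open>h k\<close>. The
    index \<open>j\<close> is free because the velocity estimate needs every iterate between two
    times, not only the last.\<close>
  have idx_dist: "norm (euler_iterate g (h k) \<xi> j - X k s) \<le> K * B T * (t - s + h k)"
    if "0 \<le> s" "s \<le> t" "t \<le> T" "idx k s \<le> j" "j \<le> idx k t" for s t T k j
  proof -
    have jt: "h k * real j \<le> t"
      using idx_le[of t k] that h[of k]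
      by (meson dual_order.trans less_imp_le mult_left_mono of_nat_mono order_trans)
    have "norm (euler_iterate g (h k) \<xi> j - X k s)
        \<le> K * (exp (K * T) * norm \<xi>) * (h k * (real j - real (idx k s)))"
      unfolding X_def using g \<open>K \<ge> 0\<close> h[of k] that jt
      by (intro euler_iterate_dist_le) auto
    also have "\<dots> \<le> K * B T * (t - s + h k)"
      unfolding B_def using jt idx_gt[of s k] that \<open>K \<ge> 0\<close>
      by (intro mult_left_mono) (auto simp: right_diff_distrib)
    finally show ?thesis .
  qed
  define Q where "Q = Pi\<^sub>E UNIV (\<lambda>t :: real. cball (0 :: 'a) (B (max t 0)))"
  have "compactin (product_topology (\<lambda>t. euclidean) UNIV) Q"
    unfolding Q_def by (simp add: compactin_PiE)
  then have "compact Q" by (simp add: euclidean_product_topology)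
  moreover have "\<forall>\<^sub>F k in sequentially. X k \<in> Q" using X_bound by (simp add: Q_def PiE_UNIV_domain)
  ultimately obtain x where x: "\<And>A. open A \<Longrightarrow> x \<in> A \<Longrightarrow> \<exists>\<^sub>F k in sequentially. X k \<in> A"
    using compact_cluster_point[of Q sequentially X] by auto
  \<comment> \<open>A basic open set of the product topology constrains finitely many coordinates:
    at finitely many times the cluster point is approximated by one common, arbitrarily late
    \<open>k\<close>.\<close>
  have approx: "\<exists>k\<ge>N. \<forall>t\<in>I. dist (X k t) (x t) < e" if "finite I" "e > 0" for I N and e :: real
  proof -
    have "open {f. \<forall>t\<in>I. f t \<in> ball (x t) e}"
      by (rule product_topology_basis'[OF \<open>finite I\<close>, of "\<lambda>t. ball (x t) e" "\<lambda>t. t"]) auto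
    then have "\<exists>\<^sub>F k in sequentially. X k \<in> {f. \<forall>t\<in>I. f t \<in> ball (x t) e}"
      using \<open>e > 0\<close> by (intro x) auto
    then show ?thesis unfolding frequently_sequentially by (auto simp: dist_commute)
  qed
  have lip: "norm (x t - x s) \<le> K * B T * (t - s)" if st: "0 \<le> s" "s \<le> t" "t \<le> T" for s t T
  proof (rule field_le_epsilon)
    fix e :: real assume "e > 0"
    define e' where "e' = e / (K * B T + 2)"
    have KB: "K * B T \<ge> 0" using \<open>K \<ge> 0\<close> B by simp
    then have "e' > 0" using \<open>e > 0\<close> by (simp add: e'_def)
    obtain N where N: "\<And>k. k \<ge> N \<Longrightarrow> h k < e'" using h_less[OF \<open>e' > 0\<close>] by auto
    obtain k where k: "k \<ge> N" "dist (X k s) (x s) < e'" "dist (X k t) (x t) < e'"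
      using approx[of "{s, t}" e' N] \<open>e' > 0\<close> by auto
    have "norm (X k t - X k s) \<le> K * B T * (t - s + h k)"
      using idx_dist[of s t T k "idx k t"] st idx_mono[of s t k] by (simp add: X_def)
    also have "\<dots> \<le> K * B T * (t - s + e')"
      using N[OF k(1)] KB by (intro mult_left_mono) auto
    finally have 1: "norm (X k t - X k s) \<le> K * B T * (t - s + e')" .
    have "norm (x t - x s) \<le> dist (X k t) (x t) + norm (X k t - X k s) + dist (X k s) (x s)"
      by norm
    also have "\<dots> \<le> K * B T * (t - s) + (K * B T + 2) * e'"
      using 1 k by (simp add: algebra_simps)
    also have "(K * B T + 2) * e' = e" using KB by (simp add: e'_def)
    finally show "norm (x t - x s) \<le> K * B T * (t - s) + e" .
  qed
  show ?thesis
  proof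
    show "x 0 = \<xi>"
    proof (rule ccontr)
      assume "x 0 \<noteq> \<xi>"
      then obtain k where "dist (X k 0) (x 0) < dist \<xi> (x 0)"
        using approx[of "{0}" "dist \<xi> (x 0)" 0] by auto
      then show False by (simp add: X_def idx_def)
    qed
  next
    fix T
    show "\<exists>L. L-lipschitz_on {0..T} x"
    proof (intro exI lipschitz_onI)
      show "K * B T \<ge> 0" using \<open>K \<ge> 0\<close> B by simp
      fix s t assume "s \<in> {0..T}" "t \<in> {0..T}"
      then show "dist (x s) (x t) \<le> K * B T * dist s t"
        using lip[of s t T] lip[of t s T]
        by (cases "s \<le> t") (auto simp: dist_norm norm_minus_commute)
    qed
  next
    fix S t assume S: "subspace S" "\<xi> \<in> S" "\<And>y. y \<in> S \<Longrightarrow> g y \<in> S"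
    show "x t \<in> S"
    proof (rule closed_approachable[THEN iffD1, OF closed_subspace[OF S(1)], rule_format])
      fix e :: real assume "e > 0"
      then obtain k where "dist (X k t) (x t) < e" using approx[of "{t}" e 0] by auto
      then show "\<exists>y\<in>S. dist y (x t) < e"
        using euler_iterate_in_subspace[of S \<xi> g] S unfolding X_def by blast
    qed
  next
    fix t v p b \<delta>
    assume t: "0 \<le> t" and v: "(x has_vector_derivative v) (at t)" and "\<delta> > 0"
      and ge: "\<And>y. dist y (x t) < \<delta> \<Longrightarrow> b \<le> p \<bullet> g y"
    define L where "L = K * B (t + 1)"
    have "L \<ge> 0" using \<open>K \<ge> 0\<close> B by (simp add: L_def)
    \<comment> \<open>Times within \<open>d\<close> of \<open>t\<close> move the scheme by less than
      \<open>\<delta> / 3\<close>; the rest of \<open>\<delta>\<close> is left for rounding and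
      approximation.\<close>
    define d where "d = min 1 (\<delta> / (4 * (L + 1)))"
    have d: "d > 0" "d \<le> 1" "L * d < \<delta> / 3"
    proof -
      show "d > 0" "d \<le> 1" using \<open>\<delta> > 0\<close> \<open>L \<ge> 0\<close> by (auto simp: d_def)
      have "L * d \<le> L * (\<delta> / (4 * (L + 1)))"
        using \<open>L \<ge> 0\<close> by (intro mult_left_mono) (auto simp: d_def)
      also have "\<dots> = \<delta> / 4 * (L / (L + 1))" by (simp add: field_simps)
      also have "\<dots> \<le> \<delta> / 4 * 1" using \<open>L \<ge> 0\<close> \<open>\<delta> > 0\<close> by (intro mult_left_mono) auto
      also have "\<dots> < \<delta> / 3" using \<open>\<delta> > 0\<close> by simp
      finally show "L * d < \<delta> / 3" .
    qed
    have *: "b * (s - t) \<le> p \<bullet> (x s - x t)" if s: "t < s" "s < t + d" for s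
    proof (rule field_le_epsilon)
      fix e :: real assume "e > 0"
      \<comment> \<open>Collects the errors per \<open>e'\<close>: \<open>\<bar>b\<bar>\<close> from
        rounding the times, \<open>2 * norm p\<close> from replacing \<open>X k\<close> by
        \<open>x\<close> at both ends; the 1 keeps it positive.\<close>
      define M where "M = \<bar>b\<bar> + 2 * norm p + 1"
      have "M > 0" by (simp add: M_def add_nonneg_pos)
      define e' where "e' = min (e / M) (\<delta> / 3 / (L + 1))"
      have e': "e' > 0" "M * e' \<le> e" "(L + 1) * e' \<le> \<delta> / 3"
      proof -
        show "e' > 0" using \<open>e > 0\<close> \<open>\<delta> > 0\<close> \<open>M > 0\<close> \<open>L \<ge> 0\<close> by (auto simp: e'_def)
        have "M * e' \<le> M * (e / M)" using \<open>M > 0\<close> by (intro mult_left_mono) (auto simp: e'_def)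
        then show "M * e' \<le> e" using \<open>M > 0\<close> by simp
        have "(L + 1) * e' \<le> (L + 1) * (\<delta> / 3 / (L + 1))"
          using \<open>L \<ge> 0\<close> by (intro mult_left_mono) (auto simp: e'_def)
        also have "\<dots> = \<delta> / 3" using \<open>L \<ge> 0\<close>
          by (metis add_nonneg_pos less_irrefl nonzero_mult_div_cancel_left times_divide_eq_right zero_less_one)
        finally show "(L + 1) * e' \<le> \<delta> / 3" .
      qed
      obtain N where N: "\<And>k. k \<ge> N \<Longrightarrow> h k < e'" using h_less[OF \<open>e' > 0\<close>] by auto
      obtain k where k: "k \<ge> N" "dist (X k s) (x s) < e'" "dist (X k t) (x t) < e'"
        using approx[of "{s, t}" e' N] \<open>e' > 0\<close> by auto
      have hk: "h k < e'" using N k by blast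
      have "b \<le> p \<bullet> g (euler_iterate g (h k) \<xi> l)" if l: "idx k t \<le> l" "l < idx k s" for l
      proof (rule ge)
        have "norm (euler_iterate g (h k) \<xi> l - X k t) \<le> L * (s - t + h k)"
          unfolding L_def using s t d l by (intro idx_dist) auto
        also have "\<dots> \<le> L * (d + e')"
          using s hk \<open>L \<ge> 0\<close> by (intro mult_left_mono) auto
        finally have "dist (euler_iterate g (h k) \<xi> l) (x t) < L * (d + e') + e'"
          using k(3) dist_triangle[of "euler_iterate g (h k) \<xi> l" "x t" "X k t"]
          by (simp add: dist_norm)
        also have "\<dots> \<le> \<delta>" using d(3) e'(3) \<open>\<delta> > 0\<close> by (simp add: algebra_simps)
        finally show "dist (euler_iterate g (h k) \<xi> l) (x t) < \<delta>" .
      qed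
      then have 1: "b * (h k * (real (idx k s) - real (idx k t))) \<le> p \<bullet> (X k s - X k t)"
        unfolding X_def using idx_mono[of t s k] s h[of k] by (intro euler_iterate_inner_ge) auto
      have "\<bar>h k * (real (idx k s) - real (idx k t)) - (s - t)\<bar> \<le> h k"
        using idx_le[of s k] idx_le[of t k] idx_gt[of s k] idx_gt[of t k] s t
        by (simp add: right_diff_distrib abs_le_iff)
      then have "\<bar>b * (h k * (real (idx k s) - real (idx k t)) - (s - t))\<bar> \<le> \<bar>b\<bar> * e'"
        unfolding abs_mult using hk by (intro mult_left_mono) auto
      then have 2: "b * (s - t) - \<bar>b\<bar> * e' \<le> b * (h k * (real (idx k s) - real (idx k t)))"
        by (simp add: right_diff_distrib abs_le_iff)
      have 3: "\<bar>p \<bullet> (X k r - x r)\<bar> \<le> norm p * e'" if "dist (X k r) (x r) < e'" for r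
      proof -
        have "\<bar>p \<bullet> (X k r - x r)\<bar> \<le> norm p * norm (X k r - x r)" by (rule Cauchy_Schwarz_ineq2)
        also have "\<dots> \<le> norm p * e'" using that by (intro mult_left_mono) (auto simp: dist_norm)
        finally show ?thesis .
      qed
      have "p \<bullet> (X k s - X k t) = p \<bullet> (x s - x t) + p \<bullet> (X k s - x s) - p \<bullet> (X k t - x t)"
        by (simp add: inner_diff_right)
      also have "\<dots> \<le> p \<bullet> (x s - x t) + 2 * norm p * e'"
        using 3[OF k(2)] 3[OF k(3)] by linarith
      finally have "b * (s - t) \<le> p \<bullet> (x s - x t) + (\<bar>b\<bar> + 2 * norm p) * e'"
        using 1 2 by (simp add: algebra_simps)
      also have "(\<bar>b\<bar> + 2 * norm p) * e' \<le> M * e'"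
        using e'(1) by (intro mult_right_mono) (auto simp: M_def)
      finally show "b * (s - t) \<le> p \<bullet> (x s - x t) + e" using e'(2) by simp
    qed
    have "((\<lambda>s. p \<bullet> x s) has_vector_derivative p \<bullet> v) (at t)"
      by (rule bounded_linear.has_vector_derivative[OF bounded_linear_inner_right v])
    then have "((\<lambda>s. p \<bullet> x s) has_real_derivative p \<bullet> v) (at t within {t<..})"
      unfolding has_real_derivative_iff_has_vector_derivative by (rule has_vector_derivative_at_within)
    then have lim: "((\<lambda>s. (p \<bullet> x s - p \<bullet> x t) / (s - t)) \<longlongrightarrow> p \<bullet> v) (at_right t)"
      by (simp add: has_field_derivative_iff)
    have "\<forall>\<^sub>F s in at_right t. b \<le> (p \<bullet> x s - p \<bullet> x t) / (s - t)"
      unfolding eventually_at_right_field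
    proof (intro exI[of _ "t + d"] conjI allI impI)
      show "t + d > t" using d by simp
      fix s assume "t < s" "s < t + d"
      with *[of s] show "b \<le> (p \<bullet> x s - p \<bullet> x t) / (s - t)"
        by (simp add: pos_le_divide_eq inner_diff_right)
    qed
    with lim show "b \<le> p \<bullet> v" by (intro tendsto_lowerbound[OF lim]) auto
  qed
qed

section \<open>Existence for the Filippov inclusion and extension to all times\<close>

lemma AE_lebesgue_compose_isometry:
  fixes f g :: "real \<Rightarrow> real"
  assumes P: "AE t in lebesgue. P t" and g: "\<And>s t. \<bar>g s - g t\<bar> = \<bar>s - t\<bar>" "\<And>t. g (f t) = t"
  shows "AE t in lebesgue. P (f t)"
proof -
  have "negligible (g ` {t. \<not> P t})"
  proof (rule negligible_locally_Lipschitz_image)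
    show "\<exists>T B. open T \<and> t \<in> T \<and> (\<forall>s\<in>{t. \<not> P t} \<inter> T. norm (g s - g t) \<le> B * norm (s - t))" for t
      by (rule exI[of _ UNIV], rule exI[of _ 1]) (simp add: g(1))
  qed (use P in \<open>auto simp: AE_lebesgue_iff_negligible\<close>)
  moreover have "{t. \<not> P (f t)} \<subseteq> g ` {t. \<not> P t}"
    by (auto intro!: image_eqI[of _ g] simp: g(2))
  ultimately show ?thesis
    unfolding AE_lebesgue_iff_negligible by (rule negligible_subset)
qed

lemma matrix_vector_mult_bound:
  fixes A :: "real^'n^'m"
  obtains K where "K \<ge> 0" "\<And>y. norm (A *v y) \<le> K * norm y"
proof -
  interpret bounded_linear "(*v) A" by (rule matrix_vector_mul_bounded_linear)
  show ?thesis using nonneg_bounded that by (metis mult.commute)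
qed

lemma filippov_map_convex_closed:
  "convex (filippov_map c A\<^sub>1 A\<^sub>2 x)" "closed (filippov_map c A\<^sub>1 A\<^sub>2 x)"
  unfolding filippov_map_def by (auto simp: finite_imp_compact_convex_hull compact_imp_closed)

text \<open>Euler steps use the discontinuous selection \<open>g\<close>. If a derivative of the
  limit were not admissible, a hyperplane would separate it strictly from the closed convex set of
  admissible velocities; near \<open>x t\<close> all values of \<open>g\<close> lie on the side of
  that set, and then so does the derivative, a contradiction. The invariant subspace
  \<open>S\<close> allows solutions confined to the unobservable subspace.\<close>

lemma filippov_forward_solution:
  fixes A\<^sub>1 A\<^sub>2 :: "real^'n^'n" and c \<xi> :: "real^'n"
  assumes S: "subspace S" "\<xi> \<in> S" "\<And>y. y \<in> S \<Longrightarrow> A\<^sub>1 *v y \<in> S" "\<And>y. y \<in> S \<Longrightarrow> A\<^sub>2 *v y \<in> S"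
  obtains x where "x 0 = \<xi>" "\<And>T. \<exists>L. L-lipschitz_on {0..T} x" "\<And>t. x t \<in> S"
    "AE t in lebesgue. 0 < t \<longrightarrow> (\<exists>v\<in>filippov_map c A\<^sub>1 A\<^sub>2 (x t). (x has_vector_derivative v) (at t))"
proof -
  define g where "g y = (if c \<bullet> y \<le> 0 then A\<^sub>1 *v y else A\<^sub>2 *v y)" for y
  obtain K\<^sub>1 where K\<^sub>1: "K\<^sub>1 \<ge> 0" "\<And>y. norm (A\<^sub>1 *v y) \<le> K\<^sub>1 * norm y"
    using matrix_vector_mult_bound by blast
  obtain K\<^sub>2 where K\<^sub>2: "K\<^sub>2 \<ge> 0" "\<And>y. norm (A\<^sub>2 *v y) \<le> K\<^sub>2 * norm y"
    using matrix_vector_mult_bound by blast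
  have gK: "norm (g y) \<le> max K\<^sub>1 K\<^sub>2 * norm y" for y
    using K\<^sub>1(2)[of y] K\<^sub>2(2)[of y] mult_right_mono[of K\<^sub>1 "max K\<^sub>1 K\<^sub>2" "norm y"]
      mult_right_mono[of K\<^sub>2 "max K\<^sub>1 K\<^sub>2" "norm y"] by (auto simp: g_def intro: order_trans)
  have "max K\<^sub>1 K\<^sub>2 \<ge> 0" using K\<^sub>1 by simp
  from euler_cluster_point[of g, OF gK this, of \<xi>]
  obtain x where x: "x 0 = \<xi>" "\<And>T. \<exists>L. L-lipschitz_on {0..T} x"
    "\<And>S t. \<lbrakk>subspace S; \<xi> \<in> S; \<And>y. y \<in> S \<Longrightarrow> g y \<in> S\<rbrakk> \<Longrightarrow> x t \<in> S"
    "\<And>t v p b \<delta>. \<lbrakk>0 \<le> t; (x has_vector_derivative v) (at t); \<delta> > 0;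
      \<And>y. dist y (x t) < \<delta> \<Longrightarrow> b \<le> p \<bullet> g y\<rbrakk> \<Longrightarrow> b \<le> p \<bullet> v"
    by blast
  have incl: "v \<in> filippov_map c A\<^sub>1 A\<^sub>2 (x t)" if "t \<ge> 0" and v: "(x has_vector_derivative v) (at t)" for t v
  proof (rule ccontr)
    assume "v \<notin> filippov_map c A\<^sub>1 A\<^sub>2 (x t)"
    then obtain p b where p: "p \<bullet> v < b" "\<And>w. w \<in> filippov_map c A\<^sub>1 A\<^sub>2 (x t) \<Longrightarrow> b < p \<bullet> w"
      using separating_hyperplane_closed_point[OF filippov_map_convex_closed] by blast
    have "open {y. b < p \<bullet> (A *v y)}" for A :: "real^'n^'n"
      by (intro open_Collect_less continuous_intros bounded_linear.continuous_on[OF matrix_vector_mul_bounded_linear])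
    then have ev: "\<forall>\<^sub>F y in nhds (x t). b < p \<bullet> (A *v y)" if "b < p \<bullet> (A *v x t)" for A :: "real^'n^'n"
      using that eventually_nhds_in_open[of "{y. b < p \<bullet> (A *v y)}" "x t"] by simp
    have c_neg: "\<forall>\<^sub>F y in nhds (x t). c \<bullet> y < 0" if "c \<bullet> x t < 0"
      using that eventually_nhds_in_open[of "{y. c \<bullet> y < 0}" "x t"] by (simp add: open_halfspace_lt)
    have c_pos: "\<forall>\<^sub>F y in nhds (x t). c \<bullet> y > 0" if "c \<bullet> x t > 0"
      using that eventually_nhds_in_open[of "{y. c \<bullet> y > 0}" "x t"] by (simp add: open_halfspace_gt)
    have "\<forall>\<^sub>F y in nhds (x t). b \<le> p \<bullet> g y"
    proof -
      consider "c \<bullet> x t < 0" | "c \<bullet> x t = 0" | "c \<bullet> x t > 0" by linarith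
      then show ?thesis
      proof cases
        case 1
        then have "b < p \<bullet> (A\<^sub>1 *v x t)" using p(2) by (simp add: filippov_map_def)
        from ev[OF this] c_neg[OF 1] show ?thesis
          by eventually_elim (simp add: g_def)
      next
        case 2
        \<comment> \<open>Both generators of the hull lie beyond the hyperplane, so it does not
          matter which one \<open>g\<close> selects nearby.\<close>
        then have "b < p \<bullet> (A\<^sub>1 *v x t)" "b < p \<bullet> (A\<^sub>2 *v x t)"
          using p(2) by (auto simp: filippov_map_def hull_inc)
        from ev[OF this(1)] ev[OF this(2)] show ?thesis
          by eventually_elim (simp add: g_def)
      next
        case 3
        then have "b < p \<bullet> (A\<^sub>2 *v x t)" using p(2) by (simp add: filippov_map_def)
        from ev[OF this] c_pos[OF 3] show ?thesis
          by eventually_elim (simp add: g_def)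
      qed
    qed
    then obtain \<delta> where "\<delta> > 0" "\<And>y. dist y (x t) < \<delta> \<Longrightarrow> b \<le> p \<bullet> g y"
      unfolding eventually_nhds_metric by blast
    then have "b \<le> p \<bullet> v" using x(4)[OF \<open>t \<ge> 0\<close> v] by blast
    with p(1) show False by simp
  qed
  have "AE t in lebesgue. 0 < t \<and> t < real n \<longrightarrow> (\<exists>v. (x has_vector_derivative v) (at t))" for n
  proof -
    obtain L where L: "L-lipschitz_on {0..real n} x" using x(2) by blast
    \<comment> \<open>Clamping the time gives a globally Lipschitz curve that agrees with
      \<open>x\<close> on the open interval.\<close>
    define f where "f t = x (max 0 (min (real n) t))" for t
    have "L-lipschitz_on UNIV f"
    proof (rule lipschitz_onI)
      fix s t :: real
      have "dist (f s) (f t) \<le> L * dist (max 0 (min (real n) s)) (max 0 (min (real n) t))"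
        unfolding f_def by (rule lipschitz_onD[OF L]) auto
      also have "\<dots> \<le> L * dist s t"
        using lipschitz_on_nonneg[OF L] by (intro mult_left_mono) (auto simp: dist_real_def)
      finally show "dist (f s) (f t) \<le> L * dist s t" .
    qed (rule lipschitz_on_nonneg[OF L])
    then have "AE t in lebesgue. \<exists>v. (f has_vector_derivative v) (at t)"
      by (rule lipschitz_has_vector_derivative_AE)
    then show ?thesis
    proof eventually_elim
      case (elim t)
      then obtain v where "(f has_vector_derivative v) (at t)" by blast
      then have "(x has_vector_derivative v) (at t)" if "0 < t \<and> t < real n"
        by (rule has_vector_derivative_transform_within_open[where S = "{0<..<real n}"])
          (use that in \<open>auto simp: f_def\<close>)
      then show ?case by blast
    qed
  qed
  then have "AE t in lebesgue. \<forall>n. 0 < t \<and> t < real n \<longrightarrow> (\<exists>v. (x has_vector_derivative v) (at t))"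
    unfolding AE_all_countable by blast
  then have "AE t in lebesgue. 0 < t \<longrightarrow> (\<exists>v\<in>filippov_map c A\<^sub>1 A\<^sub>2 (x t). (x has_vector_derivative v) (at t))"
  proof eventually_elim
    case (elim t)
    obtain n where "t < real n" using reals_Archimedean2 by blast
    then show ?case using elim incl by (meson less_imp_le)
  qed
  moreover have "x t \<in> S" for t by (rule x(3)) (use S in \<open>auto simp: g_def\<close>)
  ultimately show ?thesis using x(1,2) that by blast
qed

text \<open>Time reversal: velocities change sign while the regions, given by the sign of
  \<open>c \<bullet> y\<close>, stay the same.\<close>

lemma filippov_map_uminus: "filippov_map (c :: real^'n) (- A\<^sub>1) (- A\<^sub>2) y = uminus ` filippov_map c A\<^sub>1 A\<^sub>2 y"
proof -
  have "convex hull (uminus ` {A\<^sub>1 *v y, A\<^sub>2 *v y}) = uminus ` (convex hull {A\<^sub>1 *v y, A\<^sub>2 *v y})"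
    by (rule convex_hull_linear_image[symmetric]) (simp add: linear_iff)
  moreover have "(- A) *v y = - (A *v y)" for A :: "real^'n^'n"
    by (metis diff_0 matrix_vector_mult_diff_rdistrib matrix_vector_mult_0)
  ultimately show ?thesis by (simp add: filippov_map_def)
qed

text \<open>The backward extension is a forward solution of the system with matrices \<open>-A\<^sub>1\<close>, \<open>-A\<^sub>2\<close>.\<close>

lemma filippov_solution_extend:
  fixes A\<^sub>1 A\<^sub>2 :: "real^'n^'n"
  assumes "\<epsilon> > 0" and lip: "L-lipschitz_on {0..\<epsilon>} y"
    and y: "AE t in lebesgue. 0 < t \<and> t < \<epsilon> \<longrightarrow>
      (\<exists>v\<in>filippov_map c A\<^sub>1 A\<^sub>2 (y t). (y has_vector_derivative v) (at t))"
  obtains x where "filippov_solution c A\<^sub>1 A\<^sub>2 (y 0) x" "\<And>t. t \<in> {0..\<epsilon>} \<Longrightarrow> x t = y t"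
proof -
  obtain f where f: "f 0 = y \<epsilon>" "\<And>T. \<exists>L. L-lipschitz_on {0..T} f"
    "AE t in lebesgue. 0 < t \<longrightarrow> (\<exists>v\<in>filippov_map c A\<^sub>1 A\<^sub>2 (f t). (f has_vector_derivative v) (at t))"
    by (rule filippov_forward_solution[of UNIV "y \<epsilon>" A\<^sub>1 A\<^sub>2 c]) auto
  obtain w where w: "w 0 = y 0" "\<And>T. \<exists>L. L-lipschitz_on {0..T} w"
    "AE t in lebesgue. 0 < t \<longrightarrow> (\<exists>v\<in>filippov_map c (- A\<^sub>1) (- A\<^sub>2) (w t). (w has_vector_derivative v) (at t))"
    by (rule filippov_forward_solution[of UNIV "y 0" "- A\<^sub>1" "- A\<^sub>2" c]) auto
  define x where "x t = (if t \<le> 0 then w (- t) else if t \<le> \<epsilon> then y t else f (t - \<epsilon>))" for t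
  have "absolutely_continuous_on_Icc a b x" for a b
  proof -
    define T where "T = \<bar>a\<bar> + \<bar>b\<bar> + \<epsilon>"
    obtain L\<^sub>1 where L\<^sub>1: "L\<^sub>1-lipschitz_on {0..T} w" using w(2) by blast
    have "L\<^sub>1-lipschitz_on {-T..0} (\<lambda>t. w (- t))"
    proof (rule lipschitz_onI)
      show "dist (w (- s)) (w (- t)) \<le> L\<^sub>1 * dist s t" if "s \<in> {-T..0}" "t \<in> {-T..0}" for s t
        using lipschitz_onD[OF L\<^sub>1, of "- s" "- t"] that by (simp add: dist_real_def abs_minus_commute)
    qed (rule lipschitz_on_nonneg[OF L\<^sub>1])
    moreover obtain L\<^sub>2 where L\<^sub>2: "L\<^sub>2-lipschitz_on {0..T} f" using f(2) by blast
    have "L\<^sub>2-lipschitz_on {\<epsilon>..T} (\<lambda>t. f (t - \<epsilon>))"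
    proof (intro lipschitz_onI)
      fix s t assume "s \<in> {\<epsilon>..T}" "t \<in> {\<epsilon>..T}"
      then show "dist (f (s - \<epsilon>)) (f (t - \<epsilon>)) \<le> L\<^sub>2 * dist s t"
        using lipschitz_onD[OF L\<^sub>2, of "s - \<epsilon>" "t - \<epsilon>"] \<open>\<epsilon> > 0\<close> by (simp add: dist_real_def)
    qed (rule lipschitz_on_nonneg[OF L\<^sub>2])
    with lip have "(max L L\<^sub>2)-lipschitz_on {0..T} (\<lambda>t. if t \<le> \<epsilon> then y t else f (t - \<epsilon>))"
      by (rule lipschitz_on_concat_max) (simp add: f(1))
    ultimately have "(max L\<^sub>1 (max L L\<^sub>2))-lipschitz_on {-T..T} x"
      unfolding x_def by (rule lipschitz_on_concat_max) (use \<open>\<epsilon> > 0\<close> in \<open>simp add: w(1)\<close>)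
    then have "absolutely_continuous_on_Icc (-T) T x"
      by (rule lipschitz_imp_absolutely_continuous_on_Icc)
    then show ?thesis
      by (rule absolutely_continuous_on_Icc_subset) (use \<open>\<epsilon> > 0\<close> in \<open>auto simp: T_def\<close>)
  qed
  moreover have "AE t in lebesgue. \<exists>v\<in>filippov_map c A\<^sub>1 A\<^sub>2 (x t). (x has_vector_derivative v) (at t)"
  proof -
    have f': "AE t in lebesgue. 0 < t - \<epsilon> \<longrightarrow>
      (\<exists>v\<in>filippov_map c A\<^sub>1 A\<^sub>2 (f (t - \<epsilon>)). (f has_vector_derivative v) (at (t - \<epsilon>)))"
      by (rule AE_lebesgue_compose_isometry[OF f(3), of "\<lambda>t. t + \<epsilon>"]) auto
    have w': "AE t in lebesgue. 0 < - t \<longrightarrow>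
      (\<exists>v\<in>filippov_map c (- A\<^sub>1) (- A\<^sub>2) (w (- t)). (w has_vector_derivative v) (at (- t)))"
      by (rule AE_lebesgue_compose_isometry[OF w(3), of "\<lambda>t. - t"]) (auto simp: abs_minus_commute)
    \<comment> \<open>At the two junctions the one-sided derivatives may differ.\<close>
    have "AE t in lebesgue. t \<notin> {0, \<epsilon>}"
      unfolding AE_lebesgue_iff_negligible by (rule negligible_subset[of "{0, \<epsilon>}"]) auto
    with y f' w' show ?thesis
    proof eventually_elim
      case (elim t)
      then consider "t < 0" | "0 < t" "t < \<epsilon>" | "t > \<epsilon>" by force
      then show ?case
      proof cases
        case 1
        then obtain v where v: "v \<in> filippov_map c A\<^sub>1 A\<^sub>2 (w (- t))" "(w has_vector_derivative - v) (at (- t))"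
          using elim unfolding filippov_map_uminus by auto
        have "(uminus has_vector_derivative (- 1)) (at t)"
          by (auto intro!: derivative_eq_intros)
        from vector_diff_chain_at[OF this v(2)] have "((\<lambda>t. w (- t)) has_vector_derivative v) (at t)"
          by (simp add: o_def)
        then have "(x has_vector_derivative v) (at t)"
          by (rule has_vector_derivative_transform_within_open[where S = "{..<0}"])
            (use 1 in \<open>auto simp: x_def\<close>)
        then show ?thesis using v(1) 1 by (auto simp: x_def)
      next
        case 2
        then obtain v where v: "v \<in> filippov_map c A\<^sub>1 A\<^sub>2 (y t)" "(y has_vector_derivative v) (at t)"
          using elim by auto
        from v(2) have "(x has_vector_derivative v) (at t)"
          by (rule has_vector_derivative_transform_within_open[where S = "{0<..<\<epsilon>}"])
            (use 2 in \<open>auto simp: x_def\<close>)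
        then show ?thesis using v(1) 2 by (auto simp: x_def)
      next
        case 3
        then obtain v where v: "v \<in> filippov_map c A\<^sub>1 A\<^sub>2 (f (t - \<epsilon>))" "(f has_vector_derivative v) (at (t - \<epsilon>))"
          using elim by auto
        have "((\<lambda>t. t - \<epsilon>) has_vector_derivative 1) (at t)"
          by (auto intro!: derivative_eq_intros)
        from vector_diff_chain_at[OF this v(2)] have "((\<lambda>t. f (t - \<epsilon>)) has_vector_derivative v) (at t)"
          by (simp add: o_def)
        then have "(x has_vector_derivative v) (at t)"
          by (rule has_vector_derivative_transform_within_open[where S = "{\<epsilon><..}"])
            (use 3 \<open>\<epsilon> > 0\<close> in \<open>auto simp: x_def\<close>)
        then show ?thesis using v(1) 3 \<open>\<epsilon> > 0\<close> by (auto simp: x_def)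
      qed
    qed
  qed
  moreover have "x t = y t" if "t \<in> {0..\<epsilon>}" for t using that w(1) by (auto simp: x_def)
  moreover from this have "x 0 = y 0" using \<open>\<epsilon> > 0\<close> by simp
  ultimately show ?thesis using that unfolding filippov_solution_def by blast
qed

section \<open>Observability rows and uniqueness\<close>

lemma obs_row_0 [simp]: "obs_row c A 0 = c"
  by (simp add: obs_row_def matrix_power_def)

lemma obs_row_Suc: "obs_row c A (Suc k) = obs_row c A k v* A"
proof -
  have "matrix_power A (Suc k) = matrix_power A k ** A"
    by (induction k) (simp_all add: matrix_power_def matrix_mul_assoc)
  then show ?thesis by (simp add: obs_row_def vector_matrix_mul_assoc)
qed

lemma obs_row_Suc_inner: "obs_row c A (Suc k) \<bullet> x = obs_row c A k \<bullet> (A *v x)"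
  by (simp add: obs_row_Suc dot_lmul_matrix)

lemma vector_matrix_mult_span:
  fixes A :: "real^'n^'n"
  assumes "w \<in> span S"
  shows "w v* A \<in> span ((\<lambda>r. r v* A) ` S)"
proof -
  have "linear (\<lambda>r. r v* A)"
    by (rule linearI) (simp_all add: vector_matrix_left_distrib scaleR_vector_matrix_assoc)
  from linear_span_image[OF this, of S] show ?thesis using assms by blast
qed

context
  fixes c :: "real^'n" and A :: "real^'n^'n" and h :: nat
  assumes c: "c \<noteq> 0" and h: "h = observability_index c A"
begin

private lemma observability_index_greatest:
  "dim (obs_row c A ` {..h}) = h + 1" "dim (obs_row c A ` {..k}) = k + 1 \<Longrightarrow> k \<le> h"
proof -
  have 0: "dim (obs_row c A ` {..0}) = 0 + 1" using c by (simp add: dim_singleton)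
  have bound: "k \<le> CARD('n)" if "dim (obs_row c A ` {..k}) = k + 1" for k
    using dim_subset_UNIV_cart[of "obs_row c A ` {..k}"] that by simp
  show "dim (obs_row c A ` {..h}) = h + 1"
    unfolding h observability_index_def
    by (rule GreatestI_nat[where P = "\<lambda>k. dim (obs_row c A ` {..k}) = k + 1", OF 0 bound])
  show "dim (obs_row c A ` {..k}) = k + 1 \<Longrightarrow> k \<le> h"
    unfolding h observability_index_def
    by (rule Greatest_le_nat[where P = "\<lambda>k. dim (obs_row c A ` {..k}) = k + 1", OF _ bound])
qed

text \<open>If row \<open>k\<close> depended on its predecessors, the span of \<open>h + 1\<close>
  rows would be generated by \<open>h\<close> of them, against full rank. Independence from the
  predecessors is the form suited to induction over the rows.\<close>

lemma obs_row_notin_span: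
  assumes "k \<le> h"
  shows "obs_row c A k \<notin> span (obs_row c A ` {..<k})"
proof
  assume "obs_row c A k \<in> span (obs_row c A ` {..<k})"
  then have "obs_row c A k \<in> span (obs_row c A ` ({..h} - {k}))"
    by (rule subsetD[OF span_mono, rotated]) (use assms in auto)
  then have "dim (insert (obs_row c A k) (obs_row c A ` ({..h} - {k}))) = dim (obs_row c A ` ({..h} - {k}))"
    by (simp add: dim_insert)
  also have "insert (obs_row c A k) (obs_row c A ` ({..h} - {k})) = obs_row c A ` {..h}"
    using assms by auto
  finally have "h + 1 = dim (obs_row c A ` ({..h} - {k}))"
    using observability_index_greatest(1) by simp
  also have "\<dots> \<le> card (obs_row c A ` ({..h} - {k}))" by (intro dim_le_card') auto
  also have "\<dots> \<le> card ({..h} - {k})" by (intro card_image_le) auto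
  also have "\<dots> = h" using assms by simp
  finally show False by simp
qed

text \<open>Maximality of \<open>h\<close> puts row \<open>h + 1\<close> into the span of rows 0 to
  \<open>h\<close>; that span is therefore invariant under right multiplication by \<open>A\<close>,
  and all later rows follow.\<close>

lemma obs_row_in_span: "obs_row c A k \<in> span (obs_row c A ` {..h})"
proof -
  have Suc_h: "obs_row c A (Suc h) \<in> span (obs_row c A ` {..h})"
  proof (rule ccontr)
    assume "obs_row c A (Suc h) \<notin> span (obs_row c A ` {..h})"
    then have "dim (obs_row c A ` {..Suc h}) = Suc h + 1"
      using observability_index_greatest(1) by (simp add: atMost_Suc dim_insert)
    then show False using observability_index_greatest(2) by fastforce
  qed
  show ?thesis
  proof (induction k)
    case 0
    have "obs_row c A 0 \<in> obs_row c A ` {..h}" by blast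
    then show ?case by (rule span_base)
  next
    case (Suc k)
    from vector_matrix_mult_span[OF this, of A]
    have "obs_row c A (Suc k) \<in> span ((\<lambda>r. r v* A) ` obs_row c A ` {..h})"
      by (simp add: obs_row_Suc)
    also have "\<dots> \<subseteq> span (obs_row c A ` {..h})"
    proof (rule span_minimal)
      show "(\<lambda>r. r v* A) ` obs_row c A ` {..h} \<subseteq> span (obs_row c A ` {..h})"
      proof clarify
        fix j assume "j \<le> h"
        have "obs_row c A (Suc j) \<in> span (obs_row c A ` {..h})"
          using Suc_h \<open>j \<le> h\<close> by (cases "j = h") (auto intro: span_base)
        then show "obs_row c A j v* A \<in> span (obs_row c A ` {..h})" by (simp add: obs_row_Suc)
      qed
    qed auto
    finally show ?case .
  qed
qed

text \<open>Replaces finitely many conditions by all of them: the kernel of rows 0 to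
  \<open>h\<close> is the unobservable subspace, which \<open>A\<close> maps into itself.\<close>

lemma obs_row_inner_eq_0:
  assumes "\<And>k. k \<le> h \<Longrightarrow> obs_row c A k \<bullet> x = 0"
  shows "obs_row c A k \<bullet> x = 0"
  using obs_row_in_span[of k]
  by (induction rule: span_induct) (use assms in \<open>auto simp: subspace_def inner_add_left\<close>)

end

section \<open>Lexicographic signs and the triangular relation between the rows\<close>

definition lex_neg :: "(nat \<Rightarrow> real) \<Rightarrow> bool" where
  "lex_neg f \<longleftrightarrow> (\<exists>k. (\<forall>j<k. f j = 0) \<and> f k < 0)"

text \<open>Negative, positive or zero. Since \<open>lex_neg\<close> refers to the whole infinite
  sequence, the two modes can be compared before their observability indices are known to
  agree.\<close>

lemma lex_neg_cases: "lex_neg f \<or> lex_neg (\<lambda>k. - f k) \<or> (\<forall>k. f k = 0)"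
proof (cases "\<exists>k. f k \<noteq> 0")
  case True
  define k where "k = (LEAST k. f k \<noteq> 0)"
  have "f k \<noteq> 0" "\<And>j. j < k \<Longrightarrow> f j = 0"
    using LeastI_ex[OF True] not_less_Least by (auto simp: k_def)
  then show ?thesis unfolding lex_neg_def
    by (metis add.inverse_neutral less_linear neg_less_0_iff_less)
qed simp

text \<open>The witness is the component of \<open>w\<close> orthogonal to
  \<open>span S\<close>.\<close>

lemma notin_span_separate:
  fixes w :: "'a::euclidean_space"
  assumes "w \<notin> span S"
  shows "\<exists>z. (\<forall>y\<in>S. y \<bullet> z = 0) \<and> w \<bullet> z > 0"
proof -
  obtain y z where yz: "y \<in> span S" "\<And>u. u \<in> span S \<Longrightarrow> orthogonal z u" "w = y + z"
    using orthogonal_subspace_decomp_exists[of S w] by metis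
  have "z \<noteq> 0" using yz assms by auto
  moreover have "y \<bullet> z = 0" using yz(1,2) by (metis orthogonal_def inner_commute)
  ultimately have "w \<bullet> z > 0" using yz(3) by (simp add: inner_add_left)
  moreover have "u \<bullet> z = 0" if "u \<in> S" for u
    using yz(2)[OF span_base[OF that]] by (simp add: orthogonal_def inner_commute)
  ultimately show ?thesis by blast
qed

lemma span_image_lessThan_coeffs:
  fixes f :: "nat \<Rightarrow> 'a::real_vector"
  assumes "w \<in> span (f ` {..<k})"
  shows "\<exists>u. w = (\<Sum>j<k. u j *\<^sub>R f j)"
  using assms
proof (induction k arbitrary: w)
  case (Suc k)
  then obtain a where "w - a *\<^sub>R f k \<in> span (f ` {..<k})"
    by (auto simp: lessThan_Suc span_breakdown_eq)
  then obtain u where "w - a *\<^sub>R f k = (\<Sum>j<k. u j *\<^sub>R f j)" using Suc.IH by blast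
  then have "w = (\<Sum>j<Suc k. (u(k := a)) j *\<^sub>R f j)" by (simp add: algebra_simps)
  then show ?case by blast
qed simp

text \<open>Turns dependence on earlier rows into the perturbation bound of
  \<open>triangular_system_negative\<close>; the constant is uniform in the state.\<close>

lemma span_inner_bound:
  fixes f :: "nat \<Rightarrow> 'a::euclidean_space"
  assumes "w \<in> span (f ` {..k})"
  obtains C where "C \<ge> 0" "\<And>x. \<bar>w \<bullet> x\<bar> \<le> C * (\<Sum>i\<le>k. \<bar>f i \<bullet> x\<bar>)"
proof -
  obtain u where u: "w = (\<Sum>j\<le>k. u j *\<^sub>R f j)"
    using span_image_lessThan_coeffs[of w f "Suc k"] assms by (auto simp: lessThan_Suc_atMost)
  show ?thesis
  proof
    show "(\<Sum>j\<le>k. \<bar>u j\<bar>) \<ge> 0" by (simp add: sum_nonneg)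
    fix x
    have "\<bar>w \<bullet> x\<bar> \<le> (\<Sum>j\<le>k. \<bar>u j\<bar> * \<bar>f j \<bullet> x\<bar>)"
      unfolding u by (simp add: inner_sum_left flip: abs_mult)
    also have "\<dots> \<le> (\<Sum>j\<le>k. \<bar>u j\<bar> * (\<Sum>i\<le>k. \<bar>f i \<bullet> x\<bar>))"
      by (intro sum_mono mult_left_mono member_le_sum) auto
    finally show "\<bar>w \<bullet> x\<bar> \<le> (\<Sum>j\<le>k. \<bar>u j\<bar>) * (\<Sum>i\<le>k. \<bar>f i \<bullet> x\<bar>)"
      by (simp add: sum_distrib_right)
  qed
qed

text \<open>On the common kernel of the first \<open>k\<close> rows, the half spaces cut out by \<open>r k\<close> and \<open>s k\<close> agree,
  hence the two functionals are positive multiples of each other there.\<close>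

lemma lex_neg_proportional:
  fixes r s :: "nat \<Rightarrow> 'a::euclidean_space"
  assumes span: "span (r ` {..<k}) = span (s ` {..<k})"
    and r: "r k \<notin> span (r ` {..<k})" and s: "s k \<notin> span (s ` {..<k})"
    and lex: "\<And>x. lex_neg (\<lambda>j. s j \<bullet> x) \<Longrightarrow> lex_neg (\<lambda>j. r j \<bullet> x)"
  shows "\<exists>\<mu>>0. r k - \<mu> *\<^sub>R s k \<in> span (s ` {..<k})"
proof -
  have ker: "r j \<bullet> x = 0" if "\<And>j. j < k \<Longrightarrow> s j \<bullet> x = 0" "j < k" for x j
  proof -
    have "r j \<in> span (s ` {..<k})" using that(2) span by (metis imageI lessThan_iff span_base)
    then show ?thesis
      by (induction rule: span_induct) (use that(1) in \<open>auto simp: subspace_def inner_add_left\<close>)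
  qed
  \<comment> \<open>On the kernel of the first \<open>k\<close> rows the leading entry of the
    \<open>r\<close> sequence sits at \<open>k\<close> or later, so its negativity leaves only the
    weak inequality at \<open>k\<close>.\<close>
  have neg: "r k \<bullet> x \<le> 0" if x: "\<And>j. j < k \<Longrightarrow> s j \<bullet> x = 0" "s k \<bullet> x < 0" for x
  proof -
    have "lex_neg (\<lambda>j. s j \<bullet> x)" using x unfolding lex_neg_def by blast
    then obtain m where m: "\<And>j. j < m \<Longrightarrow> r j \<bullet> x = 0" "r m \<bullet> x < 0"
      using lex unfolding lex_neg_def by blast
    then show ?thesis using ker[of x m] x(1) by (cases m k rule: linorder_cases) auto
  qed
  obtain z where z: "\<And>j. j < k \<Longrightarrow> s j \<bullet> z = 0" "s k \<bullet> z > 0"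
    using notin_span_separate[OF s] by auto
  define \<mu> where "\<mu> = (r k \<bullet> z) / (s k \<bullet> z)"
  have eq: "r k \<bullet> x = \<mu> * (s k \<bullet> x)" if x: "\<And>j. j < k \<Longrightarrow> s j \<bullet> x = 0" for x
  proof -
    \<comment> \<open>Removes the component along \<open>z\<close>, so that \<open>s k\<close>
      vanishes as well. The line \<open>- z + a *\<^sub>R x'\<close> then stays where
      \<open>r k\<close> is nonpositive, and an affine function bounded above on a line is
      constant.\<close>
    define x' where "x' = x - ((s k \<bullet> x) / (s k \<bullet> z)) *\<^sub>R z"
    have x': "s k \<bullet> x' = 0" "\<And>j. j < k \<Longrightarrow> s j \<bullet> x' = 0"
      using z x by (auto simp: x'_def inner_diff_right)
    have "r k \<bullet> (- z + a *\<^sub>R x') \<le> 0" for a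
      by (rule neg) (use z x' in \<open>auto simp: inner_add_right inner_diff_right\<close>)
    then have le: "a * (r k \<bullet> x') \<le> r k \<bullet> z" for a by (simp add: inner_diff_right)
    have "r k \<bullet> x' = 0"
    proof (rule ccontr)
      assume "r k \<bullet> x' \<noteq> 0"
      then show False using le[of "(r k \<bullet> z + 1) / (r k \<bullet> x')"] by simp
    qed
    then show ?thesis by (simp add: x'_def inner_diff_right \<mu>_def)
  qed
  have in_span: "r k - \<mu> *\<^sub>R s k \<in> span (s ` {..<k})"
  proof (rule ccontr)
    assume "r k - \<mu> *\<^sub>R s k \<notin> span (s ` {..<k})"
    then obtain x where "\<And>j. j < k \<Longrightarrow> s j \<bullet> x = 0" "(r k - \<mu> *\<^sub>R s k) \<bullet> x > 0"
      using notin_span_separate by blast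
    then show False using eq[of x] by (simp add: inner_diff_left)
  qed
  have "r k \<bullet> (- z) \<le> 0" by (rule neg) (use z in auto)
  then have "\<mu> \<ge> 0" using z(2) by (simp add: \<mu>_def)
  \<comment> \<open>Independence of \<open>r k\<close> from its predecessors upgrades the weak
    inequality to a strict one.\<close>
  moreover have "\<mu> \<noteq> 0"
  proof
    assume "\<mu> = 0"
    then have "r k \<in> span (s ` {..<k})" using in_span by simp
    then show False using r unfolding span by contradiction
  qed
  ultimately have "\<mu> > 0" by simp
  then show ?thesis using in_span by blast
qed

text \<open>Row by row, the spans agree and each \<open>r k\<close> is a positive multiple of
  \<open>s k\<close> up to earlier rows. If one list had more independent rows, its next row would
  be negative on a vector that annihilates every row of the other, contradicting
  \<open>lex\<close>.\<close>

lemma lex_neg_rows_triangular: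
  fixes r s :: "nat \<Rightarrow> 'a::euclidean_space"
  assumes r: "\<And>k. k \<le> h \<Longrightarrow> r k \<notin> span (r ` {..<k})" "\<And>k. r k \<in> span (r ` {..h})"
    and s: "\<And>k. k \<le> h' \<Longrightarrow> s k \<notin> span (s ` {..<k})" "\<And>k. s k \<in> span (s ` {..h'})"
    and lex: "\<And>x. lex_neg (\<lambda>j. r j \<bullet> x) \<longleftrightarrow> lex_neg (\<lambda>j. s j \<bullet> x)"
  shows "h = h'" and "\<exists>M. (\<forall>i\<le>h. \<forall>j\<le>h. i < j \<longrightarrow> M i j = 0) \<and> (\<forall>i\<le>h. M i i > 0) \<and>
    (\<forall>i\<le>h. r i = (\<Sum>j\<le>h. M i j *\<^sub>R s j))"
proof -
  have span_eq: "span (r ` {..<k}) = span (s ` {..<k})" if "k \<le> Suc h" "k \<le> Suc h'" for k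
    using that
  proof (induction k)
    case (Suc k)
    then have IH: "span (r ` {..<k}) = span (s ` {..<k})" by simp
    obtain \<mu> where \<mu>: "\<mu> > 0" "r k - \<mu> *\<^sub>R s k \<in> span (s ` {..<k})"
      using lex_neg_proportional[OF IH r(1)[of k] s(1)[of k]] lex Suc.prems by auto
    have "r k \<in> span (insert (s k) (s ` {..<k}))"
      using \<mu>(2) by (auto simp: span_breakdown_eq)
    moreover have "s k \<in> span (insert (r k) (r ` {..<k}))"
    proof -
      have "(- 1 / \<mu>) *\<^sub>R (r k - \<mu> *\<^sub>R s k) \<in> span (r ` {..<k})"
        unfolding IH using \<mu>(2) by (rule span_scale)
      also have "(- 1 / \<mu>) *\<^sub>R (r k - \<mu> *\<^sub>R s k) = s k - (1 / \<mu>) *\<^sub>R r k"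
        using \<mu>(1) by (simp add: scaleR_diff_right)
      finally show ?thesis by (auto simp: span_breakdown_eq)
    qed
    moreover have "r ` {..<k} \<subseteq> span (insert (s k) (s ` {..<k}))"
      using IH span_superset[of "r ` {..<k}"] span_mono[of "s ` {..<k}" "insert (s k) (s ` {..<k})"] by auto
    moreover have "s ` {..<k} \<subseteq> span (insert (r k) (r ` {..<k}))"
      using IH span_superset[of "s ` {..<k}"] span_mono[of "r ` {..<k}" "insert (r k) (r ` {..<k})"] by auto
    ultimately show ?case unfolding lessThan_Suc image_insert
      by (intro equalityI span_minimal subspace_span) auto
  qed simp
  \<comment> \<open>Stated for arbitrary \<open>p\<close> and \<open>q\<close> because the two
    families exchange roles below.\<close>
  have aux: False if pq: "span (p ` {..h\<^sub>1}) = span (q ` {..h\<^sub>1})" "\<And>k. p k \<in> span (p ` {..h\<^sub>1})"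
    "q (Suc h\<^sub>1) \<notin> span (q ` {..<Suc h\<^sub>1})" "\<And>x. lex_neg (\<lambda>j. q j \<bullet> x) \<Longrightarrow> lex_neg (\<lambda>j. p j \<bullet> x)"
    for h\<^sub>1 and p q :: "nat \<Rightarrow> 'a"
  proof -
    obtain z where "\<forall>y\<in>q ` {..<Suc h\<^sub>1}. y \<bullet> z = 0" "q (Suc h\<^sub>1) \<bullet> z > 0"
      using notin_span_separate[OF pq(3)] by blast
    then have z: "\<And>j. j \<le> h\<^sub>1 \<Longrightarrow> q j \<bullet> z = 0" "q (Suc h\<^sub>1) \<bullet> z > 0"
      by (auto simp: less_Suc_eq_le)
    then have "lex_neg (\<lambda>j. q j \<bullet> (- z))"
      unfolding lex_neg_def by (intro exI[of _ "Suc h\<^sub>1"]) (auto simp: less_Suc_eq_le)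
    then have "lex_neg (\<lambda>j. p j \<bullet> (- z))" by (rule pq(4))
    moreover have "p j \<bullet> z = 0" for j
    proof -
      have "p j \<in> span (q ` {..h\<^sub>1})" using pq(1,2) by blast
      then show ?thesis
        by (induction rule: span_induct) (use z(1) in \<open>auto simp: subspace_def inner_add_left\<close>)
    qed
    ultimately show False by (auto simp: lex_neg_def)
  qed
  show "h = h'"
  proof (cases h h' rule: linorder_cases)
    case less
    then show ?thesis using aux[of r h s] span_eq[of "Suc h"] r(2) s(1)[of "Suc h"] lex
      by (simp add: lessThan_Suc_atMost)
  next
    case greater
    then show ?thesis using aux[of s h' r] span_eq[of "Suc h'"] s(2) r(1)[of "Suc h'"] lex
      by (simp add: lessThan_Suc_atMost)
  qed
  have "\<exists>\<mu> u. \<mu> > 0 \<and> r k = \<mu> *\<^sub>R s k + (\<Sum>j<k. u j *\<^sub>R s j)" if kh: "k \<le> h" for k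
  proof -
    obtain \<mu> where \<mu>: "\<mu> > 0" "r k - \<mu> *\<^sub>R s k \<in> span (s ` {..<k})"
      using lex_neg_proportional[OF span_eq[of k] r(1)[of k] s(1)[of k]] lex kh \<open>h = h'\<close> by auto
    obtain u where "r k - \<mu> *\<^sub>R s k = (\<Sum>j<k. u j *\<^sub>R s j)"
      using span_image_lessThan_coeffs[OF \<mu>(2)] by blast
    then have "r k = \<mu> *\<^sub>R s k + (\<Sum>j<k. u j *\<^sub>R s j)" by (simp add: algebra_simps)
    with \<mu>(1) show ?thesis by blast
  qed
  then obtain \<mu> u where \<mu>: "\<And>k. k \<le> h \<Longrightarrow> \<mu> k > 0"
    "\<And>k. k \<le> h \<Longrightarrow> r k = \<mu> k *\<^sub>R s k + (\<Sum>j<k. u k j *\<^sub>R s j)" by metis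
  define M where "M i j = (if j < i then u i j else if j = i then \<mu> i else (0::real))" for i j
  have "r i = (\<Sum>j\<le>h. M i j *\<^sub>R s j)" if "i \<le> h" for i
  proof -
    have "(\<Sum>j\<le>h. M i j *\<^sub>R s j) = (\<Sum>j\<le>i. M i j *\<^sub>R s j)"
      by (rule sum.mono_neutral_right) (use that in \<open>auto simp: M_def\<close>)
    also have "\<dots> = (\<Sum>j<i. M i j *\<^sub>R s j) + M i i *\<^sub>R s i"
      by (simp add: lessThan_Suc_atMost[symmetric])
    also have "\<dots> = r i" using \<mu>(2)[OF that] by (simp add: M_def)
    finally show ?thesis by simp
  qed
  then show "\<exists>M. (\<forall>i\<le>h. \<forall>j\<le>h. i < j \<longrightarrow> M i j = 0) \<and> (\<forall>i\<le>h. M i i > 0) \<and>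
    (\<forall>i\<le>h. r i = (\<Sum>j\<le>h. M i j *\<^sub>R s j))"
    using \<mu>(1) by (intro exI[of _ M]) (simp add: M_def)
qed

text \<open>Row \<open>k\<close> is \<open>M k k\<close> times row \<open>k\<close> of the second
  mode plus earlier rows. Multiplying by \<open>A\<^sub>2\<close> shifts this to row
  \<open>k + 1\<close>, which is converted back by the diagonal entry there; hence the factor
  \<open>M k k / M (Suc k) (Suc k)\<close>, positive because the diagonal is.\<close>

lemma triangular_rows_mode_two:
  fixes A\<^sub>1 A\<^sub>2 :: "real^'n^'n" and M :: "nat \<Rightarrow> nat \<Rightarrow> real"
  assumes M: "\<And>i j. \<lbrakk>i \<le> h; j \<le> h; i < j\<rbrakk> \<Longrightarrow> M i j = 0" "\<And>i. i \<le> h \<Longrightarrow> M i i > 0"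
    "\<And>i. i \<le> h \<Longrightarrow> obs_row c A\<^sub>1 i = (\<Sum>j\<le>h. M i j *\<^sub>R obs_row c A\<^sub>2 j)"
    and "k < h"
  obtains \<alpha> where "\<alpha> > 0"
    "obs_row c A\<^sub>1 k v* A\<^sub>2 - \<alpha> *\<^sub>R obs_row c A\<^sub>1 (Suc k) \<in> span (obs_row c A\<^sub>1 ` {..k})"
proof -
  let ?r = "obs_row c A\<^sub>1" and ?s = "obs_row c A\<^sub>2"
  have split: "?r i - M i i *\<^sub>R ?s i \<in> span (?s ` {..<i})" if "i \<le> h" for i
  proof -
    have "?r i = (\<Sum>j\<le>i. M i j *\<^sub>R ?s j)"
      unfolding M(3)[OF that] by (rule sum.mono_neutral_right) (use that M(1) in auto)
    then have "?r i - M i i *\<^sub>R ?s i = (\<Sum>j<i. M i j *\<^sub>R ?s j)"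
      by (simp add: lessThan_Suc_atMost[symmetric])
    then show ?thesis by (simp only:) (intro span_sum span_scale span_base imageI, simp)
  qed
  \<comment> \<open>Inverts the triangular relation at the level of spans: remainders arise in rows
    of the second mode but must be expressed by those of the first.\<close>
  have span_le: "span (?s ` {..<i}) \<subseteq> span (?r ` {..<i})" if "i \<le> Suc h" for i
    using that
  proof (induction i)
    case (Suc i)
    then have IH: "span (?s ` {..<i}) \<subseteq> span (?r ` {..<i})" by simp
    have "(- 1 / M i i) *\<^sub>R (?r i - M i i *\<^sub>R ?s i) \<in> span (?r ` {..<i})"
      using split[of i] IH Suc.prems by (intro span_scale) auto
    also have "(- 1 / M i i) *\<^sub>R (?r i - M i i *\<^sub>R ?s i) = ?s i - (1 / M i i) *\<^sub>R ?r i"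
      using M(2)[of i] Suc.prems by (simp add: scaleR_diff_right)
    finally have "?s i \<in> span (insert (?r i) (?r ` {..<i}))" by (auto simp: span_breakdown_eq)
    moreover have "?s ` {..<i} \<subseteq> span (insert (?r i) (?r ` {..<i}))"
      using IH span_superset[of "?s ` {..<i}"] span_mono[of "?r ` {..<i}" "insert (?r i) (?r ` {..<i})"] by auto
    ultimately show ?case unfolding lessThan_Suc image_insert
      by (intro span_minimal subspace_span) auto
  qed simp
  have to_r: "w \<in> span (?r ` {..k})" if "w \<in> span (?s ` {..k})" for w
    using span_le[of "Suc k"] that \<open>k < h\<close> by (auto simp: lessThan_Suc_atMost)
  define \<alpha> where "\<alpha> = M k k / M (Suc k) (Suc k)"
  have \<alpha>: "\<alpha> > 0" "\<alpha> * M (Suc k) (Suc k) = M k k"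
    using M(2)[of k] M(2)[of "Suc k"] \<open>k < h\<close> by (auto simp: \<alpha>_def)
  define u where "u = ?r k - M k k *\<^sub>R ?s k"
  define u' where "u' = ?r (Suc k) - M (Suc k) (Suc k) *\<^sub>R ?s (Suc k)"
  have "(\<lambda>w. w v* A\<^sub>2) ` ?s ` {..<k} \<subseteq> ?s ` {..k}"
    by (auto simp flip: obs_row_Suc)
  from span_mono[OF this] vector_matrix_mult_span[OF split[of k], of A\<^sub>2] \<open>k < h\<close>
  have "u v* A\<^sub>2 \<in> span (?s ` {..k})" unfolding u_def by (auto dest: subsetD)
  moreover have "u' \<in> span (?s ` {..k})"
    using split[of "Suc k"] \<open>k < h\<close> unfolding u'_def by (simp add: lessThan_Suc_atMost)
  ultimately have "u v* A\<^sub>2 - \<alpha> *\<^sub>R u' \<in> span (?r ` {..k})"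
    by (intro to_r span_diff span_scale)
  also have "u v* A\<^sub>2 - \<alpha> *\<^sub>R u' = ?r k v* A\<^sub>2 - \<alpha> *\<^sub>R ?r (Suc k)"
  proof -
    have "?r k v* A\<^sub>2 = (u + M k k *\<^sub>R ?s k) v* A\<^sub>2" by (simp add: u_def)
    also have "\<dots> = u v* A\<^sub>2 + M k k *\<^sub>R ?s (Suc k)"
      by (simp add: vector_matrix_left_distrib scaleR_vector_matrix_assoc obs_row_Suc)
    also have "M k k *\<^sub>R ?s (Suc k) = \<alpha> *\<^sub>R (?r (Suc k) - u')"
      using \<alpha>(2) by (simp add: u'_def)
    finally show ?thesis by (simp add: scaleR_diff_right)
  qed
  finally show ?thesis using that \<alpha>(1) by blast
qed

section \<open>Sufficiency of the conditions for right-uniqueness\<close>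

lemma filippov_mapE:
  assumes "v \<in> filippov_map c A\<^sub>1 A\<^sub>2 x"
  obtains s where "0 \<le> s" "s \<le> 1" "v = (1 - s) *\<^sub>R (A\<^sub>1 *v x) + s *\<^sub>R (A\<^sub>2 *v x)"
proof -
  have "v \<in> convex hull {A\<^sub>1 *v x, A\<^sub>2 *v x}"
    using assms by (auto simp: filippov_map_def hull_inc split: if_splits)
  then show ?thesis using that unfolding segment_convex_hull[symmetric] in_segment by blast
qed

text \<open>Lets the existence theorem for the inclusion produce trajectories of a single linear
  system.\<close>

lemma filippov_map_same [simp]: "filippov_map c A A x = {A *v x}"
  by (simp add: filippov_map_def)

text \<open>The sign \<open>\<sigma> \<in> {1, -1}\<close> covers both modes at once.\<close>

lemma filippov_solution_lex_neg:
  fixes A\<^sub>1 A\<^sub>2 :: "real^'n^'n" and M :: "nat \<Rightarrow> nat \<Rightarrow> real"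
  assumes M: "\<And>i j. \<lbrakk>i \<le> h; j \<le> h; i < j\<rbrakk> \<Longrightarrow> M i j = 0" "\<And>i. i \<le> h \<Longrightarrow> M i i > 0"
    "\<And>i. i \<le> h \<Longrightarrow> obs_row c A\<^sub>1 i = (\<Sum>j\<le>h. M i j *\<^sub>R obs_row c A\<^sub>2 j)"
    and x: "filippov_solution c A\<^sub>1 A\<^sub>2 \<xi> x" and \<sigma>: "\<bar>\<sigma>\<bar> = 1"
    and k: "k \<le> h" "\<And>j. j < k \<Longrightarrow> obs_row c A\<^sub>1 j \<bullet> \<xi> = 0" "\<sigma> * (obs_row c A\<^sub>1 k \<bullet> \<xi>) < 0"
  shows "\<exists>\<epsilon>>0. \<forall>t\<in>{0<..\<epsilon>}. \<sigma> * (c \<bullet> x t) < 0"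
proof -
  let ?r = "obs_row c A\<^sub>1"
  have x0: "x 0 = \<xi>" and ac: "\<And>a b. absolutely_continuous_on_Icc a b x"
    and ae: "AE t in lebesgue. \<exists>v\<in>filippov_map c A\<^sub>1 A\<^sub>2 (x t). (x has_vector_derivative v) (at t)"
    using x by (auto simp: filippov_solution_def)
  have "\<exists>\<alpha> C. \<alpha> > 0 \<and> C \<ge> 0 \<and> (\<forall>y. \<bar>(?r j v* A\<^sub>2 - \<alpha> *\<^sub>R ?r (Suc j)) \<bullet> y\<bar> \<le> C * (\<Sum>i\<le>j. \<bar>?r i \<bullet> y\<bar>))"
    if "j < k" for j
  proof -
    obtain \<alpha> where \<alpha>: "\<alpha> > 0" "?r j v* A\<^sub>2 - \<alpha> *\<^sub>R ?r (Suc j) \<in> span (?r ` {..j})"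
      using triangular_rows_mode_two[of h M c A\<^sub>1 A\<^sub>2 j, OF M] \<open>j < k\<close> k(1)
      by (metis order.strict_trans1 order_less_le_trans)
    from span_inner_bound[OF \<alpha>(2)] \<alpha>(1) show ?thesis by metis
  qed
  then obtain \<alpha> C where \<alpha>: "\<And>j. j < k \<Longrightarrow> \<alpha> j > 0" and C: "\<And>j. j < k \<Longrightarrow> C j \<ge> 0"
    and bound: "\<And>j y. j < k \<Longrightarrow> \<bar>(?r j v* A\<^sub>2 - \<alpha> j *\<^sub>R ?r (Suc j)) \<bullet> y\<bar> \<le> C j * (\<Sum>i\<le>j. \<bar>?r i \<bullet> y\<bar>)"
    by metis
  \<comment> \<open>The entry 1 is the coefficient of the first mode; it also keeps the set nonempty
    when \<open>k = 0\<close>.\<close>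
  define m where "m = Min (insert 1 (\<alpha> ` {..<k}))"
  have m: "m > 0" "m \<le> 1" "\<And>j. j < k \<Longrightarrow> m \<le> \<alpha> j"
    using \<alpha> by (auto simp: m_def)
  define D where "D = 1 + (\<Sum>j<k. \<alpha> j + C j)"
  have D_ge: "\<alpha> j + C j \<le> D - 1" if "j < k" for j
    unfolding D_def using member_le_sum[of j "{..<k}" "\<lambda>j. \<alpha> j + C j"] that \<alpha> C
    by (simp add: less_imp_le add_nonneg_nonneg)
  have "(\<Sum>j<k. \<alpha> j + C j) \<ge> 0" using \<alpha> C by (intro sum_nonneg) (simp add: less_imp_le add_nonneg_nonneg)
  then have D1: "D \<ge> 1" by (simp add: D_def)
  define z where "z j t = \<sigma> * (?r j \<bullet> x t)" for j t
  have lin: "bounded_linear (\<lambda>y. \<sigma> * (?r j \<bullet> y))" for j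
    by (intro bounded_linear_const_mult bounded_linear_inner_right)
  have "\<exists>\<epsilon>>0. \<epsilon> \<le> 1 \<and> (\<forall>t\<in>{0<..\<epsilon>}. z 0 t < 0)"
  proof (rule triangular_system_negative[where k = k and m = m and C = D])
    show "absolutely_continuous_on_Icc 0 1 (z j)" for j
      unfolding z_def by (rule absolutely_continuous_on_Icc_bounded_linear[OF lin ac])
    show "AE t in lebesgue. 0 < t \<and> t < 1 \<longrightarrow> (\<forall>j<k. \<exists>d a. (z j has_real_derivative d) (at t) \<and>
      m \<le> a \<and> a \<le> D \<and> \<bar>d - a * z (Suc j) t\<bar> \<le> D * (\<Sum>i\<le>j. \<bar>z i t\<bar>))"
      using ae
    proof eventually_elim
      case (elim t)
      then obtain v where v: "v \<in> filippov_map c A\<^sub>1 A\<^sub>2 (x t)" "(x has_vector_derivative v) (at t)" by blast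
      \<comment> \<open>Which mode is active is forgotten; only a weight \<open>s\<close> in
        \<open>{0..1}\<close> is kept, and the estimates are uniform in it.\<close>
      from v(1) obtain s where s: "0 \<le> s" "s \<le> 1" "v = (1 - s) *\<^sub>R (A\<^sub>1 *v x t) + s *\<^sub>R (A\<^sub>2 *v x t)"
        by (rule filippov_mapE)
      have "\<exists>d a. (z j has_real_derivative d) (at t) \<and>
        m \<le> a \<and> a \<le> D \<and> \<bar>d - a * z (Suc j) t\<bar> \<le> D * (\<Sum>i\<le>j. \<bar>z i t\<bar>)" if j: "j < k" for j
      proof (intro exI conjI)
        show "(z j has_real_derivative \<sigma> * (?r j \<bullet> v)) (at t)"
          unfolding has_real_derivative_iff_has_vector_derivative z_def
          by (rule bounded_linear.has_vector_derivative[OF lin v(2)])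
        \<comment> \<open>Mode one turns row \<open>j\<close> into row \<open>j + 1\<close> exactly,
          mode two only up to the factor \<open>\<alpha> j\<close> and earlier rows; so the
          remainder carries the weight \<open>s\<close>.\<close>
        define a where "a = (1 - s) + s * \<alpha> j"
        have "(1 - s) * m + s * m \<le> a" unfolding a_def
          using s m(2) m(3)[OF j] mult_left_mono[of m 1 "1 - s"] mult_left_mono[of m "\<alpha> j" s] by simp
        then show "m \<le> a" by (simp add: algebra_simps)
        have "a \<le> (1 - s) * D + s * D" unfolding a_def
          using s D1 D_ge[OF j] C[OF j] mult_left_mono[of 1 D "1 - s"] mult_left_mono[of "\<alpha> j" D s] by simp
        then show "a \<le> D" by (simp add: algebra_simps)
        let ?w = "?r j v* A\<^sub>2 - \<alpha> j *\<^sub>R ?r (Suc j)"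
        have "?r j \<bullet> v - a * (?r (Suc j) \<bullet> x t) = s * (?w \<bullet> x t)"
          unfolding s(3) a_def
          by (simp add: inner_add_right inner_diff_left obs_row_Suc_inner dot_lmul_matrix algebra_simps)
        moreover have "\<sigma> * (?r j \<bullet> v) - a * z (Suc j) t = \<sigma> * (?r j \<bullet> v - a * (?r (Suc j) \<bullet> x t))"
          by (simp add: z_def right_diff_distrib)
        ultimately have "\<bar>\<sigma> * (?r j \<bullet> v) - a * z (Suc j) t\<bar> = \<bar>\<sigma> * (s * (?w \<bullet> x t))\<bar>"
          by (simp only:)
        also have "\<dots> = s * \<bar>?w \<bullet> x t\<bar>" using \<sigma> s by (simp add: abs_mult)
        also have "\<dots> \<le> 1 * (D * (\<Sum>i\<le>j. \<bar>?r i \<bullet> x t\<bar>))"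
        proof (rule mult_mono)
          have "C j \<le> D" using D_ge[OF j] \<alpha>[OF j] by simp
          then show "\<bar>?w \<bullet> x t\<bar> \<le> D * (\<Sum>i\<le>j. \<bar>?r i \<bullet> x t\<bar>)"
            using bound[OF j, of "x t"] by (meson mult_right_mono order_trans sum_nonneg abs_ge_zero)
        qed (use s in auto)
        also have "(\<Sum>i\<le>j. \<bar>?r i \<bullet> x t\<bar>) = (\<Sum>i\<le>j. \<bar>z i t\<bar>)"
          using \<sigma> by (simp add: z_def abs_mult)
        finally show "\<bar>\<sigma> * (?r j \<bullet> v) - a * z (Suc j) t\<bar> \<le> D * (\<Sum>i\<le>j. \<bar>z i t\<bar>)" by simp
      qed
      then show ?case by blast
    qed
  qed (use m D1 k x0 in \<open>auto simp: z_def\<close>)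
  then show ?thesis by (auto simp: z_def)
qed

text \<open>The growth bound compares the derivatives of two curves, not the curves with a fixed vector field;
  it holds for two solutions of one linear mode as well as near the common unobservable subspace.\<close>

lemma absolutely_continuous_eq_local:
  fixes x y :: "real \<Rightarrow> 'a::euclidean_space"
  assumes "absolutely_continuous_on_Icc 0 b x" "absolutely_continuous_on_Icc 0 b y" "b > 0" "x 0 = y 0" "C \<ge> 0"
    and ae: "AE t in lebesgue. 0 < t \<and> t < b \<longrightarrow> (\<exists>v w. (x has_vector_derivative v) (at t) \<and>
      (y has_vector_derivative w) (at t) \<and> norm (v - w) \<le> C * norm (x t - y t))"
  shows "\<exists>\<epsilon>>0. \<forall>t\<in>{0..\<epsilon>}. x t = y t"
proof -
  have "\<exists>\<epsilon>>0. \<epsilon> \<le> b \<and> (\<forall>t\<in>{0..\<epsilon>}. x t - y t = 0)"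
  proof (rule absolutely_continuous_linear_growth_zero)
    show "AE t in lebesgue. 0 < t \<and> t < b \<longrightarrow>
      (\<exists>d. ((\<lambda>t. x t - y t) has_vector_derivative d) (at t) \<and> norm d \<le> C * norm (x t - y t))"
      using ae by eventually_elim (blast intro: has_vector_derivative_diff)
  qed (use assms in \<open>auto intro: absolutely_continuous_on_Icc_diff\<close>)
  then show ?thesis by auto
qed

lemma filippov_right_unique_if_triangular:
  fixes A\<^sub>1 A\<^sub>2 :: "real^'n^'n" and M :: "nat \<Rightarrow> nat \<Rightarrow> real"
  assumes "c \<noteq> 0" "h = observability_index c A\<^sub>1"
    and M: "\<And>i j. \<lbrakk>i \<le> h; j \<le> h; i < j\<rbrakk> \<Longrightarrow> M i j = 0" "\<And>i. i \<le> h \<Longrightarrow> M i i > 0"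
    "\<And>i. i \<le> h \<Longrightarrow> obs_row c A\<^sub>1 i = (\<Sum>j\<le>h. M i j *\<^sub>R obs_row c A\<^sub>2 j)"
    and eq: "\<And>x. (\<And>k. k \<le> h \<Longrightarrow> obs_row c A\<^sub>1 k \<bullet> x = 0) \<Longrightarrow> A\<^sub>1 *v x = A\<^sub>2 *v x"
    and x: "filippov_solution c A\<^sub>1 A\<^sub>2 \<xi> x" and x': "filippov_solution c A\<^sub>1 A\<^sub>2 \<xi> x'"
  shows "\<exists>\<epsilon>>0. \<forall>t\<in>{0..\<epsilon>}. x t = x' t"
proof -
  let ?r = "obs_row c A\<^sub>1"
  note zero = obs_row_inner_eq_0[OF assms(1,2)]
  obtain K\<^sub>1 where K\<^sub>1: "K\<^sub>1 \<ge> 0" "\<And>y. norm (A\<^sub>1 *v y) \<le> K\<^sub>1 * norm y"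
    using matrix_vector_mult_bound by blast
  obtain K\<^sub>2 where K\<^sub>2: "K\<^sub>2 \<ge> 0" "\<And>y. norm (A\<^sub>2 *v y) \<le> K\<^sub>2 * norm y"
    using matrix_vector_mult_bound by blast
  have sign: "\<exists>\<epsilon>>0. \<forall>t\<in>{0<..\<epsilon>}. \<sigma> * (c \<bullet> y t) < 0"
    if "\<bar>\<sigma>\<bar> = 1" "lex_neg (\<lambda>k. \<sigma> * (?r k \<bullet> \<xi>))" "filippov_solution c A\<^sub>1 A\<^sub>2 \<xi> y" for \<sigma> y
  proof -
    obtain k where k: "\<And>j. j < k \<Longrightarrow> \<sigma> * (?r j \<bullet> \<xi>) = 0" "\<sigma> * (?r k \<bullet> \<xi>) < 0"
      using \<open>lex_neg (\<lambda>k. \<sigma> * (?r k \<bullet> \<xi>))\<close> unfolding lex_neg_def by blast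
    have \<sigma>0: "\<sigma> \<noteq> 0" using \<open>\<bar>\<sigma>\<bar> = 1\<close> by auto
    \<comment> \<open>Otherwise rows 0 to \<open>h\<close> vanish at \<open>\<xi>\<close> and with
      them all rows, including row \<open>k\<close>.\<close>
    have "k \<le> h"
    proof (rule ccontr)
      assume "\<not> k \<le> h"
      then have "?r j \<bullet> \<xi> = 0" if "j \<le> h" for j using k(1)[of j] \<sigma>0 that by simp
      then have "?r k \<bullet> \<xi> = 0" by (rule zero)
      then show False using k(2) by simp
    qed
    from filippov_solution_lex_neg[OF M that(3,1) this _ k(2)] k(1) \<sigma>0 show ?thesis by auto
  qed
  \<comment> \<open>Both solutions run inside one open half-space and hence follow the same linear
    system \<open>A\<close>; one Gronwall estimate settles both signs.\<close>
  have strict: "\<exists>\<epsilon>>0. \<forall>t\<in>{0..\<epsilon>}. x t = x' t"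
    if \<sigma>: "\<bar>\<sigma>\<bar> = 1" and lex: "lex_neg (\<lambda>k. \<sigma> * (?r k \<bullet> \<xi>))"
      and A: "\<And>y. \<sigma> * (c \<bullet> y) < 0 \<Longrightarrow> filippov_map c A\<^sub>1 A\<^sub>2 y = {A *v y}"
      and K: "K \<ge> 0" "\<And>y. norm (A *v y) \<le> K * norm y" for \<sigma> A K
  proof -
    obtain \<epsilon> \<epsilon>' where \<epsilon>: "\<epsilon> > 0" "\<And>t. t \<in> {0<..\<epsilon>} \<Longrightarrow> \<sigma> * (c \<bullet> x t) < 0"
      "\<epsilon>' > 0" "\<And>t. t \<in> {0<..\<epsilon>'} \<Longrightarrow> \<sigma> * (c \<bullet> x' t) < 0"
      using sign[OF \<sigma> lex x] sign[OF \<sigma> lex x'] by auto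
    have "AE t in lebesgue. \<exists>v\<in>filippov_map c A\<^sub>1 A\<^sub>2 (x t). (x has_vector_derivative v) (at t)"
      "AE t in lebesgue. \<exists>v\<in>filippov_map c A\<^sub>1 A\<^sub>2 (x' t). (x' has_vector_derivative v) (at t)"
      using x x' by (auto simp: filippov_solution_def)
    then have "AE t in lebesgue. 0 < t \<and> t < min \<epsilon> \<epsilon>' \<longrightarrow> (\<exists>v w. (x has_vector_derivative v) (at t) \<and>
      (x' has_vector_derivative w) (at t) \<and> norm (v - w) \<le> K * norm (x t - x' t))"
    proof eventually_elim
      case (elim t)
      show ?case
      proof
        assume t: "0 < t \<and> t < min \<epsilon> \<epsilon>'"
        then have "(x has_vector_derivative A *v x t) (at t)" "(x' has_vector_derivative A *v x' t) (at t)"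
          using elim A \<epsilon> by auto
        moreover have "norm (A *v x t - A *v x' t) \<le> K * norm (x t - x' t)"
          using K(2)[of "x t - x' t"] by (simp add: matrix_vector_mult_diff_distrib)
        ultimately show "\<exists>v w. (x has_vector_derivative v) (at t) \<and>
          (x' has_vector_derivative w) (at t) \<and> norm (v - w) \<le> K * norm (x t - x' t)" by blast
      qed
    qed
    then show ?thesis
      using x x' \<epsilon> K(1) by (intro absolutely_continuous_eq_local[of "min \<epsilon> \<epsilon>'"]) (auto simp: filippov_solution_def)
  qed
  consider "lex_neg (\<lambda>k. ?r k \<bullet> \<xi>)" | "lex_neg (\<lambda>k. - (?r k \<bullet> \<xi>))" | "\<And>k. ?r k \<bullet> \<xi> = 0"
    using lex_neg_cases by blast
  then show ?thesis
  proof cases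
    case 1
    then show ?thesis using strict[of 1 A\<^sub>1 K\<^sub>1] K\<^sub>1 by (simp add: filippov_map_def)
  next
    case 2
    then show ?thesis using strict[of "-1" A\<^sub>2 K\<^sub>2] K\<^sub>2 by (simp add: filippov_map_def)
  next
    case 3
    define V where "V = {x. \<forall>k\<le>h. ?r k \<bullet> x = 0}"
    have V: "subspace V" "\<xi> \<in> V"
      using 3 by (auto simp: V_def subspace_def inner_add_right)
    have V1: "A\<^sub>1 *v y \<in> V" if "y \<in> V" for y
      using zero[of y "Suc _"] that by (auto simp: V_def simp flip: obs_row_Suc_inner)
    have V_eq: "A\<^sub>1 *v y = A\<^sub>2 *v y" if "y \<in> V" for y using that by (auto simp: V_def intro: eq)
    have V2: "A\<^sub>2 *v y \<in> V" if "y \<in> V" for y using V1 V_eq that by metis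
    obtain y where y: "y 0 = \<xi>" "\<And>T. \<exists>L. L-lipschitz_on {0..T} y" "\<And>t. y t \<in> V"
      "AE t in lebesgue. 0 < t \<longrightarrow> (\<exists>v\<in>filippov_map c A\<^sub>1 A\<^sub>2 (y t). (y has_vector_derivative v) (at t))"
      by (rule filippov_forward_solution[OF V V1 V2, of c]) auto
    have "\<exists>\<epsilon>>0. \<forall>t\<in>{0..\<epsilon>}. x t = y t" if x: "filippov_solution c A\<^sub>1 A\<^sub>2 \<xi> x" for x
    proof (rule absolutely_continuous_eq_local[of 1 _ _ "K\<^sub>1 + K\<^sub>2"])
      show "absolutely_continuous_on_Icc 0 1 x" "x 0 = y 0"
        using x y(1) by (auto simp: filippov_solution_def)
      show "absolutely_continuous_on_Icc 0 1 y"
        using y(2) lipschitz_imp_absolutely_continuous_on_Icc by blast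
      have "AE t in lebesgue. \<exists>v\<in>filippov_map c A\<^sub>1 A\<^sub>2 (x t). (x has_vector_derivative v) (at t)"
        using x by (auto simp: filippov_solution_def)
      with y(4) show "AE t in lebesgue. 0 < t \<and> t < 1 \<longrightarrow> (\<exists>v w. (x has_vector_derivative v) (at t) \<and>
        (y has_vector_derivative w) (at t) \<and> norm (v - w) \<le> (K\<^sub>1 + K\<^sub>2) * norm (x t - y t))"
      proof eventually_elim
        case (elim t)
        show ?case
        proof
          assume "0 < t \<and> t < 1"
          then obtain v w where v: "v \<in> filippov_map c A\<^sub>1 A\<^sub>2 (x t)" "(x has_vector_derivative v) (at t)"
            and w: "w \<in> filippov_map c A\<^sub>1 A\<^sub>2 (y t)" "(y has_vector_derivative w) (at t)"
            using elim by blast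
          obtain s where s: "0 \<le> s" "s \<le> 1" "v = (1 - s) *\<^sub>R (A\<^sub>1 *v x t) + s *\<^sub>R (A\<^sub>2 *v x t)"
            by (rule filippov_mapE[OF v(1)])
          \<comment> \<open>On \<open>V\<close> the modes agree, so \<open>w\<close> may be
            rewritten with the weight \<open>s\<close> that belongs to \<open>v\<close>; the
            difference is then linear in \<open>x t - y t\<close>, whichever side of the hyperplane
            \<open>x t\<close> is on.\<close>
          have "w = (1 - s) *\<^sub>R (A\<^sub>1 *v y t) + s *\<^sub>R (A\<^sub>2 *v y t)"
            using w(1) V_eq[OF y(3), of t] by (auto simp: filippov_map_def algebra_simps split: if_splits)
          then have "v - w = (1 - s) *\<^sub>R (A\<^sub>1 *v (x t - y t)) + s *\<^sub>R (A\<^sub>2 *v (x t - y t))"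
            unfolding s(3) by (simp add: matrix_vector_mult_diff_distrib algebra_simps)
          also have "norm \<dots> \<le> (1 - s) * norm (A\<^sub>1 *v (x t - y t)) + s * norm (A\<^sub>2 *v (x t - y t))"
            by (rule order_trans[OF norm_triangle_ineq]) (use s in simp)
          also have "\<dots> \<le> 1 * (K\<^sub>1 * norm (x t - y t)) + 1 * (K\<^sub>2 * norm (x t - y t))"
            by (intro add_mono mult_mono K\<^sub>1 K\<^sub>2) (use s in auto)
          finally have "norm (v - w) \<le> (K\<^sub>1 + K\<^sub>2) * norm (x t - y t)" by (simp add: algebra_simps)
          with v(2) w(2) show "\<exists>v w. (x has_vector_derivative v) (at t) \<and>
            (y has_vector_derivative w) (at t) \<and> norm (v - w) \<le> (K\<^sub>1 + K\<^sub>2) * norm (x t - y t)" by blast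
        qed
      qed
    qed (use K\<^sub>1 K\<^sub>2 in auto)
    from this[OF x] this[OF x'] obtain \<epsilon> \<epsilon>' where "\<epsilon> > 0" "\<epsilon>' > 0"
      "\<And>t. t \<in> {0..\<epsilon>} \<Longrightarrow> x t = y t" "\<And>t. t \<in> {0..\<epsilon>'} \<Longrightarrow> x' t = y t" by blast
    then show ?thesis by (intro exI[of _ "min \<epsilon> \<epsilon>'"]) auto
  qed
qed

section \<open>Necessity: following either mode from the same state\<close>

lemma linear_mode_solution:
  fixes A :: "real^'n^'n"
  assumes \<sigma>: "\<bar>\<sigma>\<bar> = 1"
    and lex: "lex_neg (\<lambda>k. \<sigma> * (obs_row c A k \<bullet> \<xi>)) \<or> (\<forall>k. obs_row c A k \<bullet> \<xi> = 0)"
  obtains y \<epsilon> where "\<epsilon> > 0" "y 0 = \<xi>" "\<And>T. \<exists>L. L-lipschitz_on {0..T} y"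
    "AE t in lebesgue. 0 < t \<longrightarrow> (y has_vector_derivative A *v y t) (at t)"
    "\<And>t. t \<in> {0..\<epsilon>} \<Longrightarrow> \<sigma> * (c \<bullet> y t) \<le> 0"
    "\<And>t. \<lbrakk>lex_neg (\<lambda>k. \<sigma> * (obs_row c A k \<bullet> \<xi>)); t \<in> {0<..\<epsilon>}\<rbrakk> \<Longrightarrow> \<sigma> * (c \<bullet> y t) < 0"
proof -
  let ?r = "obs_row c A"
  \<comment> \<open>If all rows vanish at \<open>\<xi>\<close>, the trajectory must be kept in the
    unobservable subspace, where \<open>c \<bullet> y\<close> is 0; otherwise there is no
    constraint.\<close>
  define V where "V = (if \<forall>k. ?r k \<bullet> \<xi> = 0 then {x. \<forall>k. ?r k \<bullet> x = 0} else UNIV)"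
  have V: "subspace V" "\<xi> \<in> V" by (auto simp: V_def subspace_def inner_add_right)
  have VA: "A *v y \<in> V" if "y \<in> V" for y
    using that by (auto simp: V_def simp flip: obs_row_Suc_inner split: if_splits)
  \<comment> \<open>With both matrices equal to \<open>A\<close>, the inclusion is the linear
    equation.\<close>
  obtain y where y: "y 0 = \<xi>" "\<And>T. \<exists>L. L-lipschitz_on {0..T} y" "\<And>t. y t \<in> V"
    "AE t in lebesgue. 0 < t \<longrightarrow> (\<exists>v\<in>filippov_map c A A (y t). (y has_vector_derivative v) (at t))"
    by (rule filippov_forward_solution[OF V VA VA, of c]) auto
  have ae: "AE t in lebesgue. 0 < t \<longrightarrow> (y has_vector_derivative A *v y t) (at t)" using y(4) by simp
  show ?thesis
  proof (cases "lex_neg (\<lambda>k. \<sigma> * (?r k \<bullet> \<xi>))")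
    case False
    then have "c \<bullet> y t = 0" for t
      using y(3)[of t] lex obs_row_0[of c A] by (metis (mono_tags, lifting) V_def mem_Collect_eq)
    then show ?thesis using that[of 1 y] y(1,2) ae False by simp
  next
    case True
    then obtain k where k: "\<And>j. j < k \<Longrightarrow> \<sigma> * (?r j \<bullet> \<xi>) = 0" "\<sigma> * (?r k \<bullet> \<xi>) < 0"
      unfolding lex_neg_def by blast
    define z where "z j t = \<sigma> * (?r j \<bullet> y t)" for j t
    have lin: "bounded_linear (\<lambda>y. \<sigma> * (?r j \<bullet> y))" for j
      by (intro bounded_linear_const_mult bounded_linear_inner_right)
    obtain L where "L-lipschitz_on {0..1} y" using y(2) by blast
    then have ac: "absolutely_continuous_on_Icc 0 1 y" by (rule lipschitz_imp_absolutely_continuous_on_Icc)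
    \<comment> \<open>For a single mode the chain is exact: coefficient 1, no perturbation.\<close>
    have "\<exists>\<epsilon>>0. \<epsilon> \<le> 1 \<and> (\<forall>t\<in>{0<..\<epsilon>}. z 0 t < 0)"
    proof (rule triangular_system_negative[where k = k and m = 1 and C = 1])
      show "absolutely_continuous_on_Icc 0 1 (z j)" for j
        unfolding z_def by (rule absolutely_continuous_on_Icc_bounded_linear[OF lin ac])
      show "AE t in lebesgue. 0 < t \<and> t < 1 \<longrightarrow> (\<forall>j<k. \<exists>d a. (z j has_real_derivative d) (at t) \<and>
        1 \<le> a \<and> a \<le> 1 \<and> \<bar>d - a * z (Suc j) t\<bar> \<le> 1 * (\<Sum>i\<le>j. \<bar>z i t\<bar>))"
        using ae
      proof eventually_elim
        case (elim t)
        have "(z j has_real_derivative z (Suc j) t) (at t)" if "0 < t" for j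
          unfolding has_real_derivative_iff_has_vector_derivative z_def obs_row_Suc_inner
          by (rule bounded_linear.has_vector_derivative[OF lin]) (use elim that in simp)
        then show ?case
          by (intro impI allI, rule_tac x = "z (Suc j) t" in exI, rule_tac x = 1 in exI) (simp add: sum_nonneg)
      qed
    qed (use k y(1) in \<open>auto simp: z_def\<close>)
    then obtain \<epsilon> where \<epsilon>: "\<epsilon> > 0" "\<And>t. t \<in> {0<..\<epsilon>} \<Longrightarrow> \<sigma> * (c \<bullet> y t) < 0"
      by (auto simp: z_def)
    \<comment> \<open>At time 0 only the weak inequality is available: \<open>c\<close> is row 0,
      which may still vanish at \<open>\<xi>\<close>.\<close>
    have "\<sigma> * (c \<bullet> \<xi>) \<le> 0" using k(2) k(1)[of 0] by (cases k) auto
    then have "\<sigma> * (c \<bullet> y t) \<le> 0" if "t \<in> {0..\<epsilon>}" for t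
      using \<epsilon>(2)[of t] that y(1) by (cases "t = 0") auto
    then show ?thesis using that[of \<epsilon> y] \<epsilon> y(1,2) ae by blast
  qed
qed

text \<open>From \<open>\<xi>\<close>, mode one can be followed with
  \<open>c \<bullet> x \<le> 0\<close> and mode two with \<open>c \<bullet> x \<ge> 0\<close>; on
  the hyperplane the hull contains both velocities, so both curves are pieces of Filippov solutions.
  Uniqueness merges them, which rules out a strict sign on either side.\<close>

lemma two_modes_agree:
  fixes A\<^sub>1 A\<^sub>2 :: "real^'n^'n"
  assumes uniq: "\<And>x. filippov_solution c A\<^sub>1 A\<^sub>2 \<xi> x \<Longrightarrow> filippov_right_unique c A\<^sub>1 A\<^sub>2 \<xi> x"
    and lex\<^sub>1: "lex_neg (\<lambda>k. obs_row c A\<^sub>1 k \<bullet> \<xi>) \<or> (\<forall>k. obs_row c A\<^sub>1 k \<bullet> \<xi> = 0)"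
    and lex\<^sub>2: "lex_neg (\<lambda>k. - (obs_row c A\<^sub>2 k \<bullet> \<xi>)) \<or> (\<forall>k. obs_row c A\<^sub>2 k \<bullet> \<xi> = 0)"
  shows "\<not> lex_neg (\<lambda>k. obs_row c A\<^sub>1 k \<bullet> \<xi>)" "\<not> lex_neg (\<lambda>k. - (obs_row c A\<^sub>2 k \<bullet> \<xi>))"
    "A\<^sub>1 *v \<xi> = A\<^sub>2 *v \<xi>"
proof -
  obtain y\<^sub>1 \<epsilon>\<^sub>1 where y\<^sub>1: "\<epsilon>\<^sub>1 > 0" "y\<^sub>1 0 = \<xi>" "\<And>T. \<exists>L. L-lipschitz_on {0..T} y\<^sub>1"
    "AE t in lebesgue. 0 < t \<longrightarrow> (y\<^sub>1 has_vector_derivative A\<^sub>1 *v y\<^sub>1 t) (at t)"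
    "\<And>t. t \<in> {0..\<epsilon>\<^sub>1} \<Longrightarrow> 1 * (c \<bullet> y\<^sub>1 t) \<le> 0"
    "\<And>t. \<lbrakk>lex_neg (\<lambda>k. 1 * (obs_row c A\<^sub>1 k \<bullet> \<xi>)); t \<in> {0<..\<epsilon>\<^sub>1}\<rbrakk> \<Longrightarrow> 1 * (c \<bullet> y\<^sub>1 t) < 0"
    by (rule linear_mode_solution[of 1 c A\<^sub>1 \<xi>]) (use lex\<^sub>1 in auto)
  obtain y\<^sub>2 \<epsilon>\<^sub>2 where y\<^sub>2: "\<epsilon>\<^sub>2 > 0" "y\<^sub>2 0 = \<xi>" "\<And>T. \<exists>L. L-lipschitz_on {0..T} y\<^sub>2"
    "AE t in lebesgue. 0 < t \<longrightarrow> (y\<^sub>2 has_vector_derivative A\<^sub>2 *v y\<^sub>2 t) (at t)"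
    "\<And>t. t \<in> {0..\<epsilon>\<^sub>2} \<Longrightarrow> - 1 * (c \<bullet> y\<^sub>2 t) \<le> 0"
    "\<And>t. \<lbrakk>lex_neg (\<lambda>k. - 1 * (obs_row c A\<^sub>2 k \<bullet> \<xi>)); t \<in> {0<..\<epsilon>\<^sub>2}\<rbrakk> \<Longrightarrow> - 1 * (c \<bullet> y\<^sub>2 t) < 0"
    by (rule linear_mode_solution[of "-1" c A\<^sub>2 \<xi>]) (use lex\<^sub>2 in auto)
  define \<epsilon> where "\<epsilon> = min \<epsilon>\<^sub>1 \<epsilon>\<^sub>2"
  have "\<epsilon> > 0" using y\<^sub>1 y\<^sub>2 by (simp add: \<epsilon>_def)
  have "AE t in lebesgue. 0 < t \<and> t < \<epsilon> \<longrightarrow>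
      (\<exists>v\<in>filippov_map c A\<^sub>1 A\<^sub>2 (y\<^sub>1 t). (y\<^sub>1 has_vector_derivative v) (at t))"
    using y\<^sub>1(4)
  proof eventually_elim
    case (elim t)
    have "A\<^sub>1 *v y\<^sub>1 t \<in> filippov_map c A\<^sub>1 A\<^sub>2 (y\<^sub>1 t)" if "0 < t \<and> t < \<epsilon>"
      using y\<^sub>1(5)[of t] that by (auto simp: \<epsilon>_def filippov_map_def hull_inc)
    then show ?case using elim by blast
  qed
  moreover obtain L\<^sub>1 where "L\<^sub>1-lipschitz_on {0..\<epsilon>} y\<^sub>1" using y\<^sub>1(3) by blast
  ultimately obtain x\<^sub>1 where x\<^sub>1: "filippov_solution c A\<^sub>1 A\<^sub>2 \<xi> x\<^sub>1" "\<And>t. t \<in> {0..\<epsilon>} \<Longrightarrow> x\<^sub>1 t = y\<^sub>1 t"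
    using filippov_solution_extend[OF \<open>\<epsilon> > 0\<close>, of L\<^sub>1 y\<^sub>1 c A\<^sub>1 A\<^sub>2] y\<^sub>1(2) by metis
  have "AE t in lebesgue. 0 < t \<and> t < \<epsilon> \<longrightarrow>
      (\<exists>v\<in>filippov_map c A\<^sub>1 A\<^sub>2 (y\<^sub>2 t). (y\<^sub>2 has_vector_derivative v) (at t))"
    using y\<^sub>2(4)
  proof eventually_elim
    case (elim t)
    have "A\<^sub>2 *v y\<^sub>2 t \<in> filippov_map c A\<^sub>1 A\<^sub>2 (y\<^sub>2 t)" if "0 < t \<and> t < \<epsilon>"
      using y\<^sub>2(5)[of t] that by (auto simp: \<epsilon>_def filippov_map_def hull_inc)
    then show ?case using elim by blast
  qed
  moreover obtain L\<^sub>2 where "L\<^sub>2-lipschitz_on {0..\<epsilon>} y\<^sub>2" using y\<^sub>2(3) by blast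
  ultimately obtain x\<^sub>2 where x\<^sub>2: "filippov_solution c A\<^sub>1 A\<^sub>2 \<xi> x\<^sub>2" "\<And>t. t \<in> {0..\<epsilon>} \<Longrightarrow> x\<^sub>2 t = y\<^sub>2 t"
    using filippov_solution_extend[OF \<open>\<epsilon> > 0\<close>, of L\<^sub>2 y\<^sub>2 c A\<^sub>1 A\<^sub>2] y\<^sub>2(2) by metis
  obtain \<delta> where "\<delta> > 0" and \<delta>: "\<And>t. t \<in> {0..<\<delta>} \<Longrightarrow> x\<^sub>1 t = x\<^sub>2 t"
    using uniq[OF x\<^sub>1(1)] x\<^sub>2(1) unfolding filippov_right_unique_def by blast
  define b where "b = min \<epsilon> \<delta>"
  have b: "b > 0" "b \<le> \<epsilon>\<^sub>1" "b \<le> \<epsilon>\<^sub>2" using \<open>\<epsilon> > 0\<close> \<open>\<delta> > 0\<close> by (auto simp: b_def \<epsilon>_def)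
  have eq: "y\<^sub>1 t = y\<^sub>2 t" if "t \<in> {0..<b}" for t
    using \<delta>[of t] x\<^sub>1(2)[of t] x\<^sub>2(2)[of t] that by (simp add: b_def)
  have mid: "b / 2 \<in> {0<..\<epsilon>\<^sub>1}" "b / 2 \<in> {0<..\<epsilon>\<^sub>2}" "b / 2 \<in> {0..\<epsilon>\<^sub>1}" "b / 2 \<in> {0..\<epsilon>\<^sub>2}" "b / 2 \<in> {0..<b}"
    using b by auto
  show "\<not> lex_neg (\<lambda>k. obs_row c A\<^sub>1 k \<bullet> \<xi>)"
    using y\<^sub>1(6)[OF _ mid(1)] y\<^sub>2(5)[OF mid(4)] eq[OF mid(5)] by auto
  show "\<not> lex_neg (\<lambda>k. - (obs_row c A\<^sub>2 k \<bullet> \<xi>))"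
    using y\<^sub>2(6)[OF _ mid(2)] y\<^sub>1(5)[OF mid(3)] eq[OF mid(5)] by auto
  show "A\<^sub>1 *v \<xi> = A\<^sub>2 *v \<xi>"
  proof (rule ccontr)
    \<comment> \<open>By continuity the two velocities would differ along the common curve on a
      whole interval, yet almost everywhere there both are its derivative; the interval would be a
      null set.\<close>
    assume neq: "A\<^sub>1 *v \<xi> \<noteq> A\<^sub>2 *v \<xi>"
    obtain L where "L-lipschitz_on {0..b} y\<^sub>1" using y\<^sub>1(3) by blast
    then have "continuous_on {0..b} (\<lambda>t. A\<^sub>1 *v y\<^sub>1 t - A\<^sub>2 *v y\<^sub>1 t)"
      by (intro continuous_intros bounded_linear.continuous_on[OF matrix_vector_mul_bounded_linear]
          lipschitz_on_continuous_on)
    from this[unfolded continuous_on_iff, rule_format, of 0 "norm (A\<^sub>1 *v \<xi> - A\<^sub>2 *v \<xi>)"]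
    obtain d where "d > 0" and d: "\<And>t. \<lbrakk>t \<in> {0..b}; t < d\<rbrakk> \<Longrightarrow>
      dist (A\<^sub>1 *v y\<^sub>1 t - A\<^sub>2 *v y\<^sub>1 t) (A\<^sub>1 *v \<xi> - A\<^sub>2 *v \<xi>) < norm (A\<^sub>1 *v \<xi> - A\<^sub>2 *v \<xi>)"
      using neq b y\<^sub>1(2) by (auto simp: dist_real_def)
    have "AE t in lebesgue. t \<notin> {0<..<min b d}"
      using y\<^sub>1(4) y\<^sub>2(4)
    proof eventually_elim
      case (elim t)
      show ?case
      proof
        assume t: "t \<in> {0<..<min b d}"
        have "(y\<^sub>2 has_vector_derivative A\<^sub>1 *v y\<^sub>1 t) (at t)"
          by (rule has_vector_derivative_transform_within_open[where S = "{0<..<b}" and f = y\<^sub>1])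
            (use t elim(1) eq in auto)
        moreover have "(y\<^sub>2 has_vector_derivative A\<^sub>2 *v y\<^sub>2 t) (at t)" using t elim(2) by simp
        ultimately have "A\<^sub>1 *v y\<^sub>1 t = A\<^sub>2 *v y\<^sub>2 t" by (rule vector_derivative_unique_at)
        then have "A\<^sub>1 *v y\<^sub>1 t - A\<^sub>2 *v y\<^sub>1 t = 0" using eq[of t] t by simp
        then show False using d[of t] t by (simp add: dist_norm norm_minus_commute)
      qed
    qed
    moreover have "{t. \<not> t \<notin> {0<..<min b d}} = box 0 (min b d)" by auto
    ultimately have "negligible (box 0 (min b d))"
      unfolding AE_lebesgue_iff_negligible by (simp only:)
    then show False unfolding negligible_interval using b \<open>d > 0\<close> by simp
  qed
qed

text \<open>If the second sequence is not negative, it is positive or zero, and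
  \<open>two_modes_agree\<close> at \<open>x\<close> forbids the first to be negative. The converse
  uses \<open>- x\<close>, where the second sequence is positive.\<close>

lemma lex_neg_iff_if_right_unique:
  fixes A\<^sub>1 A\<^sub>2 :: "real^'n^'n"
  assumes uniq: "\<And>\<xi> x. filippov_solution c A\<^sub>1 A\<^sub>2 \<xi> x \<Longrightarrow> filippov_right_unique c A\<^sub>1 A\<^sub>2 \<xi> x"
  shows "lex_neg (\<lambda>k. obs_row c A\<^sub>1 k \<bullet> x) \<longleftrightarrow> lex_neg (\<lambda>k. obs_row c A\<^sub>2 k \<bullet> x)"
proof
  assume "lex_neg (\<lambda>k. obs_row c A\<^sub>1 k \<bullet> x)"
  then show "lex_neg (\<lambda>k. obs_row c A\<^sub>2 k \<bullet> x)"
    using two_modes_agree(1)[OF uniq, of x] lex_neg_cases[of "\<lambda>k. obs_row c A\<^sub>2 k \<bullet> x"] by blast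
next
  assume "lex_neg (\<lambda>k. obs_row c A\<^sub>2 k \<bullet> x)"
  then show "lex_neg (\<lambda>k. obs_row c A\<^sub>1 k \<bullet> x)"
    using two_modes_agree(2)[OF uniq, of "- x"] lex_neg_cases[of "\<lambda>k. obs_row c A\<^sub>1 k \<bullet> x"] by auto
qed

theorem corollary3p5:
  fixes A\<^sub>1 A\<^sub>2 :: "real^'n^'n" and c :: "real^'n" and h\<^sub>1 h\<^sub>2 :: nat
  assumes "c \<noteq> 0"
    and "h\<^sub>1 = observability_index c A\<^sub>1"
    and "h\<^sub>2 = observability_index c A\<^sub>2"
  shows "(\<forall>\<xi> x. filippov_solution c A\<^sub>1 A\<^sub>2 \<xi> x \<longrightarrow> filippov_right_unique c A\<^sub>1 A\<^sub>2 \<xi> x) \<longleftrightarrow>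
    h\<^sub>1 = h\<^sub>2 \<and>
    (\<exists>M :: nat \<Rightarrow> nat \<Rightarrow> real.
       (\<forall>i\<le>h\<^sub>1. \<forall>j\<le>h\<^sub>1. i < j \<longrightarrow> M i j = 0) \<and>
       (\<forall>i\<le>h\<^sub>1. M i i > 0) \<and>
       (\<forall>i\<le>h\<^sub>1. obs_row c A\<^sub>1 i = (\<Sum>j\<le>h\<^sub>1. M i j *\<^sub>R obs_row c A\<^sub>2 j))) \<and>
    (\<forall>x :: real^'n. (\<forall>k\<le>h\<^sub>1. obs_row c A\<^sub>1 k \<bullet> x = 0) \<longrightarrow> A\<^sub>1 *v x = A\<^sub>2 *v x)"
proof -
  let ?r = "obs_row c A\<^sub>1" and ?s = "obs_row c A\<^sub>2"
  let ?U = "\<forall>\<xi> x. filippov_solution c A\<^sub>1 A\<^sub>2 \<xi> x \<longrightarrow> filippov_right_unique c A\<^sub>1 A\<^sub>2 \<xi> x"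
  let ?M = "\<lambda>M :: nat \<Rightarrow> nat \<Rightarrow> real. (\<forall>i\<le>h\<^sub>1. \<forall>j\<le>h\<^sub>1. i < j \<longrightarrow> M i j = 0) \<and> (\<forall>i\<le>h\<^sub>1. M i i > 0) \<and>
    (\<forall>i\<le>h\<^sub>1. ?r i = (\<Sum>j\<le>h\<^sub>1. M i j *\<^sub>R ?s j))"
  let ?E = "\<forall>x :: real^'n. (\<forall>k\<le>h\<^sub>1. ?r k \<bullet> x = 0) \<longrightarrow> A\<^sub>1 *v x = A\<^sub>2 *v x"
  have "h\<^sub>1 = h\<^sub>2 \<and> (\<exists>M. ?M M) \<and> ?E" if ?U
  proof -
    have uniq: "\<And>\<xi> x. filippov_solution c A\<^sub>1 A\<^sub>2 \<xi> x \<Longrightarrow> filippov_right_unique c A\<^sub>1 A\<^sub>2 \<xi> x"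
      using that by blast
    note lex = lex_neg_iff_if_right_unique[OF uniq]
    note rows = obs_row_notin_span[OF assms(1,2)] obs_row_in_span[OF assms(1,2)]
      obs_row_notin_span[OF assms(1,3)] obs_row_in_span[OF assms(1,3)]
    have "A\<^sub>1 *v x = A\<^sub>2 *v x" if "\<forall>k\<le>h\<^sub>1. ?r k \<bullet> x = 0" for x
    proof -
      \<comment> \<open>All rows of mode one vanish at \<open>x\<close>, so by \<open>lex\<close>
        mode two is negative neither at \<open>x\<close> nor at \<open>- x\<close>: its rows vanish
        too, and both modes may be followed from \<open>x\<close>.\<close>
      have r: "?r k \<bullet> x = 0" for k using obs_row_inner_eq_0[OF assms(1,2)] that by blast
      then have "\<not> lex_neg (\<lambda>k. ?r k \<bullet> x)" "\<not> lex_neg (\<lambda>k. ?r k \<bullet> - x)"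
        by (simp_all add: lex_neg_def)
      then have "\<not> lex_neg (\<lambda>k. ?s k \<bullet> x)" "\<not> lex_neg (\<lambda>k. ?s k \<bullet> - x)"
        using lex by blast+
      then have "\<forall>k. ?s k \<bullet> x = 0" using lex_neg_cases[of "\<lambda>k. ?s k \<bullet> x"] by simp
      then show ?thesis using two_modes_agree(3)[OF uniq, of x] r by blast
    qed
    then show ?thesis
      using lex_neg_rows_triangular[OF rows lex] by blast
  qed
  moreover have ?U if ME: "\<exists>M. ?M M" ?E
  proof -
    obtain M where M: "?M M" using ME(1) by blast
    show ?U
      unfolding filippov_right_unique_def
    proof (intro allI impI)
      fix \<xi> x x' assume x: "filippov_solution c A\<^sub>1 A\<^sub>2 \<xi> x" "filippov_solution c A\<^sub>1 A\<^sub>2 \<xi> x'"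
      have "\<exists>\<epsilon>>0. \<forall>t\<in>{0..\<epsilon>}. x t = x' t"
        by (rule filippov_right_unique_if_triangular[OF assms(1,2), of M A\<^sub>2 \<xi>]) (use M ME(2) x in auto)
      then show "\<exists>\<epsilon>>0. \<forall>t\<in>{0..<\<epsilon>}. x t = x' t" by force
    qed
  qed
  ultimately show ?thesis by blast
qed

end
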